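(* Let $\mathcal{E}_c$ be a non-degenerate crossing configuration with only one crossing point, and let $h$ be the local minimum index with $d_h(\mathcal{E}_c)=0$. Then there is a neighborhood $\mathcal{W}$ of $\mathcal{E}_c$ such that, for each component $y_k$ ($k=1,\dots,4$) of $Y=(G,Z,g,z)$, the averaged derivative $\frac{\overline{\partial R}}{\partial y_k}$ (defined off the crossing set $\{\tilde d_h=0\}$) can be extended to two Lipschitz-continuous maps $\left(\frac{\overline{\partial R}}{\partial y_k}\right)_h^{+}$ and $\left(\frac{\overline{\partial R}}{\partial y_k}\right)_h^{-}$ on $\mathcal{W}$. These maps, restricted respectively to $\mathcal{W}^+=\mathcal{W}\cap\{\tilde d_h>0\}$ and $\mathcal{W}^-=\mathcal{W}\cap\{\tilde d_h<0\}$, coincide with $\frac{\overline{\partial R}}{\partial y_k}$. Moreover, on $\mathcal{W}$, $$\left(\frac{\overline{\partial R}}{\partial y_k}\right)_h^{-}-\left(\frac{\overline{\partial R}}{\partial y_k}\right)_h^{+}=\frac{\mu k_0^2}{\pi}\left[\frac{\partial}{\partial y_k}\left(\frac{1}{\sqrt{\det \mathcal{A}_h}}\right)\tilde d_h+\frac{1}{\sqrt{\det\mathcal{A}_h}}\,\frac{\partial\tilde d_h}{\partial y_k}\right],$$ where the derivatives of $\tilde d_h$ are given by $\frac{\partial \tilde d_h}{\partial y_k}(\mathcal{E})=\hat\tau_3^{(h)}\cdot\frac{\partial\Delta}{\partial y_k}(\mathcal{E},V_h(\mathcal{E}))$ (the derivative of $\Delta$ being taken at fixed $V$).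
   Context: Orbits and elements. Two bodies (asteroid and planet, "Earth") move on bounded (elliptic) Keplerian orbits with a common focus (the Sun) at the origin of $\mathbb{R}^3$. Let $k_0>0$ be Gauss' constant and $\mu>0$ a small parameter (ratio of the planet mass to the Sun mass). For Keplerian elements $(a,e,I,\omega,\Omega,\ell)$ (semimajor axis, eccentricity, inclination, argument of perihelion, longitude of node, mean anomaly), Delaunay's elements are $L=k_0\sqrt a$, $G=k_0\sqrt{a(1-e^2)}$, $Z=k_0\sqrt{a(1-e^2)}\cos I$, $\ell$, $g=\omega$, $z=\Omega$. Write $E=(L,G,Z,g,z)$ and $E'=(L',G',Z',g',z')$ for the elements describing the trajectories of asteroid and planet, $\mathcal{E}=(E,E')\in\mathbb{R}^{10}$ for the two-orbit configuration, $V=(\ell,\ell')$ for the mean anomalies, a point of the torus $\mathbb{T}^2$ (of periods $2\pi$), and $Y=(G,Z,g,z)$. Elements range over the open set where they are regular coordinates, so that the heliocentric positions $\mathcal{X}=\mathcal{X}(E,\ell)$, $\mathcal{X}'=\mathcal{X}'(E',\ell')\in\mathbb{R}^3$ are analytic. Distance. $\Delta(\mathcal{E},V)=\mathcal{X}-\mathcal{X}'$ and $d(\mathcal{E},V)=|\mathcal{X}-\mathcal{X}'|$ (Keplerian distance function). $\mathcal{E}$ is non-degenerate if all critical points of $V\mapsto d^2(\mathcal{E},V)$ are non-degenerate. $\mathcal{E}_c$ is a crossing configuration if $d(\mathcal{E}_c,V)=0$ for some $V$; it has only one crossing point if there is exactly one such $V$. For $\mathcal{E}_c$ non-degenerate,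 the local minimum points $V_h(\mathcal{E})$ of $V\mapsto d^2(\mathcal{E},V)$ are defined (as smooth continuations of those at $\mathcal{E}_c$) for $\mathcal{E}$ near $\mathcal{E}_c$; $V_h=(\ell_h,\ell_h')$, $d_h(\mathcal{E})=d(\mathcal{E},V_h(\mathcal{E}))$, and $h$ is the index with $d_h(\mathcal{E}_c)=0$. Let $\mathcal{A}_h(\mathcal{E})=\frac12\frac{\partial^2 d^2}{\partial V^2}(\mathcal{E},V_h(\mathcal{E}))$ (a $2\times2$ matrix), $\tau_h=\frac{\partial\mathcal{X}}{\partial\ell}(E,\ell_h)$, $\tau_h'=\frac{\partial\mathcal{X}'}{\partial\ell'}(E',\ell_h')$, $\tau_3^{(h)}=\tau_h\times\tau_h'$, $\hat\tau_3^{(h)}=\tau_3^{(h)}/|\tau_3^{(h)}|$, $\Delta_h=\Delta(\mathcal{E},V_h)$. The signed distance is $\tilde d_h=(\hat\tau_3^{(h)}\cdot\hat\Delta_h)\,d_h$ with $\hat\Delta_h=\Delta_h/|\Delta_h|$ (and $\tilde d_h=0$ where $d_h=0$), equivalently $\tilde d_h=\hat\tau_3^{(h)}\cdot\Delta_h$; it is considered near $\mathcal{E}_c$, where $\tau_3^{(h)}\ne0$. Perturbing function and averages. $R=\mu k_0^2\left(\frac{1}{|\mathcal{X}-\mathcal{X}'|}-\frac{\mathcal{X}\cdot\mathcal{X}'}{|\mathcal{X}'|^3}\right)$ as a function of $(\mathcal{E},V)$, and $\frac{\overline{\partial R}}{\partial y_k}(\mathcal{E})=\frac{1}{(2\pi)^2}\int_{\mathbb{T}^2}\frac{\partial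 R}{\partial y_k}(\mathcal{E},V)\,d\ell\,d\ell'$. *)

theory Defs
  imports "HOL-Analysis.Analysis"
begin

text \<open>
  The Delaunay elements \<open>E = (L, G, Z, g, z)\<close> of one orbit are a vector of \<open>real ^ 5\<close>, in this
  order; a two-orbit configuration is a pair (asteroid, planet), whose norm is the
  Euclidean norm of the ten elements. A point of the torus of mean anomalies \<open>V = (l, l')\<close> is
  represented by a vector of \<open>real ^ 2\<close>; all functions of \<open>V\<close> below have period \<open>2 * pi\<close> in both components.
\<close>

type_synonym elements = "real ^ 5"
type_synonym config = "elements \<times> elements"

text \<open>
  Inverting \<open>L = k0 * sqrt a\<close>, \<open>G = k0 * sqrt (a * (1 - e\<^sup>2))\<close> and
  \<open>Z = k0 * sqrt (a * (1 - e\<^sup>2)) * cos I\<close>: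
\<close>

definition semimajor_axis :: "real \<Rightarrow> elements \<Rightarrow> real" where
  "semimajor_axis k0 E = (E $ 1 / k0)\<^sup>2"

definition eccentricity :: "elements \<Rightarrow> real" where
  "eccentricity E = sqrt (1 - (E $ 2 / E $ 1)\<^sup>2)"

definition inclination :: "elements \<Rightarrow> real" where
  "inclination E = arccos (E $ 3 / E $ 2)"

text \<open>
  Delaunay elements are regular coordinates exactly when \<open>0 < e < 1\<close> and \<open>0 < I < pi\<close>.
\<close>

definition regular_elements :: "elements set" where
  "regular_elements = {E. 0 < E $ 2 \<and> E $ 2 < E $ 1 \<and> \<bar>E $ 3\<bar> < E $ 2}"

text \<open>The solution of Kepler's equation, unique for \<open>0 \<le> e < 1\<close>.\<close>

definition eccentric_anomaly :: "real \<Rightarrow> real \<Rightarrow> real" where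
  "eccentric_anomaly e l = (THE u. u - e * sin u = l)"

definition rot_x :: "real \<Rightarrow> real ^ 3 ^ 3" where
  "rot_x t = vector [vector [1, 0, 0],
                     vector [0, cos t, - sin t],
                     vector [0, sin t, cos t]]"

definition rot_z :: "real \<Rightarrow> real ^ 3 ^ 3" where
  "rot_z t = vector [vector [cos t, - sin t, 0],
                     vector [sin t, cos t, 0],
                     vector [0, 0, 1]]"

definition position :: "real \<Rightarrow> elements \<Rightarrow> real \<Rightarrow> real ^ 3" where
  "position k0 E l =
     (let a = semimajor_axis k0 E; e = eccentricity E; u = eccentric_anomaly e l
      in rot_z (E $ 5) *v (rot_x (inclination E) *v (rot_z (E $ 4) *v
           vector [a * (cos u - e), a * sqrt (1 - e\<^sup>2) * sin u, 0])))"

definition Delta :: "real \<Rightarrow> config \<Rightarrow> real ^ 2 \<Rightarrow> real ^ 3" where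
  "Delta k0 \<E> V = position k0 (fst \<E>) (V $ 1) - position k0 (snd \<E>) (V $ 2)"

definition kepler_dist :: "real \<Rightarrow> config \<Rightarrow> real ^ 2 \<Rightarrow> real" where
  "kepler_dist k0 \<E> V = norm (Delta k0 \<E> V)"

definition dir_deriv ::
  "'a::real_normed_vector \<Rightarrow> ('a \<Rightarrow> 'b::real_normed_vector) \<Rightarrow> 'a \<Rightarrow> 'b" where
  "dir_deriv v f x = vector_derivative (\<lambda>t. f (x + t *\<^sub>R v)) (at 0)"

text \<open>
  The unit vector of the coordinate of \<open>config\<close> that is the \<open>i\<close>-th asteroid element;
  \<open>Y = (G, Z, g, z)\<close> corresponds to the indices \<open>2, 3, 4, 5\<close>
  (in the index type, \<open>5 = 0\<close> is the fifth index, distinct from the others).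
\<close>

definition asteroid_dir :: "5 \<Rightarrow> config" where
  "asteroid_dir i = (axis i 1, 0)"

definition Y_indices :: "5 set" where
  "Y_indices = {2, 3, 4, 5}"

definition hessian_V :: "(real ^ 2 \<Rightarrow> real) \<Rightarrow> real ^ 2 \<Rightarrow> real ^ 2 ^ 2" where
  "hessian_V f V = (\<chi> i j. dir_deriv (axis i 1) (dir_deriv (axis j 1) f) V)"

definition non_degenerate :: "real \<Rightarrow> config \<Rightarrow> bool" where
  "non_degenerate k0 \<E> \<longleftrightarrow>
     (\<forall>V. (\<forall>i. dir_deriv (axis i 1) (\<lambda>V. (kepler_dist k0 \<E> V)\<^sup>2) V = 0) \<longrightarrow>
          det (hessian_V (\<lambda>V. (kepler_dist k0 \<E> V)\<^sup>2) V) \<noteq> 0)"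

definition crossing :: "real \<Rightarrow> config \<Rightarrow> bool" where
  "crossing k0 \<E> \<longleftrightarrow> (\<exists>V. kepler_dist k0 \<E> V = 0)"

definition one_crossing_point :: "real \<Rightarrow> config \<Rightarrow> bool" where
  "one_crossing_point k0 \<E> \<longleftrightarrow>
     (\<exists>!V. (\<forall>i. 0 \<le> V $ i \<and> V $ i < 2 * pi) \<and> kepler_dist k0 \<E> V = 0)"

text \<open>
  \<open>Vh\<close> is, on the neighbourhood \<open>U\<close> of \<open>\<E>c\<close>, a continuation of a local minimum point of the
  squared distance at \<open>\<E>c\<close>. Only continuity is required: at a non-degenerate \<open>\<E>c\<close> the implicit
  function theorem makes such a continuation unique and smooth near \<open>\<E>c\<close>.
\<close>

definition local_min_continuation ::
  "real \<Rightarrow> config \<Rightarrow> config set \<Rightarrow> (config \<Rightarrow> real ^ 2) \<Rightarrow> bool" where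
  "local_min_continuation k0 \<E>c U Vh \<longleftrightarrow>
     open U \<and> \<E>c \<in> U \<and> U \<subseteq> regular_elements \<times> regular_elements \<and> continuous_on U Vh \<and>
     (\<forall>\<E>\<in>U. \<forall>\<^sub>F V in nhds (Vh \<E>). (kepler_dist k0 \<E> (Vh \<E>))\<^sup>2 \<le> (kepler_dist k0 \<E> V)\<^sup>2)"

definition A_h :: "real \<Rightarrow> (config \<Rightarrow> real ^ 2) \<Rightarrow> config \<Rightarrow> real ^ 2 ^ 2" where
  "A_h k0 Vh \<E> = (1 / 2) *\<^sub>R hessian_V (\<lambda>V. (kepler_dist k0 \<E> V)\<^sup>2) (Vh \<E>)"

definition tau3 :: "real \<Rightarrow> (config \<Rightarrow> real ^ 2) \<Rightarrow> config \<Rightarrow> real ^ 3" where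
  "tau3 k0 Vh \<E> =
     cross3 (vector_derivative (position k0 (fst \<E>)) (at (Vh \<E> $ 1)))
            (vector_derivative (position k0 (snd \<E>)) (at (Vh \<E> $ 2)))"

text \<open>
  \<open>sgn\<close> is normalisation of vectors; since \<open>sgn 0 = 0\<close>, the signed distance is \<open>0\<close> at crossings.
\<close>

definition signed_dist :: "real \<Rightarrow> (config \<Rightarrow> real ^ 2) \<Rightarrow> config \<Rightarrow> real" where
  "signed_dist k0 Vh \<E> =
     (sgn (tau3 k0 Vh \<E>) \<bullet> sgn (Delta k0 \<E> (Vh \<E>))) * kepler_dist k0 \<E> (Vh \<E>)"

definition perturbing_function :: "real \<Rightarrow> real \<Rightarrow> config \<Rightarrow> real ^ 2 \<Rightarrow> real" where
  "perturbing_function k0 \<mu> \<E> V =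
     (let X = position k0 (fst \<E>) (V $ 1); X' = position k0 (snd \<E>) (V $ 2)
      in \<mu> * k0\<^sup>2 * (1 / norm (X - X') - (X \<bullet> X') / norm X' ^ 3))"

definition dR :: "real \<Rightarrow> real \<Rightarrow> 5 \<Rightarrow> config \<Rightarrow> real ^ 2 \<Rightarrow> real" where
  "dR k0 \<mu> i \<E> V = dir_deriv (asteroid_dir i) (\<lambda>\<E>. perturbing_function k0 \<mu> \<E> V) \<E>"

definition torus_box :: "(real ^ 2) set" where
  "torus_box = cbox 0 (\<chi> i. 2 * pi)"

definition averaged_dR :: "real \<Rightarrow> real \<Rightarrow> 5 \<Rightarrow> config \<Rightarrow> real" where
  "averaged_dR k0 \<mu> i \<E> = 1 / (2 * pi)\<^sup>2 * integral torus_box (dR k0 \<mu> i \<E>)"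

end

theory Submission
  imports Defs
begin

text \<open>
  Up to a smooth term and a constant factor, the averaged derivative is the integral of
  \<open>w \<bullet> \<Delta> / |\<Delta>|\<^sup>3\<close> over the torus, where \<open>w\<close> is the derivative of \<open>\<Delta>\<close> along the
  element \<open>y\<^sub>k\<close>. Near the crossing point \<open>V \<mapsto> \<Delta>(\<E>, V)\<close> parametrises a surface in space, and the
  integral is the derivative of a single layer potential of that surface at the origin, which lies at
  signed distance \<open>- s\<close> from it. Shifting the surface along its normal turns \<open>s\<close> into an independent
  parameter: the two sides become the convex sets \<open>s > 0\<close> and \<open>s < 0\<close>, and it suffices to bound the
  derivatives of the integral on each of them.

  The field \<open>y / |y|\<^sup>3\<close> is curl free and divergence free, so its Jacobian is symmetric and traceless.
  Therefore its derivative along any parameter is a combination of its derivatives along the surface, and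
  integration by parts brings the derivative of the integral back to an integral of the same form. The
  tangential part of the density is once more integrated by parts, against \<open>1 / |\<Delta>|\<close>; the
  normal part is the kernel of a double layer potential. Both are bounded uniformly in \<open>s\<close>.

  The jump across the surface follows by rescaling with \<open>s\<close> and from the integral of
  \<open>(1 + u \<bullet> G u) powr (- 3 / 2)\<close> over the plane, which is \<open>2 \<pi> / sqrt (det G)\<close>.
\<close>

subsection \<open>Continuously differentiable functions\<close>

text \<open>Differentiating the kernel in a parameter raises its singularity to order -3, and with r
  = sqrt (s^2 + |v - v_h|^2) the plane integral of 1 / r^3 is 2 pi / |s|: bounding absolute values
  directly fails as s tends to 0. Integration by parts leaves only 1 / r and a normal component over
  r^3. That component is at most of order |s| + |v - v_h|^2, because the surface leaves its tangent
  plane quadratically, and |s| / r^3 has integral 2 pi for every s. Neither one-sided limit at the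
  crossing set is computed by itself: in rescaled coordinates one kernel decays like an inverse
  square, which is not integrable over the plane, while the difference of the two sides decays like
  an inverse cube. The jump is needed only where the signed distance vanishes, and there the term
  with the derivative of the determinant drops out. Off the crossing set the difference formula
  holds by construction, since each extension continues past its own side as the average corrected
  by the right-hand side of the formula; the work lies in showing that this is Lipschitz across the
  crossing set.\<close>

lemma bounded_bilinear_cross3: "bounded_bilinear cross3"
  using bilinear_conv_bounded_bilinear bilinear_cross by blast

lemma dir_deriv_eq:
  assumes "(f has_derivative D) (at x)"
  shows "dir_deriv v f x = D v"
proof -
  have "((\<lambda>t. f (x + t *\<^sub>R v)) has_vector_derivative D v) (at 0)"
  proof -
    have "((\<lambda>t. x + t *\<^sub>R v) has_derivative (\<lambda>t. t *\<^sub>R v)) (at 0)"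
      by (auto intro!: derivative_eq_intros)
    then have "((\<lambda>t. f (x + t *\<^sub>R v)) has_derivative (\<lambda>t. D (t *\<^sub>R v))) (at 0)"
      using has_derivative_compose[of "\<lambda>t. x + t *\<^sub>R v" "\<lambda>t. t *\<^sub>R v" 0 UNIV f D] assms by simp
    moreover have "D (t *\<^sub>R v) = t *\<^sub>R D v" for t
      using has_derivative_bounded_linear[OF assms] by (simp add: linear_simps)
    ultimately show ?thesis by (simp add: has_vector_derivative_def)
  qed
  then show ?thesis unfolding dir_deriv_def by (rule vector_derivative_at)
qed

lemma has_derivative_dir_deriv:
  assumes "f differentiable (at x)"
  shows "(f has_derivative (\<lambda>v. dir_deriv v f x)) (at x)"
proof -
  obtain D where D: "(f has_derivative D) (at x)" using assms by (auto simp: differentiable_def)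
  then have "(\<lambda>v. dir_deriv v f x) = D" by (auto simp: dir_deriv_eq)
  then show ?thesis using D by simp
qed

lemma dir_deriv_line:
  assumes "f differentiable (at (x + t *\<^sub>R v))"
  shows "((\<lambda>t. f (x + t *\<^sub>R v)) has_vector_derivative dir_deriv v f (x + t *\<^sub>R v)) (at t)"
proof -
  have "((\<lambda>t. x + t *\<^sub>R v) has_derivative (\<lambda>t. t *\<^sub>R v)) (at t)"
    by (auto intro!: derivative_eq_intros)
  from has_derivative_compose[OF this has_derivative_dir_deriv[OF assms]]
  have "((\<lambda>t. f (x + t *\<^sub>R v)) has_derivative (\<lambda>u. dir_deriv (u *\<^sub>R v) f (x + t *\<^sub>R v))) (at t)" .
  moreover have "dir_deriv (u *\<^sub>R v) f (x + t *\<^sub>R v) = u *\<^sub>R dir_deriv v f (x + t *\<^sub>R v)" for u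
    using linear_cmul[OF bounded_linear.linear[OF has_derivative_bounded_linear[OF has_derivative_dir_deriv[OF assms]]]]
    by simp
  ultimately show ?thesis by (simp add: has_vector_derivative_def)
qed

lemma dir_deriv_cong_open:
  assumes "open S" "x \<in> S" "\<And>y. y \<in> S \<Longrightarrow> f y = g y"
  shows "dir_deriv v f x = dir_deriv v g x"
proof -
  have "open ((\<lambda>t. x + t *\<^sub>R v) -` S)"
    by (rule open_vimage[OF assms(1)]) (intro continuous_intros)
  then have "\<forall>\<^sub>F t in nhds (0::real). t \<in> (\<lambda>t. x + t *\<^sub>R v) -` S"
    using assms(2) eventually_nhds_in_open[of "(\<lambda>t. x + t *\<^sub>R v) -` S" 0] by simp
  then have ev: "\<forall>\<^sub>F t in nhds (0::real). f (x + t *\<^sub>R v) = g (x + t *\<^sub>R v)"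
    by eventually_elim (use assms(3) in auto)
  show ?thesis
    unfolding dir_deriv_def
    using ev by (intro vector_derivative_cong_eq) simp_all
qed

text \<open>Phrased with \<open>dir_deriv\<close>, so that it applies directly to the derivatives in the theorem.\<close>

primrec Ck :: "nat \<Rightarrow> 'a::euclidean_space set \<Rightarrow> ('a \<Rightarrow> 'b::euclidean_space) \<Rightarrow> bool" where
  "Ck 0 S f \<longleftrightarrow> continuous_on S f"
| "Ck (Suc k) S f \<longleftrightarrow> (\<forall>x\<in>S. f differentiable (at x)) \<and> (\<forall>v. Ck k S (dir_deriv v f))"

declare Ck.simps(2) [simp del]

text \<open>Functions are total but controlled only on \<open>S\<close>. Openness of
  \<open>S\<close> makes a derivative at a point of \<open>S\<close> blind to the values outside, so
  a formula valid on \<open>S\<close> alone may replace the function.\<close>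

lemma Ck_cong:
  fixes f g :: "'a::euclidean_space \<Rightarrow> 'b::euclidean_space"
  assumes "open S" "\<And>y. y \<in> S \<Longrightarrow> f y = g y" "Ck k S f"
  shows "Ck k S g"
proof -
  have "\<forall>f g :: 'a \<Rightarrow> 'b. (\<forall>y\<in>S. f y = g y) \<longrightarrow> Ck k S f \<longrightarrow> Ck k S g" for k
  proof (induction k)
    case 0
    show ?case by (metis Ck.simps(1) continuous_on_cong)
  next
    case (Suc k)
    show ?case
    proof (intro allI impI)
      fix f g :: "'a \<Rightarrow> 'b"
      assume eq: "\<forall>y\<in>S. f y = g y" and f: "Ck (Suc k) S f"
      have "g differentiable (at x)" if "x \<in> S" for x
        using f[unfolded Ck.simps(2)] that eq \<open>open S\<close> unfolding differentiable_def
        by (metis has_derivative_transform_within_open)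
      moreover have "Ck k S (dir_deriv v g)" for v
      proof -
        have "\<forall>y\<in>S. dir_deriv v f y = dir_deriv v g y"
          using eq dir_deriv_cong_open[OF \<open>open S\<close>] by blast
        moreover have "Ck k S (dir_deriv v f)" using f by (simp add: Ck.simps(2))
        ultimately show ?thesis
          using Suc.IH[THEN spec[of _ "dir_deriv v f"], THEN spec[of _ "dir_deriv v g"]] by simp
      qed
      ultimately show "Ck (Suc k) S g" by (simp add: Ck.simps(2))
    qed
  qed
  then show ?thesis using assms by blast
qed

text \<open>\<open>dir_deriv\<close> is defined by a limit; here regularity is obtained from any
  closed formula \<open>F\<close> for the derivative. The inductions on \<open>k\<close> below close
  because such a formula is built from functions already known to be of order
  \<open>k\<close>.\<close>

lemma Ck_SucI:
  assumes "open S" "\<And>x. x \<in> S \<Longrightarrow> (f has_derivative F x) (at x)" "\<And>v. Ck k S (\<lambda>x. F x v)"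
  shows "Ck (Suc k) S f"
proof -
  have "Ck k S (dir_deriv v f)" for v
    by (rule Ck_cong[OF assms(1) _ assms(3)[of v]]) (simp add: dir_deriv_eq[OF assms(2)])
  then show ?thesis using assms(2) unfolding Ck.simps(2) differentiable_def by blast
qed

lemma Ck_imp_differentiable: "Ck (Suc k) S f \<Longrightarrow> x \<in> S \<Longrightarrow> f differentiable (at x)"
  by (simp add: Ck.simps(2))

lemma Ck_dir_deriv: "Ck (Suc k) S f \<Longrightarrow> Ck k S (dir_deriv v f)"
  by (simp add: Ck.simps(2))

lemma Ck_has_derivative:
  "Ck (Suc k) S f \<Longrightarrow> x \<in> S \<Longrightarrow> (f has_derivative (\<lambda>v. dir_deriv v f x)) (at x)"
  by (intro has_derivative_dir_deriv Ck_imp_differentiable)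

lemma Ck_continuous_on: "Ck k S f \<Longrightarrow> continuous_on S f"
  by (cases k)
    (auto dest: Ck_imp_differentiable
      intro!: continuous_at_imp_continuous_on differentiable_imp_continuous_within)

lemma Ck_SucD: "Ck (Suc k) S f \<Longrightarrow> Ck k S f"
proof (induction k arbitrary: f)
  case 0 then show ?case using Ck_continuous_on by auto
next
  case (Suc k)
  then have "Ck k S (dir_deriv v f)" for v
    by (intro Suc.IH Ck_dir_deriv)
  then show ?case using Suc.prems by (auto simp: Ck.simps(2)[of k] dest: Ck_imp_differentiable)
qed

lemma Ck_le: "j \<le> k \<Longrightarrow> Ck k S f \<Longrightarrow> Ck j S f"
  by (induction k rule: dec_induct) (auto dest: Ck_SucD)

lemma Ck_subset: "Ck k S f \<Longrightarrow> T \<subseteq> S \<Longrightarrow> Ck k T f"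
  by (induction k arbitrary: f) (auto intro: continuous_on_subset simp: Ck.simps(2))

text \<open>Glues a region where a function is smooth by a formula to a region where it vanishes
  identically; this is how cut-off integrands are treated later.\<close>

lemma Ck_Un:
  assumes "open S" "open T" "Ck k S f" "Ck k T f"
  shows "Ck k (S \<union> T) f"
  using assms(3,4) by (induction k arbitrary: f) (auto intro: continuous_on_open_Un assms simp: Ck.simps(2))

lemma Ck_const: "open S \<Longrightarrow> Ck k S (\<lambda>x. c)"
proof (induction k arbitrary: c)
  case (Suc k)
  show ?case by (rule Ck_SucI[where F="\<lambda>_ _. 0"]) (use Suc in auto)
qed simp

lemma Ck_linear:
  assumes "bounded_linear f" "open S"
  shows "Ck k S f"
proof (cases k)
  case 0
  then show ?thesis using assms by (simp add: linear_continuous_on)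
next
  case (Suc j)
  show ?thesis unfolding Suc
    by (rule Ck_SucI[where F="\<lambda>x. f"])
      (use assms in \<open>auto intro: bounded_linear_imp_has_derivative Ck_const\<close>)
qed

lemma Ck_bounded_linear:
  assumes "bounded_linear L" "open S" "Ck k S f"
  shows "Ck k S (\<lambda>x. L (f x))"
  using assms(3)
proof (induction k arbitrary: f)
  case 0
  then show ?case using assms(1) by (auto intro: bounded_linear.continuous_on)
next
  case (Suc k)
  show ?case
    by (rule Ck_SucI[where F="\<lambda>x v. L (dir_deriv v f x)"])
      (use Suc assms in \<open>auto intro!: bounded_linear.has_derivative[OF assms(1)] Ck_has_derivative Ck_dir_deriv\<close>)
qed

lemma Ck_add:
  assumes "open S" "Ck k S f" "Ck k S g"
  shows "Ck k S (\<lambda>x. f x + g x)"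
  using assms(2,3)
proof (induction k arbitrary: f g)
  case 0 then show ?case by (auto intro!: continuous_intros)
next
  case (Suc k)
  show ?case
    by (rule Ck_SucI[where F="\<lambda>x v. dir_deriv v f x + dir_deriv v g x"])
      (use Suc assms in \<open>auto intro!: has_derivative_add Ck_has_derivative Ck_dir_deriv\<close>)
qed

lemma Ck_sum:
  assumes "open S" "\<And>i. i \<in> I \<Longrightarrow> Ck k S (f i)"
  shows "Ck k S (\<lambda>x. \<Sum>i\<in>I. f i x)"
  using assms(2) by (induction I rule: infinite_finite_induct) (auto intro: Ck_add Ck_const assms)

lemma Ck_bilinear:
  assumes "bounded_bilinear p" "open S" "Ck k S f" "Ck k S g"
  shows "Ck k S (\<lambda>x. p (f x) (g x))"
  using assms(3,4)
proof (induction k arbitrary: f g)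
  case 0
  then show ?case using assms(1) by (auto intro: bounded_bilinear.continuous_on)
next
  case (Suc k)
  have "Ck k S f" "Ck k S g" using Suc.prems Ck_SucD by blast+
  then show ?case
    by (intro Ck_SucI[where F="\<lambda>x v. p (f x) (dir_deriv v g x) + p (dir_deriv v f x) (g x)"])
      (use Suc assms in \<open>auto intro!: bounded_bilinear.FDERIV[OF assms(1)] Ck_has_derivative Ck_dir_deriv Ck_add\<close>)
qed

lemmas Ck_scaleR = Ck_bilinear[OF bounded_bilinear_scaleR]
lemmas Ck_mult = Ck_bilinear[OF bounded_bilinear_mult]
lemmas Ck_inner = Ck_bilinear[OF bounded_bilinear_inner]
lemmas Ck_cross3 = Ck_bilinear[OF bounded_bilinear_cross3]

lemma Ck_minus: "open S \<Longrightarrow> Ck k S f \<Longrightarrow> Ck k S (\<lambda>x. - f x)"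
  by (rule Ck_bounded_linear[of uminus]) (auto intro: bounded_linear_minus bounded_linear_ident)

lemma Ck_diff: "open S \<Longrightarrow> Ck k S f \<Longrightarrow> Ck k S g \<Longrightarrow> Ck k S (\<lambda>x. f x - g x)"
  using Ck_add[of S k f "\<lambda>x. - g x"] Ck_minus[of S k g] by simp

lemma Ck_Pair:
  assumes "open S" "Ck k S f" "Ck k S g"
  shows "Ck k S (\<lambda>x. (f x, g x))"
proof -
  have "Ck k S (\<lambda>x. (f x, 0) + (0, g x))"
    by (intro Ck_add Ck_bounded_linear[of "\<lambda>u. (u, 0)"] Ck_bounded_linear[of "\<lambda>u. (0, u)"])
      (use assms in \<open>auto intro!: bounded_linear_intros\<close>)
  then show ?thesis by simp
qed

lemma Ck_fst: "open S \<Longrightarrow> Ck k S fst"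
  by (rule Ck_linear[OF bounded_linear_fst])

lemma Ck_snd: "open S \<Longrightarrow> Ck k S snd"
  by (rule Ck_linear[OF bounded_linear_snd])

lemma Ck_ident: "open S \<Longrightarrow> Ck k S (\<lambda>x. x)"
  by (rule Ck_linear[OF bounded_linear_ident])

lemma Ck_fst': "open S \<Longrightarrow> Ck k S f \<Longrightarrow> Ck k S (\<lambda>x. fst (f x))"
  by (rule Ck_bounded_linear[OF bounded_linear_fst])

lemma Ck_snd': "open S \<Longrightarrow> Ck k S f \<Longrightarrow> Ck k S (\<lambda>x. snd (f x))"
  by (rule Ck_bounded_linear[OF bounded_linear_snd])

lemma Ck_nth: "open S \<Longrightarrow> Ck k S f \<Longrightarrow> Ck k S (\<lambda>x. f x $ i)"
  by (auto intro!: Ck_bounded_linear[of "\<lambda>u. u $ i"] bounded_linear_vec_nth)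

lemma Ck_vec:
  fixes f :: "'a::euclidean_space \<Rightarrow> 'b::euclidean_space ^ 'n"
  assumes "open S" "\<And>i. Ck k S (\<lambda>x. f x $ i)"
  shows "Ck k S f"
proof -
  have lin: "bounded_linear (\<lambda>u::'b. axis i u :: 'b ^ 'n)" for i :: 'n
    by (intro linear_conv_bounded_linear[THEN iffD1] linearI)
      (auto simp: axis_def vec_eq_iff)
  have "Ck k S (\<lambda>x. \<Sum>i\<in>UNIV. axis i (f x $ i))"
    by (intro Ck_sum Ck_bounded_linear[OF lin] assms)
  then show ?thesis
    by (rule Ck_cong[OF assms(1), rotated]) (simp add: vec_eq_iff axis_def if_distrib sum.delta' cong: if_cong)
qed

lemma Ck_compose:
  assumes "open S" "open T" "Ck k T f" "Ck k S g" "\<And>x. x \<in> S \<Longrightarrow> g x \<in> T"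
  shows "Ck k S (\<lambda>x. f (g x))"
  using assms(3,4)
proof (induction k arbitrary: f)
  case 0
  then show ?case using assms(5) by (auto intro: continuous_on_compose2)
next
  case (Suc k)
  have "Ck k S g" using Suc.prems Ck_SucD by blast
  \<comment> \<open>The direction \<open>dir_deriv v g x\<close> moves with \<open>x\<close>, while
    the induction hypothesis covers derivatives of \<open>f\<close> in fixed directions only; hence
    the expansion in the basis.\<close>
  let ?F = "\<lambda>x v. \<Sum>b\<in>Basis. (dir_deriv v g x \<bullet> b) *\<^sub>R dir_deriv b f (g x)"
  have "((\<lambda>x. f (g x)) has_derivative ?F x) (at x)" if "x \<in> S" for x
  proof -
    have f: "(f has_derivative (\<lambda>v. dir_deriv v f (g x))) (at (g x))"
      using Suc.prems assms(5) that by (intro Ck_has_derivative) auto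
    have g: "(g has_derivative (\<lambda>v. dir_deriv v g x)) (at x)"
      using Suc.prems that by (intro Ck_has_derivative) auto
    have *: "dir_deriv u f (g x) = (\<Sum>b\<in>Basis. (u \<bullet> b) *\<^sub>R dir_deriv b f (g x))" for u
    proof -
      interpret bounded_linear "\<lambda>v. dir_deriv v f (g x)" using f by (rule has_derivative_bounded_linear)
      have "dir_deriv u f (g x) = dir_deriv (\<Sum>b\<in>Basis. (u \<bullet> b) *\<^sub>R b) f (g x)"
        by (simp add: euclidean_representation)
      then show ?thesis by (simp add: sum scaleR)
    qed
    show ?thesis using has_derivative_compose[OF g f] by (subst (asm) *)
  qed
  moreover have "Ck k S (\<lambda>x. ?F x v)" for v
    by (intro Ck_sum Ck_scaleR Ck_inner Suc.IH Ck_const Ck_dir_deriv Suc.prems assms(1) \<open>Ck k S g\<close>)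
  ultimately show ?case by (intro Ck_SucI[where F = ?F] assms)
qed

lemma Ck_inverse_real: "Ck k {x::real. x \<noteq> 0} inverse"
proof (induction k)
  case 0 show ?case by (auto intro!: continuous_intros)
next
  case (Suc k)
  have o: "open {x::real. x \<noteq> 0}" by (intro open_Collect_neq continuous_intros)
  show ?case
    by (rule Ck_SucI[where F="\<lambda>x v. - (inverse x * v * inverse x)"])
      (use Suc o in \<open>auto intro!: Ck_minus Ck_mult Ck_const has_derivative_inverse'\<close>)
qed

lemma Ck_sqrt_real: "Ck k {0<..} sqrt"
proof (induction k)
  case 0 show ?case by (auto intro!: continuous_intros)
next
  case (Suc k)
  have "Ck k {0<..} (\<lambda>x. inverse (sqrt x))"
    by (rule Ck_compose[OF _ _ Ck_inverse_real Suc]) (auto intro!: open_Collect_neq continuous_intros)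
  then have "Ck k {0<..} (\<lambda>x. v / 2 * inverse (sqrt x))" for v
    by (intro Ck_mult Ck_const) auto
  then show ?case
    by (intro Ck_SucI[where F="\<lambda>x v. v / 2 * inverse (sqrt x)"])
      (auto intro!: derivative_eq_intros simp: divide_simps)
qed

lemma Ck_sin_cos_real: "Ck k UNIV (sin :: real \<Rightarrow> real) \<and> Ck k UNIV (cos :: real \<Rightarrow> real)"
proof (induction k)
  case 0 show ?case by (auto intro!: continuous_intros)
next
  case (Suc k)
  have "Ck (Suc k) UNIV (sin :: real \<Rightarrow> real)"
    by (rule Ck_SucI[where F="\<lambda>x v. v * cos x"])
      (use Suc in \<open>auto intro!: derivative_eq_intros Ck_mult Ck_const simp: mult.commute\<close>)
  moreover have "Ck (Suc k) UNIV (cos :: real \<Rightarrow> real)"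
    by (rule Ck_SucI[where F="\<lambda>x v. v * (- sin x)"])
      (use Suc in \<open>auto intro!: derivative_eq_intros Ck_mult Ck_const Ck_minus simp: mult.commute\<close>)
  ultimately show ?case by blast
qed

lemma Ck_inverse: "open S \<Longrightarrow> Ck k S f \<Longrightarrow> (\<And>x. x \<in> S \<Longrightarrow> f x \<noteq> 0) \<Longrightarrow> Ck k S (\<lambda>x. inverse (f x :: real))"
  by (rule Ck_compose[OF _ _ Ck_inverse_real]) (auto intro!: open_Collect_neq continuous_intros)

lemma Ck_divide:
  "open S \<Longrightarrow> Ck k S f \<Longrightarrow> Ck k S g \<Longrightarrow> (\<And>x. x \<in> S \<Longrightarrow> g x \<noteq> 0) \<Longrightarrow> Ck k S (\<lambda>x. f x / g x :: real)"
  unfolding divide_inverse by (intro Ck_mult Ck_inverse)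

lemma Ck_sqrt: "open S \<Longrightarrow> Ck k S f \<Longrightarrow> (\<And>x. x \<in> S \<Longrightarrow> f x > 0) \<Longrightarrow> Ck k S (\<lambda>x. sqrt (f x))"
  by (rule Ck_compose[OF _ _ Ck_sqrt_real]) auto

lemma Ck_sin: "open S \<Longrightarrow> Ck k S f \<Longrightarrow> Ck k S (\<lambda>x. sin (f x :: real))"
  and Ck_cos: "open S \<Longrightarrow> Ck k S f \<Longrightarrow> Ck k S (\<lambda>x. cos (f x :: real))"
  by (rule Ck_compose[OF _ open_UNIV]; use Ck_sin_cos_real in blast)+

lemma Ck_power: "open S \<Longrightarrow> Ck k S f \<Longrightarrow> Ck k S (\<lambda>x. (f x :: real) ^ n)"
  by (induction n) (auto intro: Ck_mult Ck_const)

lemma Ck_norm: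
  assumes "open S" "Ck k S f" "\<And>x. x \<in> S \<Longrightarrow> f x \<noteq> 0"
  shows "Ck k S (\<lambda>x. norm (f x))"
  unfolding norm_eq_sqrt_inner using assms by (intro Ck_sqrt Ck_inner) auto

lemmas Ck_intros = Ck_const Ck_add Ck_diff Ck_minus Ck_scaleR Ck_mult Ck_inner Ck_cross3 Ck_Pair Ck_fst' Ck_snd'
  Ck_fst Ck_snd Ck_ident Ck_nth Ck_inverse Ck_divide Ck_sqrt Ck_sin Ck_cos Ck_power Ck_norm

subsection \<open>Implicit functions, Lipschitz bounds and integration by parts\<close>

text \<open>The branch \<open>g\<close> is given, so only the differentiation part of the implicit
  function theorem is at stake. \<open>A\<close> inverts the partial derivative in the second
  variable from the left. The applications are Kepler's equation and the critical points
  \<open>Vh\<close>.\<close>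

lemma has_derivative_implicit:
  fixes f :: "'a::real_normed_vector \<times> 'b::real_normed_vector \<Rightarrow> 'c::real_normed_vector"
  assumes f: "(f has_derivative f') (at (x0, g x0))"
    and g: "isCont g x0"
    and zero: "\<forall>\<^sub>F x in nhds x0. f (x, g x) = 0"
    and A: "bounded_linear A" "\<And>k. A (f' (0, k)) = k"
  shows "(g has_derivative (\<lambda>h. - A (f' (h, 0)))) (at x0)"
proof -
  let ?L = "\<lambda>h. - A (f' (h, 0))"
  have f': "bounded_linear f'" using f by (rule has_derivative_bounded_linear)
  have L: "bounded_linear ?L"
    by (intro bounded_linear_minus bounded_linear_compose[OF A(1)] bounded_linear_compose[OF f'])
      (auto intro!: bounded_linear_intros)
  obtain K where K: "K > 0" "\<And>v. norm (A v) \<le> norm v * K"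
    using bounded_linear.pos_bounded[OF A(1)] by blast
  obtain B where B: "B > 0" "\<And>h. norm (?L h) \<le> norm h * B"
    using bounded_linear.pos_bounded[OF L] by blast
  show ?thesis
    unfolding has_derivative_at_alt
  proof (intro conjI L allI impI)
    fix e :: real assume e: "e > 0"
    \<comment> \<open>The first bound lets half of \<open>norm (g y - g x0)\<close> be absorbed into
      the left-hand side, which bounds it by a multiple of \<open>norm (y - x0)\<close>; the second
      turns the resulting error into \<open>e\<close>.\<close>
    define e' where "e' = min (1 / (2 * K)) (e / (K * (2 * B + 2)))"
    have KB: "K * (2 * B + 2) > 0" using K B by (intro mult_pos_pos) auto
    then have e'0: "e' > 0" using K e by (simp add: e'_def)
    have "e' \<le> 1 / (2 * K)" "e' \<le> e / (K * (2 * B + 2))" by (simp_all only: e'_def min.cobounded1 min.cobounded2)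
    then have "e' * (2 * K) \<le> 1" "e' * (K * (2 * B + 2)) \<le> e"
      using K KB by (simp_all only: pos_le_divide_eq mult_pos_pos zero_less_numeral)
    then have e': "e' > 0" "K * e' \<le> 1 / 2" "K * e' * (2 * B + 2) \<le> e"
      using e'0 by (auto simp only: mult_ac)
    obtain d where d: "d > 0" "\<And>z. norm (z - (x0, g x0)) < d \<Longrightarrow>
        norm (f z - f (x0, g x0) - f' (z - (x0, g x0))) \<le> e' * norm (z - (x0, g x0))"
      using f e' unfolding has_derivative_at_alt by blast
    have f0: "f (x0, g x0) = 0" using zero by (rule eventually_nhds_x_imp_x)
    obtain d1 where d1: "d1 > 0" "\<And>x. dist x x0 < d1 \<Longrightarrow> f (x, g x) = 0"
      using zero unfolding eventually_nhds_metric by blast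
    obtain d2 where d2: "d2 > 0" "\<And>x. dist x x0 < d2 \<Longrightarrow> dist (g x) (g x0) < d / 2"
      using g d unfolding continuous_at_eps_delta by (meson half_gt_zero)
    have "norm (g y - g x0 - ?L (y - x0)) \<le> e * norm (y - x0)"
      if y: "norm (y - x0) < Min {d / 2, d1, d2}" for y
    proof -
      let ?h = "y - x0" and ?k = "g y - g x0"
      have hk: "norm ((y, g y) - (x0, g x0)) \<le> norm ?h + norm ?k"
        by (simp add: norm_Pair sqrt_sum_squares_le_sum)
      have "norm ?h < d / 2" "norm ?k < d / 2" using y d2(2)[of y] by (auto simp: dist_norm)
      then have "norm ((y, g y) - (x0, g x0)) < d" using hk by linarith
      from d(2)[OF this] have "norm (f' (?h, ?k)) \<le> e' * norm ((y, g y) - (x0, g x0))"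
        using d1(2)[of y] y f0 by (auto simp: dist_norm)
      also have "\<dots> \<le> e' * (norm ?h + norm ?k)" using e' hk by (intro mult_left_mono) auto
      finally have 1: "norm (f' (?h, ?k)) \<le> e' * (norm ?h + norm ?k)" .
      have "f' (?h, ?k) = f' (?h, 0) + f' (0, ?k)"
        using linear_add[OF bounded_linear.linear[OF f'], of "(?h, 0)" "(0, ?k)"] by simp
      then have "A (f' (?h, ?k)) = ?k - ?L ?h"
        using linear_add[OF bounded_linear.linear[OF A(1)]] A(2) by simp
      then have "norm (?k - ?L ?h) \<le> norm (f' (?h, ?k)) * K" using K(2) by metis
      also have "\<dots> \<le> e' * (norm ?h + norm ?k) * K" using 1 K by (intro mult_right_mono) auto
      finally have 2: "norm (?k - ?L ?h) \<le> K * e' * (norm ?h + norm ?k)" by (simp add: mult_ac)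
      also have "\<dots> \<le> 1 / 2 * (norm ?h + norm ?k)" using e' by (intro mult_right_mono) auto
      finally have "norm ?k \<le> norm (?L ?h) + 1 / 2 * (norm ?h + norm ?k)"
        using norm_triangle_sub[of ?k "?L ?h"] by linarith
      then have "norm ?k \<le> (2 * B + 1) * norm ?h" using B(2)[of ?h] by (simp add: algebra_simps)
      then have "K * e' * (norm ?h + norm ?k) \<le> K * e' * ((2 * B + 2) * norm ?h)"
        using K e' by (intro mult_left_mono) (auto simp: algebra_simps)
      also have "\<dots> \<le> e * norm ?h" using e'(3) by (metis mult.assoc mult_right_mono norm_ge_zero)
      finally show ?thesis using 2 by linarith
    qed
    moreover have "Min {d / 2, d1, d2} > 0" using d d1 d2 by simp
    ultimately show "\<exists>d>0. \<forall>y. norm (y - x0) < d \<longrightarrow> norm (g y - g x0 - ?L (y - x0)) \<le> e * norm (y - x0)"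
      by blast
  qed
qed

text \<open>Linearity in \<open>v\<close> reduces all directions to the finitely many basis
  directions, and each of these derivatives is continuous on the compact set.\<close>

lemma dir_deriv_bound:
  fixes f :: "'a::euclidean_space \<Rightarrow> 'b::euclidean_space"
  assumes f: "Ck (Suc 0) Q f" and T: "compact T" "T \<subseteq> Q"
  shows "\<exists>B\<ge>0. \<forall>z\<in>T. \<forall>v. norm (dir_deriv v f z) \<le> B * norm v"
proof -
  have "\<exists>M. \<forall>z\<in>T. norm (dir_deriv b f z) \<le> M" for b
  proof -
    have "compact ((\<lambda>z. norm (dir_deriv b f z)) ` T)"
      using Ck_dir_deriv[OF f, of b] T
      by (intro compact_continuous_image continuous_on_norm) (auto intro: continuous_on_subset)
    then obtain M where "\<forall>x\<in>(\<lambda>z. norm (dir_deriv b f z)) ` T. norm x \<le> M"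
      using compact_imp_bounded bounded_iff by blast
    then show ?thesis by (intro exI[of _ M]) auto
  qed
  then obtain M where M: "\<And>b z. z \<in> T \<Longrightarrow> norm (dir_deriv b f z) \<le> M b" by metis
  define B where "B = (\<Sum>b\<in>Basis. \<bar>M b\<bar>)"
  have "norm (dir_deriv v f z) \<le> B * norm v" if z: "z \<in> T" for z v
  proof -
    interpret bounded_linear "\<lambda>v. dir_deriv v f z"
      using Ck_has_derivative[OF f, of z] z T by (intro has_derivative_bounded_linear) auto
    have "dir_deriv v f z = dir_deriv (\<Sum>b\<in>Basis. (v \<bullet> b) *\<^sub>R b) f z"
      by (simp add: euclidean_representation)
    also have "\<dots> = (\<Sum>b\<in>Basis. (v \<bullet> b) *\<^sub>R dir_deriv b f z)" by (simp only: sum scaleR)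
    finally have "norm (dir_deriv v f z) \<le> (\<Sum>b\<in>Basis. norm ((v \<bullet> b) *\<^sub>R dir_deriv b f z))"
      by (metis norm_sum)
    also have "\<dots> \<le> (\<Sum>b\<in>Basis. \<bar>M b\<bar> * norm v)"
    proof (rule sum_mono)
      fix b :: 'a assume "b \<in> Basis"
      then have "\<bar>v \<bullet> b\<bar> \<le> norm v" by (rule Basis_le_norm)
      moreover have "norm (dir_deriv b f z) \<le> \<bar>M b\<bar>" using M[OF z, of b] by linarith
      ultimately have "\<bar>v \<bullet> b\<bar> * norm (dir_deriv b f z) \<le> norm v * \<bar>M b\<bar>"
        by (intro mult_mono) auto
      then show "norm ((v \<bullet> b) *\<^sub>R dir_deriv b f z) \<le> \<bar>M b\<bar> * norm v" by (simp add: mult.commute)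
    qed
    finally show ?thesis by (simp add: B_def sum_distrib_right)
  qed
  moreover have "B \<ge> 0" by (auto simp: B_def intro: sum_nonneg)
  ultimately show ?thesis by blast
qed

lemma Ck_lipschitz_fst:
  fixes f :: "'a::euclidean_space \<times> 'c::euclidean_space \<Rightarrow> 'b::euclidean_space"
  assumes f: "Ck (Suc 0) Q f" and "compact K" "convex K" "compact C" "K \<times> C \<subseteq> Q"
  obtains L where "L \<ge> 0"
    "\<And>v x y. v \<in> C \<Longrightarrow> x \<in> K \<Longrightarrow> y \<in> K \<Longrightarrow> norm (f (x, v) - f (y, v)) \<le> L * norm (x - y)"
proof -
  obtain B where B: "B \<ge> 0" "\<And>z v. z \<in> K \<times> C \<Longrightarrow> norm (dir_deriv v f z) \<le> B * norm v"
    using dir_deriv_bound[OF f compact_Times[OF assms(2) assms(4)] assms(5)] by auto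
  have "norm (f (x, v) - f (y, v)) \<le> B * norm (x - y)" if v: "v \<in> C" and xy: "x \<in> K" "y \<in> K" for v x y
  proof (rule differentiable_bound[OF \<open>convex K\<close> _ _ xy, of _ "\<lambda>x h. dir_deriv (h, 0) f (x, v)"])
    fix x assume x: "x \<in> K"
    have "((\<lambda>x. (x, v)) has_derivative (\<lambda>h. (h, 0))) (at x within K)"
      by (auto intro!: derivative_eq_intros)
    moreover have "(f has_derivative (\<lambda>h. dir_deriv h f (x, v))) (at (x, v))"
      using assms x v by (intro Ck_has_derivative[OF f]) auto
    ultimately show "((\<lambda>x. f (x, v)) has_derivative (\<lambda>h. dir_deriv (h, 0) f (x, v))) (at x within K)"
      by (rule has_derivative_compose)
    show "onorm (\<lambda>h. dir_deriv (h, 0) f (x, v)) \<le> B"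
      using B(1) B(2)[of "(x, v)" "(_, 0)"] x v by (intro onorm_le) (auto simp: norm_Pair)
  qed
  with B(1) that show ?thesis by blast
qed

lemma Ck_lipschitz:
  fixes f :: "'a::euclidean_space \<Rightarrow> 'b::euclidean_space"
  assumes f: "Ck (Suc 0) Q f" and "compact K" "convex K" "K \<subseteq> Q"
  obtains L where "L \<ge> 0" "\<And>x y. x \<in> K \<Longrightarrow> y \<in> K \<Longrightarrow> norm (f x - f y) \<le> L * norm (x - y)"
proof -
  obtain B where B: "B \<ge> 0" and B': "\<forall>z\<in>K. \<forall>v. norm (dir_deriv v f z) \<le> B * norm v"
    using dir_deriv_bound[OF f assms(2) assms(4)] by blast
  have "norm (f x - f y) \<le> B * norm (x - y)" if xy: "x \<in> K" "y \<in> K" for x y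
  proof (rule differentiable_bound[OF \<open>convex K\<close> _ _ xy, of _ "\<lambda>x h. dir_deriv h f x"])
    fix x assume x: "x \<in> K"
    show "(f has_derivative (\<lambda>h. dir_deriv h f x)) (at x within K)"
      by (rule has_derivative_at_withinI, rule Ck_has_derivative[OF f]) (use assms x in auto)
    show "onorm (\<lambda>h. dir_deriv h f x) \<le> B"
      using B' x by (intro onorm_le) blast
  qed
  with B that show ?thesis by blast
qed

lemma dir_deriv_0_outside:
  assumes "closed C" "\<And>v. v \<notin> C \<Longrightarrow> f v = 0" "v \<notin> C"
  shows "dir_deriv e f v = 0"
proof -
  have "dir_deriv e f v = dir_deriv e (\<lambda>_. 0) v"
    by (rule dir_deriv_cong_open[of "- C"]) (use assms in auto)
  also have "\<dots> = 0" by (simp add: dir_deriv_def)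
  finally show ?thesis .
qed

text \<open>Translation invariance makes the integral of \<open>f (v + t e)\<close> constant in \<open>t\<close>.\<close>

lemma integral_dir_deriv_eq_0:
  fixes f :: "'a::euclidean_space \<Rightarrow> real"
  assumes f: "Ck (Suc 0) UNIV f" and supp: "\<And>v. v \<notin> cbox p q \<Longrightarrow> f v = 0"
  shows "integral (cbox p q) (dir_deriv e f) = 0"
proof -
  \<comment> \<open>Margin of the larger box \<open>P\<close>: it contains every translate of the
    original box by \<open>t\<close> times \<open>e\<close> with \<open>t\<close> between -1 and 1,
    so that one fixed domain serves all \<open>t\<close>.\<close>
  define M where "M = norm e *\<^sub>R (One :: 'a)"
  define P where "P = cbox (p - M) (q + M)"
  have PM: "cbox (p - t *\<^sub>R e) (q - t *\<^sub>R e) \<subseteq> P" if "\<bar>t\<bar> \<le> 1" for t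
  proof -
    have "\<bar>t * (e \<bullet> b)\<bar> \<le> norm e" if b: "b \<in> Basis" for b
    proof -
      have "\<bar>t\<bar> * \<bar>e \<bullet> b\<bar> \<le> 1 * norm e"
        using \<open>\<bar>t\<bar> \<le> 1\<close> Basis_le_norm[OF b] by (intro mult_mono) auto
      then show ?thesis by (simp add: abs_mult)
    qed
    then show ?thesis unfolding P_def M_def
      by (intro subset_box_imp) (auto simp: inner_diff_left inner_add_left abs_le_iff)
  qed
  have cont: "continuous_on UNIV f" "continuous_on UNIV (dir_deriv e f)"
    using Ck_continuous_on[OF f] Ck_dir_deriv[OF f] by auto
  have const: "integral P (\<lambda>v. f (v + t *\<^sub>R e)) = integral (cbox p q) f" if "\<bar>t\<bar> \<le> 1" for t
  proof -
    have "f integrable_on cbox p q" by (intro integrable_continuous continuous_on_subset[OF cont(1)]) simp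
    then have "((\<lambda>v. f (v + t *\<^sub>R e)) has_integral integral (cbox p q) f) (cbox (p - t *\<^sub>R e) (q - t *\<^sub>R e))"
      by (intro has_integral_shift_cbox integrable_integral)
    then have "((\<lambda>v. f (v + t *\<^sub>R e)) has_integral integral (cbox p q) f) P"
      by (rule has_integral_on_superset[OF _ _ PM[OF that]])
        (rule supp, simp add: mem_box inner_diff_left inner_add_left algebra_simps)
    then show ?thesis by (rule integral_unique)
  qed
  have fdiff: "f differentiable (at x)" for x using Ck_imp_differentiable[OF f] by simp
  have "((\<lambda>t. integral P (\<lambda>v. f (v + t *\<^sub>R e))) has_vector_derivative
      integral P (\<lambda>v. dir_deriv e f (v + 0 *\<^sub>R e))) (at 0 within {-1<..<1})"
    unfolding P_def
  proof (rule leibniz_rule_vector_derivative[where fx="\<lambda>t v. dir_deriv e f (v + t *\<^sub>R e)"])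
    show "((\<lambda>t. f (v + t *\<^sub>R e)) has_vector_derivative dir_deriv e f (v + t *\<^sub>R e)) (at t within {-1<..<1})"
      for t v using dir_deriv_line[OF fdiff] by (rule has_vector_derivative_at_within)
    show "(\<lambda>v. f (v + t *\<^sub>R e)) integrable_on cbox (p - M) (q + M)" for t
      by (intro integrable_continuous continuous_on_compose2[OF cont(1)] continuous_intros) auto
    show "continuous_on ({-1<..<1} \<times> cbox (p - M) (q + M)) (\<lambda>(t, v). dir_deriv e f (v + t *\<^sub>R e))"
      unfolding case_prod_beta
      by (intro continuous_on_compose2[OF cont(2)] continuous_intros) auto
  qed auto
  then have 1: "((\<lambda>t. integral P (\<lambda>v. f (v + t *\<^sub>R e))) has_vector_derivative integral P (dir_deriv e f)) (at 0)"
    using at_within_open[of 0 "{-1<..<1::real}"] by simp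
  have "((\<lambda>t. integral (cbox p q) f) has_vector_derivative integral P (dir_deriv e f)) (at 0)"
    by (rule has_vector_derivative_transform_within_open[OF 1, of "{-1<..<1}"]) (use const in auto)
  then have 0: "integral P (dir_deriv e f) = 0"
    by (rule vector_derivative_unique_at) simp
  have "(dir_deriv e f has_integral integral (cbox p q) (dir_deriv e f)) P"
  proof (rule has_integral_on_superset)
    show "(dir_deriv e f has_integral integral (cbox p q) (dir_deriv e f)) (cbox p q)"
      by (intro integrable_integral integrable_continuous continuous_on_subset[OF cont(2)]) simp
    show "cbox p q \<subseteq> P" using PM[of 0] by simp
    show "dir_deriv e f x = 0" if "x \<notin> cbox p q" for x
      by (rule dir_deriv_0_outside[of "cbox p q"]) (use supp that in auto)
  qed
  then show ?thesis using 0 by (simp add: integral_unique)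
qed

text \<open>McShane's extension, the infimum of the cones of slope \<open>L\<close> placed on the
  graph. It supplies the values on the crossing set without any limit being taken.\<close>

lemma lipschitz_extend_UNIV:
  fixes f :: "'a::metric_space \<Rightarrow> real"
  assumes L: "L \<ge> 0" and f: "\<And>x y. x \<in> S \<Longrightarrow> y \<in> S \<Longrightarrow> \<bar>f x - f y\<bar> \<le> L * dist x y"
  obtains g where "L-lipschitz_on UNIV g" "\<And>x. x \<in> S \<Longrightarrow> g x = f x"
proof (cases "S = {}")
  case True
  with L show ?thesis by (intro that[of "\<lambda>_. 0"]) (auto intro: lipschitz_onI)
next
  case False
  then obtain s where s: "s \<in> S" by blast
  define g where "g x = (INF y\<in>S. f y + L * dist x y)" for x
  have bdd: "bdd_below ((\<lambda>y. f y + L * dist x y) ` S)" for x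
  proof (rule bdd_belowI2)
    fix y assume y: "y \<in> S"
    have "L * dist s y \<le> L * (dist x s + dist x y)"
      using L dist_triangle[of s y x] by (intro mult_left_mono) (auto simp: dist_commute)
    then show "f s - L * dist x s \<le> f y + L * dist x y"
      using f[OF s y] by (simp add: algebra_simps)
  qed
  have le: "g x \<le> g y + L * dist x y" for x y
  proof -
    have "g x - L * dist x y \<le> g y"
      unfolding g_def[of y]
    proof (rule cINF_greatest[OF False])
      fix z assume z: "z \<in> S"
      have "g x \<le> f z + L * dist x z" unfolding g_def by (rule cINF_lower[OF bdd z])
      moreover have "L * dist x z \<le> L * (dist x y + dist y z)"
        using L dist_triangle[of x z y] by (intro mult_left_mono) auto
      ultimately show "g x - L * dist x y \<le> f z + L * dist y z" by (simp add: algebra_simps)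
    qed
    then show ?thesis by simp
  qed
  show ?thesis
  proof (rule that)
    show "L-lipschitz_on UNIV g"
    proof (rule lipschitz_onI[OF _ L])
      fix x y show "dist (g x) (g y) \<le> L * dist x y"
        using le[of x y] le[of y x] by (simp add: dist_real_def dist_commute abs_le_iff)
    qed
    show "g x = f x" if x: "x \<in> S" for x
    proof (rule antisym)
      show "g x \<le> f x" unfolding g_def using cINF_lower[OF bdd x, of x] by simp
      show "f x \<le> g x" unfolding g_def
        by (rule cINF_greatest[OF False]) (use f[OF x] in \<open>fastforce simp: abs_le_iff\<close>)
    qed
  qed
qed

text \<open>The shifted box and the original one share all but a slab of width \<open>t\<close> at
  opposite ends; translation by one period carries one slab to the other.\<close>

lemma integral_periodic_shift_Basis:
  fixes f :: "'a::euclidean_space \<Rightarrow> real"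
  assumes cont: "continuous_on UNIV f" and T: "T \<ge> 0"
    and per: "\<And>v b. b \<in> Basis \<Longrightarrow> f (v + T *\<^sub>R b) = f v"
    and b: "b \<in> Basis" and t: "0 \<le> t" "t \<le> T"
  shows "integral (cbox (c + t *\<^sub>R b) (c + T *\<^sub>R One + t *\<^sub>R b)) f = integral (cbox c (c + T *\<^sub>R One)) f"
proof -
  have int: "f integrable_on cbox u v" for u v
    by (intro integrable_continuous continuous_on_subset[OF cont]) simp
  have ib: "i \<bullet> b = (if i = b then 1 else 0)" "b \<bullet> i = (if i = b then 1 else 0)" if "i \<in> Basis" for i
    using that b by (auto simp: inner_Basis)
  let ?B = "cbox c (c + T *\<^sub>R One)" and ?B' = "cbox (c + t *\<^sub>R b) (c + T *\<^sub>R One + t *\<^sub>R b)"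
  have 1: "?B \<inter> {x. x \<bullet> b \<le> c \<bullet> b + t} = cbox c (c + T *\<^sub>R One + (t - T) *\<^sub>R b)"
  proof (rule set_eqI)
    fix x
    show "x \<in> ?B \<inter> {x. x \<bullet> b \<le> c \<bullet> b + t} \<longleftrightarrow> x \<in> cbox c (c + T *\<^sub>R One + (t - T) *\<^sub>R b)"
      using t b by (fastforce simp: mem_box inner_add_left ib split: if_splits)
  qed
  have 2: "?B \<inter> {x. x \<bullet> b \<ge> c \<bullet> b + t} = cbox (c + t *\<^sub>R b) (c + T *\<^sub>R One)"
  proof (rule set_eqI)
    fix x
    show "x \<in> ?B \<inter> {x. x \<bullet> b \<ge> c \<bullet> b + t} \<longleftrightarrow> x \<in> cbox (c + t *\<^sub>R b) (c + T *\<^sub>R One)"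
      using t b by (fastforce simp: mem_box inner_add_left ib split: if_splits)
  qed
  have 3: "?B' \<inter> {x. x \<bullet> b \<le> c \<bullet> b + T} = cbox (c + t *\<^sub>R b) (c + T *\<^sub>R One)"
  proof (rule set_eqI)
    fix x
    show "x \<in> ?B' \<inter> {x. x \<bullet> b \<le> c \<bullet> b + T} \<longleftrightarrow> x \<in> cbox (c + t *\<^sub>R b) (c + T *\<^sub>R One)"
      using t b by (fastforce simp: mem_box inner_add_left ib split: if_splits)
  qed
  have 4: "?B' \<inter> {x. x \<bullet> b \<ge> c \<bullet> b + T} = cbox (c + T *\<^sub>R b) (c + T *\<^sub>R One + t *\<^sub>R b)"
  proof (rule set_eqI)
    fix x
    show "x \<in> ?B' \<inter> {x. x \<bullet> b \<ge> c \<bullet> b + T} \<longleftrightarrow> x \<in> cbox (c + T *\<^sub>R b) (c + T *\<^sub>R One + t *\<^sub>R b)"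
      using t b by (fastforce simp: mem_box inner_add_left ib split: if_splits)
  qed
  have "integral (cbox c (c + T *\<^sub>R One + (t - T) *\<^sub>R b)) (f \<circ> (+) (T *\<^sub>R b)) =
      integral (cbox (c + T *\<^sub>R b) (c + T *\<^sub>R One + (t - T) *\<^sub>R b + T *\<^sub>R b)) f"
    by (rule integral_shift_cbox_plus)
  moreover have "f \<circ> (+) (T *\<^sub>R b) = f"
    using per[OF b] by (auto simp: fun_eq_iff add.commute)
  moreover have "c + T *\<^sub>R One + (t - T) *\<^sub>R b + T *\<^sub>R b = c + T *\<^sub>R One + t *\<^sub>R b"
    by (simp add: algebra_simps)
  ultimately have 5: "integral (cbox c (c + T *\<^sub>R One + (t - T) *\<^sub>R b)) f =
      integral (cbox (c + T *\<^sub>R b) (c + T *\<^sub>R One + t *\<^sub>R b)) f"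
    by simp
  show ?thesis
    using integral_split[OF int b, of c "c + T *\<^sub>R One" "c \<bullet> b + t"]
      integral_split[OF int b, of "c + t *\<^sub>R b" "c + T *\<^sub>R One + t *\<^sub>R b" "c \<bullet> b + T"]
    unfolding 1 2 3 4 5 by simp
qed

lemma integral_periodic_shift:
  fixes f :: "'a::euclidean_space \<Rightarrow> real"
  assumes cont: "continuous_on UNIV f" and T: "T > 0"
    and per: "\<And>v b. b \<in> Basis \<Longrightarrow> f (v + T *\<^sub>R b) = f v"
  shows "integral (cbox c (c + T *\<^sub>R One)) f = integral (cbox 0 (T *\<^sub>R One)) f"
proof -
  let ?I = "\<lambda>c. integral (cbox c (c + T *\<^sub>R One)) f"
  have small: "?I (c + t *\<^sub>R b) = ?I c" if "b \<in> Basis" "0 \<le> t" "t \<le> T" for c b t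
    using integral_periodic_shift_Basis[OF cont _ per that, of c] T by (simp add: algebra_simps)
  have nat: "?I (c + t *\<^sub>R b) = ?I c" if b: "b \<in> Basis" and "0 \<le> t" "t \<le> real n * T" for c b t n
    using that(2,3)
  proof (induction n arbitrary: t)
    case 0
    then show ?case by simp
  next
    case (Suc n)
    show ?case
    proof (cases "t \<le> T")
      case True
      then show ?thesis using small Suc.prems b by blast
    next
      case False
      then have "?I (c + (t - T) *\<^sub>R b + T *\<^sub>R b) = ?I (c + (t - T) *\<^sub>R b)" using small b T by simp
      also have "\<dots> = ?I c" using Suc.prems False by (intro Suc.IH) (auto simp: algebra_simps)
      finally show ?thesis by (simp add: algebra_simps)
    qed
  qed
  have pos: "?I (c + t *\<^sub>R b) = ?I c" if "b \<in> Basis" "0 \<le> t" for c b t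
  proof -
    obtain n where "t / T \<le> real n" using real_arch_simple by blast
    then show ?thesis using nat[OF that, of n c] T by (simp add: field_simps)
  qed
  have all: "?I (c + t *\<^sub>R b) = ?I c" if "b \<in> Basis" for c b t
    using pos[OF that, of t c] pos[OF that, of "- t" "c + t *\<^sub>R b"] by (cases "t \<ge> 0") auto
  \<comment> \<open>The corner is moved from 0 to its place one coordinate at a time.\<close>
  have "?I (\<Sum>b\<in>B. (c \<bullet> b) *\<^sub>R b) = ?I 0" if "finite B" "B \<subseteq> Basis" for B
    using that
  proof (induction B)
    case (insert b B)
    then show ?case using all[of b "\<Sum>b\<in>B. (c \<bullet> b) *\<^sub>R b" "c \<bullet> b"] by (simp add: add.commute)
  qed simp
  from this[of Basis] show ?thesis by (simp add: euclidean_representation)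
qed

subsection \<open>Keplerian positions\<close>

lemma abs_sin_diff_le: "\<bar>sin x - sin y\<bar> \<le> \<bar>x - y\<bar>" for x y :: real
proof -
  have "\<bar>sin x - sin y\<bar> = 2 * \<bar>sin ((x - y) / 2)\<bar> * \<bar>cos ((x + y) / 2)\<bar>"
    by (simp add: sin_diff_sin abs_mult)
  also have "\<dots> \<le> 2 * \<bar>(x - y) / 2\<bar> * 1"
    by (intro mult_mono abs_sin_x_le_abs_x) auto
  finally show ?thesis by simp
qed

text \<open>The coefficient comes from \<open>sin\<close> being 1-Lipschitz. With equal
  eccentricities this gives uniqueness for Kepler's equation, with different ones continuity of the
  solution in both arguments.\<close>

lemma kepler_diff_bound:
  fixes e1 e2 u1 u2 :: real
  shows "(1 - \<bar>e1\<bar>) * \<bar>u1 - u2\<bar> \<le> \<bar>(u1 - e1 * sin u1) - (u2 - e2 * sin u2)\<bar> + \<bar>e1 - e2\<bar>"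
proof -
  have "u1 - u2 = ((u1 - e1 * sin u1) - (u2 - e2 * sin u2)) + e1 * (sin u1 - sin u2) + (e1 - e2) * sin u2"
    by (simp add: algebra_simps)
  then have "\<bar>u1 - u2\<bar> \<le> \<bar>(u1 - e1 * sin u1) - (u2 - e2 * sin u2)\<bar> + \<bar>e1 * (sin u1 - sin u2)\<bar> + \<bar>(e1 - e2) * sin u2\<bar>"
    by linarith
  moreover have "\<bar>e1 * (sin u1 - sin u2)\<bar> \<le> \<bar>e1\<bar> * \<bar>u1 - u2\<bar>"
    unfolding abs_mult by (intro mult_left_mono abs_sin_diff_le) auto
  moreover have "\<bar>(e1 - e2) * sin u2\<bar> \<le> \<bar>e1 - e2\<bar> * 1"
    unfolding abs_mult by (intro mult_left_mono) auto
  ultimately show ?thesis by (simp add: algebra_simps)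
qed

lemma kepler_ex1:
  fixes e l :: real
  assumes e: "\<bar>e\<bar> < 1"
  shows "\<exists>!u. u - e * sin u = l"
proof (rule ex_ex1I)
  have "\<bar>e * sin u\<bar> \<le> 1" for u
    unfolding abs_mult using e by (intro mult_le_one) auto
  \<comment> \<open>Since the correction \<open>e * sin u\<close> never exceeds 1 in absolute value,
    a solution is trapped between \<open>l - 1\<close> and \<open>l + 1\<close>.\<close>
  then have "(l - 1) - e * sin (l - 1) \<le> l" "l \<le> (l + 1) - e * sin (l + 1)"
    by (simp_all add: abs_le_iff)
  then show "\<exists>u. u - e * sin u = l"
    using IVT'[of "\<lambda>u. u - e * sin u" "l - 1" l "l + 1"] by (fastforce intro!: continuous_intros)
next
  fix u v assume "u - e * sin u = l" "v - e * sin v = l"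
  then have "(1 - \<bar>e\<bar>) * \<bar>u - v\<bar> \<le> 0" using kepler_diff_bound[of e u v e] by simp
  then show "u = v" using e by (simp add: mult_le_0_iff)
qed

lemma eccentric_anomaly:
  "\<bar>e\<bar> < 1 \<Longrightarrow> eccentric_anomaly e l - e * sin (eccentric_anomaly e l) = l"
  unfolding eccentric_anomaly_def by (rule theI'[OF kepler_ex1])

lemma eccentric_anomaly_periodic:
  assumes "\<bar>e\<bar> < 1"
  shows "eccentric_anomaly e (l + 2 * pi) = eccentric_anomaly e l + 2 * pi"
proof -
  have "(eccentric_anomaly e l + 2 * pi) - e * sin (eccentric_anomaly e l + 2 * pi) = l + 2 * pi"
    using eccentric_anomaly[OF assms, of l] by simp
  then show ?thesis using kepler_ex1[OF assms] eccentric_anomaly[OF assms] by metis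
qed

lemma kepler_pos: "\<bar>e\<bar> < 1 \<Longrightarrow> 1 - e * cos u > 0" for e u :: real
proof -
  assume e: "\<bar>e\<bar> < 1"
  have "e * cos u \<le> \<bar>e\<bar> * \<bar>cos u\<bar>" by (metis abs_ge_self abs_mult)
  also have "\<dots> \<le> \<bar>e\<bar> * 1" by (intro mult_left_mono) auto
  finally show ?thesis using e by simp
qed

lemma isCont_eccentric_anomaly:
  assumes e: "\<bar>fst x0\<bar> < 1"
  shows "isCont (\<lambda>x. eccentric_anomaly (fst x) (snd x)) x0"
proof -
  let ?u = "\<lambda>x. eccentric_anomaly (fst x) (snd x)"
  define b where "b x = (\<bar>snd x0 - snd x\<bar> + \<bar>fst x0 - fst x\<bar>) / (1 - \<bar>fst x0\<bar>)" for x :: "real \<times> real"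
  have "open {x :: real \<times> real. \<bar>fst x\<bar> < 1}" by (intro open_Collect_less continuous_intros)
  then have ev: "\<forall>\<^sub>F x in at x0. \<bar>fst x\<bar> < 1"
    using e eventually_at_in_open'[of "{x :: real \<times> real. \<bar>fst x\<bar> < 1}" x0] by simp
  have "(b \<longlongrightarrow> b x0) (at x0)"
    unfolding b_def using e by (intro tendsto_intros) auto
  then have b: "(b \<longlongrightarrow> 0) (at x0)" by (simp add: b_def)
  have "((\<lambda>x. ?u x - ?u x0) \<longlongrightarrow> 0) (at x0)"
  proof (rule Lim_null_comparison[OF _ b])
    show "\<forall>\<^sub>F x in at x0. norm (?u x - ?u x0) \<le> b x"
      using ev
    proof eventually_elim
      case (elim x)
      have "(1 - \<bar>fst x0\<bar>) * \<bar>?u x0 - ?u x\<bar> \<le> \<bar>snd x0 - snd x\<bar> + \<bar>fst x0 - fst x\<bar>"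
        using kepler_diff_bound[of "fst x0" "?u x0" "?u x" "fst x"]
        by (simp only: eccentric_anomaly[OF e] eccentric_anomaly[OF elim])
      then show ?case using e by (simp add: b_def pos_le_divide_eq mult.commute abs_minus_commute)
    qed
  qed
  then show ?thesis unfolding isCont_def by (simp add: LIM_zero_iff)
qed

lemma has_derivative_eccentric_anomaly:
  assumes e: "\<bar>fst x0\<bar> < 1"
  defines "u \<equiv> \<lambda>x. eccentric_anomaly (fst x) (snd x)"
  shows "(u has_derivative (\<lambda>h. (fst h * sin (u x0) + snd h) / (1 - fst x0 * cos (u x0)))) (at x0)"
proof -
  let ?f = "\<lambda>p :: (real \<times> real) \<times> real. snd p - fst (fst p) * sin (snd p) - snd (fst p)"
  let ?c = "1 - fst x0 * cos (u x0)"
  have c: "?c > 0" using kepler_pos[OF e] .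
  have "(u has_derivative (\<lambda>h. - ((\<lambda>v. v / ?c)
      ((\<lambda>p. snd p - (fst (fst p) * sin (u x0) + fst x0 * (snd p * cos (u x0))) - snd (fst p)) (h, 0)))))
    (at x0)"
  proof (rule has_derivative_implicit[where f = ?f and A = "\<lambda>v. v / ?c" and
      f' = "\<lambda>p. snd p - (fst (fst p) * sin (u x0) + fst x0 * (snd p * cos (u x0))) - snd (fst p)"])
    show "(?f has_derivative (\<lambda>p. snd p - (fst (fst p) * sin (u x0) + fst x0 * (snd p * cos (u x0))) - snd (fst p)))
        (at (x0, u x0))"
      by (auto intro!: derivative_eq_intros simp: algebra_simps)
    show "isCont u x0" unfolding u_def by (rule isCont_eccentric_anomaly[OF e])
    have "open {x :: real \<times> real. \<bar>fst x\<bar> < 1}" by (intro open_Collect_less continuous_intros)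
    then have "\<forall>\<^sub>F x in nhds x0. \<bar>fst x\<bar> < 1"
      using e eventually_nhds_in_open[of "{x :: real \<times> real. \<bar>fst x\<bar> < 1}" x0] by simp
    then show "\<forall>\<^sub>F x in nhds x0. ?f (x, u x) = 0"
      by eventually_elim (simp add: u_def eccentric_anomaly)
    show "bounded_linear (\<lambda>v. v / ?c)" by (rule bounded_linear_divide)
    show "(snd (0, k) - (fst (fst (0 :: real \<times> real, k)) * sin (u x0) + fst x0 * (snd (0 :: real \<times> real, k) * cos (u x0))) -
      snd (fst (0 :: real \<times> real, k))) / ?c = k" for k
      using c by (simp add: field_simps)
  qed
  then show ?thesis by (simp add: diff_divide_distrib add_divide_distrib add.commute)
qed

text \<open>The derivative of the solution is a quotient of smooth expressions in the solution
  itself, and its denominator \<open>1 - e * cos u\<close> stays positive for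
  \<open>\<bar>e\<bar> < 1\<close>, so regularity of order \<open>k\<close> lifts to order
  \<open>k + 1\<close>.\<close>

lemma Ck_eccentric_anomaly:
  "Ck k {x. \<bar>fst x\<bar> < 1} (\<lambda>x. eccentric_anomaly (fst x) (snd x))"
proof (induction k)
  have o: "open {x :: real \<times> real. \<bar>fst x\<bar> < 1}" by (intro open_Collect_less continuous_intros)
  {
    case 0
    show ?case by (auto intro!: continuous_at_imp_continuous_on isCont_eccentric_anomaly)
  next
    case (Suc k)
    show ?case
    proof (rule Ck_SucI[OF o])
      show "((\<lambda>x. eccentric_anomaly (fst x) (snd x)) has_derivative
        (\<lambda>h. (fst h * sin (eccentric_anomaly (fst x) (snd x)) + snd h) /
          (1 - fst x * cos (eccentric_anomaly (fst x) (snd x))))) (at x)" if "x \<in> {x. \<bar>fst x\<bar> < 1}" for x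
        using has_derivative_eccentric_anomaly[of x] that by simp
      show "Ck k {x. \<bar>fst x\<bar> < 1} (\<lambda>x. (fst v * sin (eccentric_anomaly (fst x) (snd x)) + snd v) /
          (1 - fst x * cos (eccentric_anomaly (fst x) (snd x))))" for v
        by (intro Ck_divide Ck_add Ck_mult Ck_diff Ck_const Ck_sin Ck_cos Ck_fst o Suc)
          (use kepler_pos in \<open>force simp: less_imp_neq\<close>)
    qed
  }
qed

lemma open_regular_elements: "open regular_elements"
  unfolding regular_elements_def
  by (intro open_Collect_conj open_Collect_less continuous_intros)

lemma regular_elements_pos:
  assumes "E \<in> regular_elements"
  shows "E $ 2 > 0" "E $ 1 > 0" "(E $ 2 / E $ 1)\<^sup>2 < 1" "0 < (E $ 2 / E $ 1)\<^sup>2" "\<bar>E $ 3 / E $ 2\<bar> < 1"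
    "(E $ 3 / E $ 2)\<^sup>2 < 1"
proof -
  have E: "0 < E $ 2" "E $ 2 < E $ 1" "\<bar>E $ 3\<bar> < E $ 2"
    using assms by (auto simp: regular_elements_def)
  then show "E $ 2 > 0" "E $ 1 > 0" "0 < (E $ 2 / E $ 1)\<^sup>2" by auto
  have "\<bar>E $ 2 / E $ 1\<bar> < 1" using E by (simp add: abs_divide)
  then show "(E $ 2 / E $ 1)\<^sup>2 < 1" by (simp add: abs_square_less_1)
  show "\<bar>E $ 3 / E $ 2\<bar> < 1" using E by (simp add: abs_divide)
  then show "(E $ 3 / E $ 2)\<^sup>2 < 1" by (simp add: abs_square_less_1)
qed

lemma eccentricity_bounds: "E \<in> regular_elements \<Longrightarrow> \<bar>eccentricity E\<bar> < 1"
  using regular_elements_pos[of E] by (auto simp: eccentricity_def real_sqrt_lt_1_iff)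

lemma Ck_matrix_vector_mult:
  fixes A :: "'a::euclidean_space \<Rightarrow> real ^ 'n ^ 'm"
  assumes "open S" "\<And>i j. Ck k S (\<lambda>z. A z $ i $ j)" "Ck k S x"
  shows "Ck k S (\<lambda>z. A z *v x z)"
proof (rule Ck_vec[OF assms(1)])
  show "Ck k S (\<lambda>z. (A z *v x z) $ i)" for i
    unfolding matrix_vector_mult_def vec_lambda_beta
    by (intro Ck_sum Ck_mult Ck_nth assms)
qed

lemma Ck_vector_3:
  assumes "open S" "Ck k S a" "Ck k S b" "Ck k S c"
  shows "Ck k S (\<lambda>z. vector [a z, b z, c z :: real] :: real ^ 3)"
proof (rule Ck_vec[OF assms(1)])
  show "Ck k S (\<lambda>z. (vector [a z, b z, c z] :: real ^ 3) $ i)" for i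
    using exhaust_3[of i] assms by auto
qed

lemma Ck_rot:
  assumes "open S" "Ck k S (\<lambda>z. cos (t z))" "Ck k S (\<lambda>z. sin (t z))"
  shows "Ck k S (\<lambda>z. rot_z (t z) $ i $ j)" "Ck k S (\<lambda>z. rot_x (t z) $ i $ j)"
  using exhaust_3[of i] exhaust_3[of j] assms Ck_minus[OF assms(1) assms(3)] Ck_const[OF assms(1)]
  by (auto simp: rot_z_def rot_x_def)

lemma Ck_position:
  "Ck k (regular_elements \<times> UNIV) (\<lambda>z. position k0 (fst z) (snd z))"
proof -
  let ?S = "regular_elements \<times> (UNIV :: real set)"
  have o: "open ?S" by (intro open_Times open_regular_elements open_UNIV)
  have E: "Ck k ?S (\<lambda>z. fst z $ i)" for i by (intro Ck_intros o)
  have ratio: "Ck k ?S (\<lambda>z. fst z $ 2 / fst z $ 1)"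
    by (intro Ck_divide o E) (use regular_elements_pos in \<open>force simp: less_imp_neq\<close>)
  have e: "Ck k ?S (\<lambda>z. eccentricity (fst z))"
    unfolding eccentricity_def using regular_elements_pos
    by (intro Ck_sqrt Ck_diff Ck_const Ck_power o ratio) auto
  have u: "Ck k ?S (\<lambda>z. eccentric_anomaly (eccentricity (fst z)) (snd z))"
  proof -
    have "Ck k ?S (\<lambda>z. (\<lambda>x. eccentric_anomaly (fst x) (snd x)) (eccentricity (fst z), snd z))"
    proof (rule Ck_compose[OF o _ Ck_eccentric_anomaly])
      show "open {x :: real \<times> real. \<bar>fst x\<bar> < 1}" by (intro open_Collect_less continuous_intros)
    qed (auto intro!: Ck_Pair o e Ck_snd eccentricity_bounds)
    then show ?thesis by simp
  qed
  have ratio3: "Ck k ?S (\<lambda>z. fst z $ 3 / fst z $ 2)"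
    by (intro Ck_divide o E) (use regular_elements_pos in \<open>force simp: less_imp_neq\<close>)
  \<comment> \<open>The inclination enters only through its cosine and sine, which are algebraic in
    \<open>Z / G\<close>: the quotient itself and the square root of one minus its square.\<close>
  have cosI: "Ck k ?S (\<lambda>z. cos (inclination (fst z)))"
    by (rule Ck_cong[OF o _ ratio3])
      (use regular_elements_pos(5) in \<open>auto simp: inclination_def cos_arccos_abs less_imp_le\<close>)
  have "Ck k ?S (\<lambda>z. sqrt (1 - (fst z $ 3 / fst z $ 2)\<^sup>2))"
    using regular_elements_pos by (intro Ck_sqrt Ck_diff Ck_const Ck_power o ratio3) auto
  then have sinI: "Ck k ?S (\<lambda>z. sin (inclination (fst z)))"
    by (rule Ck_cong[OF o, rotated])
      (use regular_elements_pos(5) in \<open>auto simp: inclination_def sin_arccos_abs less_imp_le\<close>)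
  have sq: "Ck k ?S (\<lambda>z. sqrt (1 - (eccentricity (fst z))\<^sup>2))"
  proof (intro Ck_sqrt Ck_diff Ck_const Ck_power o e)
    show "0 < 1 - (eccentricity (fst z))\<^sup>2" if "z \<in> ?S" for z
      using eccentricity_bounds[of "fst z"] that by (auto simp: abs_square_less_1)
  qed
  have a: "Ck k ?S (\<lambda>z. semimajor_axis k0 (fst z))"
    unfolding semimajor_axis_def divide_inverse by (intro Ck_power Ck_mult Ck_const o E)
  show ?thesis
    unfolding position_def Let_def
    by (intro Ck_matrix_vector_mult Ck_rot Ck_vector_3 o Ck_mult Ck_diff Ck_cos[OF o u] Ck_sin[OF o u]
        Ck_cos[OF o E] Ck_sin[OF o E] Ck_const a e sq cosI sinI)
qed

lemma position_periodic:
  "E \<in> regular_elements \<Longrightarrow> position k0 E (l + 2 * pi) = position k0 E l"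
  by (simp add: position_def Let_def eccentric_anomaly_periodic[OF eccentricity_bounds])

subsection \<open>Kernel integrals over the plane\<close>

text \<open>Formulated for the nonnegative integral, so that Tonelli's theorem can chain the
  one-dimensional results without integrability conditions.\<close>

lemma nn_integral_FTC_UNIV:
  fixes f F :: "real \<Rightarrow> real"
  assumes F: "\<And>x. DERIV F x :> f x" and f: "\<And>x. isCont f x" and nonneg: "\<And>x. 0 \<le> f x"
    and A: "(F \<longlongrightarrow> A) at_bot" and B: "(F \<longlongrightarrow> B) at_top"
  shows "(\<integral>\<^sup>+x. ennreal (f x) \<partial>lborel) = ennreal (B - A)"
proof -
  have A': "((F \<circ> real_of_ereal) \<longlongrightarrow> A) (at_right (-\<infinity>))"
    and B': "((F \<circ> real_of_ereal) \<longlongrightarrow> B) (at_left \<infinity>)"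
    using A B by (simp_all add: ereal_tendsto_simps)
  have "set_integrable lborel (einterval (-\<infinity>) \<infinity>) f" "(LBINT x=-\<infinity>..\<infinity>. f x) = B - A"
    using interval_integral_FTC_nonneg[of "-\<infinity>" \<infinity> F f A B, OF _ F f _ A' B'] nonneg by simp_all
  then have "integrable lborel f" "integral\<^sup>L lborel f = B - A"
    by (simp_all add: set_integrable_def interval_lebesgue_integral_def set_lebesgue_integral_def)
  then show ?thesis by (simp add: nn_integral_eq_integral nonneg)
qed

lemma tendsto_ratio_sqrt:
  fixes c g :: real
  assumes "g > 0"
  shows "((\<lambda>y. y / sqrt (c + g * y\<^sup>2)) \<longlongrightarrow> 1 / sqrt g) at_top"
proof (rule Lim_transform_eventually)
  have "((\<lambda>y. 1 / sqrt (c * (inverse y)\<^sup>2 + g)) \<longlongrightarrow> 1 / sqrt (c * 0\<^sup>2 + g)) at_top"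
    using assms by (intro tendsto_intros tendsto_inverse_0_at_top filterlim_ident) auto
  then show "((\<lambda>y. 1 / sqrt (c * (inverse y)\<^sup>2 + g)) \<longlongrightarrow> 1 / sqrt g) at_top" by simp
  show "\<forall>\<^sub>F y in at_top. 1 / sqrt (c * (inverse y)\<^sup>2 + g) = y / sqrt (c + g * y\<^sup>2)"
    using eventually_gt_at_top[of 0]
  proof eventually_elim
    case (elim y)
    have "c * (inverse y)\<^sup>2 + g = (c + g * y\<^sup>2) / y\<^sup>2"
      using elim by (simp add: field_simps)
    then have "sqrt (c * (inverse y)\<^sup>2 + g) = sqrt (c + g * y\<^sup>2) / y"
      using elim by (simp add: real_sqrt_divide)
    then show ?case by simp
  qed
qed

text \<open>The antiderivative is \<open>(x + b) / (c * sqrt (c + g * (x + b)\<^sup>2))\<close>,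
  with limits plus and minus \<open>1 / (c * sqrt g)\<close> at the two ends.\<close>

lemma nn_integral_inverse_sqrt_cubed:
  fixes c g b :: real
  assumes "c > 0" "g > 0"
  shows "(\<integral>\<^sup>+x. ennreal (1 / sqrt (c + g * (x + b)\<^sup>2) ^ 3) \<partial>lborel) = ennreal (2 / (c * sqrt g))"
proof -
  have pos: "c + g * (x + b)\<^sup>2 > 0" for x using assms by (intro add_pos_nonneg) auto
  let ?F = "\<lambda>x. (x + b) / (c * sqrt (c + g * (x + b)\<^sup>2))"
  have deriv: "DERIV ?F x :> 1 / sqrt (c + g * (x + b)\<^sup>2) ^ 3" for x
  proof -
    define r where "r = sqrt (c + g * (x + b)\<^sup>2)"
    have r: "r > 0" "r\<^sup>2 = c + g * (x + b)\<^sup>2" using pos[of x] by (auto simp: r_def)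
    have "DERIV ?F x :> (c * r - (x + b) * (c * (g * (2 * (x + b)) * (inverse r / 2)))) / (c * r)\<^sup>2"
      using pos[of x] assms r(1)
      by (auto intro!: derivative_eq_intros simp: r_def power2_eq_square)
    moreover have "(c * r - (x + b) * (c * (g * (2 * (x + b)) * (inverse r / 2)))) / (c * r)\<^sup>2 = 1 / r ^ 3"
    proof -
      have "c * r - (x + b) * (c * (g * (2 * (x + b)) * (inverse r / 2))) = c * (r\<^sup>2 - g * (x + b)\<^sup>2) / r"
        using r(1) by (simp add: field_simps power2_eq_square)
      also have "\<dots> = c\<^sup>2 / r" using r(2) by (simp add: power2_eq_square)
      finally have num: "c * r - (x + b) * (c * (g * (2 * (x + b)) * (inverse r / 2))) = c\<^sup>2 / r" .
      show ?thesis unfolding num using r(1) assms by (simp add: field_simps power2_eq_square power3_eq_cube)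
    qed
    ultimately show ?thesis by (simp add: r_def)
  qed
  have cont: "isCont (\<lambda>x. 1 / sqrt (c + g * (x + b)\<^sup>2) ^ 3) x" for x
    using pos[of x] by (intro continuous_intros) auto
  have top: "(?F \<longlongrightarrow> 1 / (c * sqrt g)) at_top"
  proof -
    have "((\<lambda>x. (x + b) / sqrt (c + g * (x + b)\<^sup>2)) \<longlongrightarrow> 1 / sqrt g) at_top"
      by (rule filterlim_compose[OF tendsto_ratio_sqrt[OF assms(2)]])
        (use filterlim_tendsto_add_at_top[OF tendsto_const[of b] filterlim_ident] in \<open>simp add: add.commute\<close>)
    then have "((\<lambda>x. (1 / c) * ((x + b) / sqrt (c + g * (x + b)\<^sup>2))) \<longlongrightarrow> (1 / c) * (1 / sqrt g)) at_top"
      by (rule tendsto_mult_left)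
    then show ?thesis by simp
  qed
  have bot: "(?F \<longlongrightarrow> - (1 / (c * sqrt g))) at_bot"
  proof -
    have lim: "filterlim (\<lambda>x. - (x + b)) at_top at_bot"
      using filterlim_tendsto_add_at_top[OF tendsto_const[of "- b"] filterlim_uminus_at_top_at_bot]
      by (simp add: algebra_simps)
    have "((\<lambda>x. (- (x + b)) / sqrt (c + g * (- (x + b))\<^sup>2)) \<longlongrightarrow> 1 / sqrt g) at_bot"
      by (rule filterlim_compose[OF tendsto_ratio_sqrt[OF assms(2)] lim])
    then have "((\<lambda>x. (- 1 / c) * ((- (x + b)) / sqrt (c + g * (- (x + b))\<^sup>2))) \<longlongrightarrow> (- 1 / c) * (1 / sqrt g)) at_bot"
      by (rule tendsto_mult_left)
    moreover have "(- 1 / c) * ((- (x + b)) / sqrt (c + g * (- (x + b))\<^sup>2)) = ?F x" for x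
      unfolding power2_minus minus_divide_left[symmetric] by simp
    ultimately show ?thesis by (simp only:) simp
  qed
  have "(\<integral>\<^sup>+x. ennreal (1 / sqrt (c + g * (x + b)\<^sup>2) ^ 3) \<partial>lborel)
      = ennreal (1 / (c * sqrt g) - - (1 / (c * sqrt g)))"
    using pos by (intro nn_integral_FTC_UNIV[OF deriv cont _ bot top]) (simp add: less_imp_le)
  then show ?thesis by simp
qed

lemma nn_integral_inverse_square_plus:
  fixes s k :: real
  assumes "s > 0" "k > 0"
  shows "(\<integral>\<^sup>+y. ennreal (1 / (s\<^sup>2 + k * y\<^sup>2)) \<partial>lborel) = ennreal (pi / (s * sqrt k))"
proof -
  have pos: "s\<^sup>2 + k * y\<^sup>2 > 0" for y using assms by (intro add_pos_nonneg) auto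
  let ?F = "\<lambda>y. arctan (sqrt k / s * y) / (s * sqrt k)"
  have deriv: "DERIV ?F y :> 1 / (s\<^sup>2 + k * y\<^sup>2)" for y
  proof -
    have "DERIV ?F y :> (sqrt k / s) * inverse (1 + (sqrt k / s * y)\<^sup>2) / (s * sqrt k)"
      using assms by (auto intro!: derivative_eq_intros simp: divide_inverse mult_ac)
    moreover have "(sqrt k / s) * inverse (1 + (sqrt k / s * y)\<^sup>2) / (s * sqrt k) = 1 / (s\<^sup>2 + k * y\<^sup>2)"
    proof -
      have eq: "1 + (sqrt k / s * y)\<^sup>2 = (s\<^sup>2 + k * y\<^sup>2) / s\<^sup>2"
        using assms by (simp add: field_simps power_mult_distrib power_divide)
      have frac: "(w / s) * inverse (D / s\<^sup>2) / (s * w) = 1 / D" if "w > 0" "D > 0" for w D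
        using that assms by (simp add: field_simps power2_eq_square)
      show ?thesis unfolding eq using assms pos[of y] by (intro frac) auto
    qed
    ultimately show ?thesis by simp
  qed
  have cont: "isCont (\<lambda>y. 1 / (s\<^sup>2 + k * y\<^sup>2)) y" for y
    using pos[of y] by (intro continuous_intros) auto
  have top: "(?F \<longlongrightarrow> (pi / 2) / (s * sqrt k)) at_top"
    using assms
    by (intro tendsto_divide tendsto_const filterlim_compose[OF tendsto_arctan_at_top]
        filterlim_tendsto_pos_mult_at_top[OF tendsto_const] filterlim_ident) auto
  have bot: "(?F \<longlongrightarrow> (- (pi / 2)) / (s * sqrt k)) at_bot"
    using assms
    by (intro tendsto_divide tendsto_const filterlim_compose[OF tendsto_arctan_at_bot]
        filterlim_tendsto_pos_mult_at_bot[OF tendsto_const] filterlim_ident) auto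
  have "(\<integral>\<^sup>+y. ennreal (1 / (s\<^sup>2 + k * y\<^sup>2)) \<partial>lborel) =
      ennreal ((pi / 2) / (s * sqrt k) - (- (pi / 2)) / (s * sqrt k))"
    using pos by (intro nn_integral_FTC_UNIV[OF deriv cont _ bot top]) (simp add: less_imp_le)
  also have "(pi / 2) / (s * sqrt k) - (- (pi / 2)) / (s * sqrt k) = pi / (s * sqrt k)"
    using assms by (simp add: field_simps)
  finally show ?thesis .
qed

section \<open>Lebesgue measure on the plane as a product measure\<close>

lemma vector2_continuous: "continuous_on S (\<lambda>p. vector [fst p, snd p] :: real ^ 2)"
proof -
  have "vector [fst p, snd p] = fst p *\<^sub>R axis 1 1 + snd p *\<^sub>R (axis 2 1 :: real ^ 2)" for p :: "real \<times> real"
    by (simp add: vec_eq_iff forall_2 axis_def)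
  then show ?thesis by (auto intro!: continuous_intros)
qed

lemma Basis_real2: "(Basis :: (real ^ 2) set) = {axis 1 1, axis 2 1}"
  by (auto simp: Basis_vec_def exhaust_2) (metis exhaust_2)

lemma axis_1_neq_2: "axis 1 (1::real) \<noteq> (axis 2 1 :: real ^ 2)"
  by (simp add: axis_eq_axis)

text \<open>The image measure agrees with Lebesgue measure on boxes, which determines it. This makes
  iterated integrals available on \<open>real ^ 2\<close>.\<close>

lemma lborel_real2: "lborel = distr (lborel \<Otimes>\<^sub>M lborel) borel (\<lambda>p. vector [fst p, snd p] :: real ^ 2)"
proof (rule lborel_eqI)
  have m: "(\<lambda>p. vector [fst p, snd p] :: real ^ 2) \<in> borel_measurable (lborel \<Otimes>\<^sub>M lborel)"
    unfolding lborel_prod using borel_measurable_continuous_onI[OF vector2_continuous] by simp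
  fix l u :: "real ^ 2" assume le: "\<And>b. b \<in> Basis \<Longrightarrow> l \<bullet> b \<le> u \<bullet> b"
  have le': "l $ 1 \<le> u $ 1" "l $ 2 \<le> u $ 2"
    using le[of "axis 1 1"] le[of "axis 2 1"] by (simp_all add: Basis_real2 inner_axis)
  have vim: "(\<lambda>p. vector [fst p, snd p]) -` box l u = {l $ 1<..<u $ 1} \<times> {l $ 2<..<u $ 2}"
    by (auto simp: mem_box Basis_real2 inner_axis)
  have "emeasure (distr (lborel \<Otimes>\<^sub>M lborel) borel (\<lambda>p. vector [fst p, snd p])) (box l u) =
      emeasure (lborel \<Otimes>\<^sub>M lborel) ({l $ 1<..<u $ 1} \<times> {l $ 2<..<u $ 2})"
    using m by (subst emeasure_distr) (auto simp: vim space_pair_measure)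
  also have "\<dots> = ennreal (u $ 1 - l $ 1) * ennreal (u $ 2 - l $ 2)"
    using le' by (subst lborel.emeasure_pair_measure_Times) auto
  also have "\<dots> = (\<Prod>b\<in>Basis. (u - l) \<bullet> b)"
    using le' by (simp add: Basis_real2 inner_axis axis_1_neq_2 ennreal_mult[symmetric])
  finally show "emeasure (distr (lborel \<Otimes>\<^sub>M lborel) borel (\<lambda>p. vector [fst p, snd p])) (box l u)
      = (\<Prod>b\<in>Basis. (u - l) \<bullet> b)" .
qed simp

lemma nn_integral_real2:
  fixes f :: "real ^ 2 \<Rightarrow> ennreal"
  assumes [measurable]: "f \<in> borel_measurable borel"
  shows "(\<integral>\<^sup>+v. f v \<partial>lborel) = (\<integral>\<^sup>+y. (\<integral>\<^sup>+x. f (vector [x, y]) \<partial>lborel) \<partial>lborel)"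
    and "(\<integral>\<^sup>+v. f v \<partial>lborel) = (\<integral>\<^sup>+x. (\<integral>\<^sup>+y. f (vector [x, y]) \<partial>lborel) \<partial>lborel)"
proof -
  have m: "(\<lambda>p. vector [fst p, snd p] :: real ^ 2) \<in> borel_measurable (lborel \<Otimes>\<^sub>M lborel)"
    unfolding lborel_prod using borel_measurable_continuous_onI[OF vector2_continuous] by simp
  have fm: "(\<lambda>p. f (vector [fst p, snd p])) \<in> borel_measurable (lborel \<Otimes>\<^sub>M lborel)"
    using m assms by (rule measurable_compose)
  have "(\<integral>\<^sup>+v. f v \<partial>lborel) = (\<integral>\<^sup>+p. f (vector [fst p, snd p]) \<partial>(lborel \<Otimes>\<^sub>M lborel))"
    by (subst lborel_real2, subst nn_integral_distr[OF m]) auto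
  then show "(\<integral>\<^sup>+v. f v \<partial>lborel) = (\<integral>\<^sup>+y. (\<integral>\<^sup>+x. f (vector [x, y]) \<partial>lborel) \<partial>lborel)"
    and "(\<integral>\<^sup>+v. f v \<partial>lborel) = (\<integral>\<^sup>+x. (\<integral>\<^sup>+y. f (vector [x, y]) \<partial>lborel) \<partial>lborel)"
    using lborel_pair.nn_integral_snd[OF fm] lborel.nn_integral_fst[OF fm] by simp_all
qed

text \<open>Completing the square in the first variable reduces the inner integral to the inverse
  cube of a root; what remains for the outer one is an inverse quadratic with an arctangent as
  antiderivative.\<close>

lemma nn_integral_quadratic_kernel:
  fixes s g11 g12 g22 :: real
  assumes s: "s > 0" and g: "g11 > 0" "g11 * g22 - g12\<^sup>2 > 0"
  shows "(\<integral>\<^sup>+v. ennreal (1 / sqrt (s\<^sup>2 + (g11 * (v $ 1)\<^sup>2 + 2 * g12 * (v $ 1) * (v $ 2) + g22 * (v $ 2)\<^sup>2)) ^ 3)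
      \<partial>(lborel :: (real ^ 2) measure)) = ennreal (2 * pi / (s * sqrt (g11 * g22 - g12\<^sup>2)))"
proof -
  \<comment> \<open>The Schur complement of \<open>g11\<close>; the product \<open>g11 * k\<close>
    is the determinant, which is why only the root of the determinant survives.\<close>
  define k where "k = (g11 * g22 - g12\<^sup>2) / g11"
  have k: "k > 0" using g by (simp add: k_def)
  have q: "s\<^sup>2 + (g11 * x\<^sup>2 + 2 * g12 * x * y + g22 * y\<^sup>2) = (s\<^sup>2 + k * y\<^sup>2) + g11 * (x + g12 / g11 * y)\<^sup>2" for x y
    using g(1) by (simp add: k_def field_simps power2_eq_square)
  have pos: "s\<^sup>2 + k * y\<^sup>2 > 0" for y using s k by (intro add_pos_nonneg) auto
  have "(\<integral>\<^sup>+v. ennreal (1 / sqrt (s\<^sup>2 + (g11 * (v $ 1)\<^sup>2 + 2 * g12 * (v $ 1) * (v $ 2) + g22 * (v $ 2)\<^sup>2)) ^ 3)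
      \<partial>(lborel :: (real ^ 2) measure)) =
    (\<integral>\<^sup>+y. (\<integral>\<^sup>+x. ennreal (1 / sqrt ((s\<^sup>2 + k * y\<^sup>2) + g11 * (x + g12 / g11 * y)\<^sup>2) ^ 3) \<partial>lborel) \<partial>lborel)"
    by (subst nn_integral_real2(1)) (simp_all add: q)
  also have "\<dots> = (\<integral>\<^sup>+y. ennreal (2 / sqrt g11) * ennreal (1 / (s\<^sup>2 + k * y\<^sup>2)) \<partial>lborel)"
    by (intro nn_integral_cong, subst nn_integral_inverse_sqrt_cubed)
      (use pos g in \<open>auto simp: ennreal_mult[symmetric] less_imp_le mult.commute\<close>)
  also have "\<dots> = ennreal (2 / sqrt g11) * ennreal (pi / (s * sqrt k))"
    by (subst nn_integral_cmult) (simp_all add: nn_integral_inverse_square_plus[OF s k])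
  also have "\<dots> = ennreal (2 / sqrt g11 * (pi / (s * sqrt k)))"
    using s k g by (subst ennreal_mult) auto
  also have "2 / sqrt g11 * (pi / (s * sqrt k)) = 2 * pi / (s * sqrt (g11 * g22 - g12\<^sup>2))"
  proof -
    have "sqrt g11 * sqrt k = sqrt (g11 * g22 - g12\<^sup>2)"
      using g by (simp add: k_def real_sqrt_mult[symmetric])
    moreover have "2 / sqrt g11 * (pi / (s * sqrt k)) = 2 * pi / (s * (sqrt g11 * sqrt k))" by simp
    ultimately show ?thesis by (simp only:)
  qed
  finally show ?thesis .
qed

lemma norm_real2: "(norm (v :: real ^ 2))\<^sup>2 = (v $ 1)\<^sup>2 + (v $ 2)\<^sup>2"
  unfolding power2_norm_eq_inner by (simp add: inner_vec_def sum_2 power2_eq_square)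

lemma nn_integral_norm_kernel:
  assumes "s > 0"
  shows "(\<integral>\<^sup>+v. ennreal (1 / sqrt (s\<^sup>2 + (norm v)\<^sup>2) ^ 3) \<partial>(lborel :: (real ^ 2) measure)) = ennreal (2 * pi / s)"
  using nn_integral_quadratic_kernel[OF assms, of 1 1 0] by (simp add: norm_real2)

text \<open>Integrating out the free coordinate first leaves at most 2, whatever \<open>s\<close>
  is, so the strip of width \<open>2 * R\<close> contributes at most \<open>4 * R\<close>. The
  strips take the place of polar coordinates in the estimate of 1 / r.\<close>

lemma nn_integral_weighted_kernel:
  fixes R s :: real
  assumes "s > 0" "R \<ge> 0"
  shows "(\<integral>\<^sup>+v. ennreal ((v $ 1)\<^sup>2 / sqrt (s\<^sup>2 + (norm v)\<^sup>2) ^ 3) * indicator {-R..R} (v $ 1) \<partial>(lborel :: (real ^ 2) measure))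
      \<le> ennreal (4 * R)" (is "?A \<le> _")
    and "(\<integral>\<^sup>+v. ennreal ((v $ 2)\<^sup>2 / sqrt (s\<^sup>2 + (norm v)\<^sup>2) ^ 3) * indicator {-R..R} (v $ 2) \<partial>(lborel :: (real ^ 2) measure))
      \<le> ennreal (4 * R)" (is "?B \<le> _")
proof -
  have pos: "s\<^sup>2 + y\<^sup>2 > 0" for y :: real using assms by (intro add_pos_nonneg) auto
  have inner: "(\<integral>\<^sup>+x. ennreal (y\<^sup>2 / sqrt (s\<^sup>2 + (y\<^sup>2 + x\<^sup>2)) ^ 3) * indicator {-R..R} y \<partial>lborel) \<le> 2 * indicator {-R..R} y"
    for y :: real
  proof -
    have "(\<integral>\<^sup>+x. ennreal (y\<^sup>2 / sqrt (s\<^sup>2 + (y\<^sup>2 + x\<^sup>2)) ^ 3) * indicator {-R..R} y \<partial>lborel) =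
       (\<integral>\<^sup>+x. ennreal (y\<^sup>2) * indicator {-R..R} y * ennreal (1 / sqrt ((s\<^sup>2 + y\<^sup>2) + 1 * (x + 0)\<^sup>2) ^ 3) \<partial>lborel)"
      by (intro nn_integral_cong) (auto simp: ennreal_mult[symmetric] indicator_def add.assoc)
    also have "\<dots> = ennreal (y\<^sup>2) * indicator {-R..R} y * ennreal (2 / (s\<^sup>2 + y\<^sup>2))"
      by (subst nn_integral_cmult) (simp, subst nn_integral_inverse_sqrt_cubed[OF pos], simp_all)
    also have "\<dots> = ennreal (y\<^sup>2 * (2 / (s\<^sup>2 + y\<^sup>2))) * indicator {-R..R} y"
      using pos[of y] by (subst ennreal_mult) (auto simp: mult_ac less_imp_le)
    also have "\<dots> \<le> ennreal 2 * indicator {-R..R} y"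
      using pos[of y] assms by (intro mult_right_mono ennreal_leI) (auto simp: field_simps)
    finally show ?thesis by simp
  qed
  have outer: "(\<integral>\<^sup>+y. 2 * indicator {-R..R} y \<partial>lborel) \<le> ennreal (4 * R)"
  proof -
    have "(\<integral>\<^sup>+y. 2 * indicator {-R..R} y \<partial>lborel) = 2 * ennreal (2 * R)"
      using assms by (subst nn_integral_cmult_indicator) auto
    also have "\<dots> = ennreal (4 * R)"
      using assms by (metis ennreal_mult ennreal_numeral mult.assoc mult_2 numeral_Bit0 order.refl zero_le_numeral mult_nonneg_nonneg numeral_plus_numeral semiring_norm(2) distrib_right)
    finally show ?thesis by simp
  qed
  have meas: "(\<lambda>v :: real ^ 2. ennreal ((v $ i)\<^sup>2 / sqrt (s\<^sup>2 + (norm v)\<^sup>2) ^ 3) * indicator {-R..R} (v $ i))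
      \<in> borel_measurable borel" for i
    by measurable
  have "?A = (\<integral>\<^sup>+x. (\<integral>\<^sup>+y. ennreal (x\<^sup>2 / sqrt (s\<^sup>2 + (x\<^sup>2 + y\<^sup>2)) ^ 3) * indicator {-R..R} x \<partial>lborel) \<partial>lborel)"
    by (subst nn_integral_real2(2)[OF meas]) (simp add: norm_real2)
  also have "\<dots> \<le> (\<integral>\<^sup>+x. 2 * indicator {-R..R} x \<partial>lborel)" by (intro nn_integral_mono inner)
  finally show "?A \<le> ennreal (4 * R)" using outer by (rule order_trans)
  have "?B = (\<integral>\<^sup>+y. (\<integral>\<^sup>+x. ennreal (y\<^sup>2 / sqrt (s\<^sup>2 + (y\<^sup>2 + x\<^sup>2)) ^ 3) * indicator {-R..R} y \<partial>lborel) \<partial>lborel)"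
    by (subst nn_integral_real2(1)[OF meas]) (simp add: norm_real2 add.commute)
  also have "\<dots> \<le> (\<integral>\<^sup>+x. 2 * indicator {-R..R} x \<partial>lborel)" by (intro nn_integral_mono inner)
  finally show "?B \<le> ennreal (4 * R)" using outer by (rule order_trans)
qed

lemma nn_integral_translate:
  fixes f :: "'a::euclidean_space \<Rightarrow> ennreal"
  assumes [measurable]: "f \<in> borel_measurable borel"
  shows "(\<integral>\<^sup>+v. f (v - c) \<partial>lborel) = (\<integral>\<^sup>+v. f v \<partial>lborel)"
proof -
  have "(\<integral>\<^sup>+v. f v \<partial>lborel) = (\<integral>\<^sup>+v. f v \<partial>(distr lborel borel ((+) (- c))))"
    by (simp add: lborel_distr_plus)
  then show ?thesis by (subst (asm) nn_integral_distr) auto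
qed

text \<open>With r the square root, 1 / r is r^2 / r^3, and r^2 is the sum of
  \<open>s\<^sup>2\<close> and the two squared coordinates. The coordinates give two strip integrals
  of at most \<open>4 * R\<close> each. The rest is a multiple of the plane integral
  \<open>2 * pi / \<bar>s\<bar>\<close>: the factor \<open>s\<^sup>2\<close> yields at most
  \<open>2 * pi * s0\<close>, the factor \<open>\<bar>s\<bar>\<close> yields
  \<open>2 * pi\<close>.\<close>

lemma kernel_integral_bound:
  fixes p q c :: "real ^ 2"
  assumes s: "0 < \<bar>s\<bar>" "\<bar>s\<bar> \<le> s0" and c: "c \<in> cbox p q"
  shows "integral (cbox p q) (\<lambda>v. 1 / sqrt (s\<^sup>2 + (norm (v - c))\<^sup>2) + \<bar>s\<bar> / sqrt (s\<^sup>2 + (norm (v - c))\<^sup>2) ^ 3)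
    \<le> (2 * pi * s0 + 8 * norm (q - p)) + 2 * pi" (is "integral _ ?k \<le> ?C")
proof -
  \<comment> \<open>As \<open>c\<close> lies in the box, \<open>R\<close> bounds each coordinate of
    \<open>v - c\<close>, so the strip indicators are 1 there.\<close>
  define R where "R = norm (q - p)"
  have R: "R \<ge> 0" by (simp add: R_def)
  let ?r = "\<lambda>v :: real ^ 2. sqrt (s\<^sup>2 + (norm v)\<^sup>2)"
  have rpos: "?r v > 0" for v using s by (auto intro!: add_pos_nonneg)
  let ?f1 = "\<lambda>v :: real ^ 2. ennreal ((v $ 1)\<^sup>2 / ?r v ^ 3) * indicator {-R..R} (v $ 1)"
  let ?f2 = "\<lambda>v :: real ^ 2. ennreal ((v $ 2)\<^sup>2 / ?r v ^ 3) * indicator {-R..R} (v $ 2)"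
  let ?f3 = "\<lambda>v :: real ^ 2. ennreal (s\<^sup>2 + \<bar>s\<bar>) * ennreal (1 / ?r v ^ 3)"
  have kpos: "?k v \<ge> 0" for v using rpos[of "v - c"] by (auto intro!: add_nonneg_nonneg divide_nonneg_pos)
  have cont: "continuous_on (cbox p q) ?k"
    using s by (intro continuous_intros) auto
  have "ennreal (integral (cbox p q) ?k) = (\<integral>\<^sup>+v. indicator (cbox p q) v * ennreal (?k v) \<partial>lborel)"
    using nn_integral_has_integral_lebesgue[OF kpos integrable_integral[OF integrable_continuous[OF cont]]]
    by (subst (asm) nn_integral_cong[where v = "\<lambda>v. indicator (cbox p q) v * ennreal (?k v)"])
      (auto simp: indicator_def)
  also have "\<dots> \<le> (\<integral>\<^sup>+v. ?f1 (v - c) + ?f2 (v - c) + ?f3 (v - c) \<partial>lborel)"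
  proof (intro nn_integral_mono)
    fix v :: "real ^ 2"
    show "indicator (cbox p q) v * ennreal (?k v) \<le> ?f1 (v - c) + ?f2 (v - c) + ?f3 (v - c)"
    proof (cases "v \<in> cbox p q")
      case True
      have "\<bar>(v - c) $ i\<bar> \<le> R" for i
      proof -
        have "\<bar>(v - c) $ i\<bar> \<le> \<bar>(q - p) $ i\<bar>"
          using True c by (auto simp: mem_box_cart abs_le_iff) (smt (verit))+
        also have "\<dots> \<le> R" unfolding R_def by (rule component_le_norm_cart)
        finally show ?thesis .
      qed
      then have i: "indicator {-R..R} ((v - c) $ i) = (1 :: ennreal)" for i
        by (auto simp: indicator_def abs_le_iff) (smt (verit))+
      let ?w = "v - c"
      have "1 / ?r ?w = ?r ?w ^ 2 / ?r ?w ^ 3" using rpos[of ?w] by (simp add: power2_eq_square power3_eq_cube)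
      also have "?r ?w ^ 2 = s\<^sup>2 + ((?w $ 1)\<^sup>2 + (?w $ 2)\<^sup>2)" by (simp add: norm_real2 del: vector_minus_component)
      finally have "?k v = (?w $ 1)\<^sup>2 / ?r ?w ^ 3 + (?w $ 2)\<^sup>2 / ?r ?w ^ 3 + (s\<^sup>2 + \<bar>s\<bar>) * (1 / ?r ?w ^ 3)"
        by (simp add: add_divide_distrib del: vector_minus_component)
      then have "ennreal (?k v) = ennreal ((?w $ 1)\<^sup>2 / ?r ?w ^ 3) + ennreal ((?w $ 2)\<^sup>2 / ?r ?w ^ 3) +
          ennreal (s\<^sup>2 + \<bar>s\<bar>) * ennreal (1 / ?r ?w ^ 3)"
        using rpos[of ?w] by (simp add: ennreal_plus[symmetric] ennreal_mult[symmetric] del: ennreal_plus vector_minus_component)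
      then show ?thesis using True by (simp add: i del: vector_minus_component)
    qed simp
  qed
  also have "\<dots> = (\<integral>\<^sup>+v. ?f1 v + ?f2 v + ?f3 v \<partial>lborel)"
    by (rule nn_integral_translate[of "\<lambda>v. ?f1 v + ?f2 v + ?f3 v"]) measurable
  also have "\<dots> = (\<integral>\<^sup>+v. ?f1 v \<partial>lborel) + (\<integral>\<^sup>+v. ?f2 v \<partial>lborel) + ennreal (s\<^sup>2 + \<bar>s\<bar>) * (\<integral>\<^sup>+v. ennreal (1 / ?r v ^ 3) \<partial>lborel)"
    by (simp add: nn_integral_add nn_integral_cmult)
  also have "\<dots> \<le> ennreal (4 * R) + ennreal (4 * R) + ennreal (s\<^sup>2 + \<bar>s\<bar>) * ennreal (2 * pi / \<bar>s\<bar>)"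
    using nn_integral_weighted_kernel[OF s(1) R] nn_integral_norm_kernel[OF s(1)] by (intro add_mono) auto
  also have "\<dots> = ennreal (8 * R + (s\<^sup>2 + \<bar>s\<bar>) * (2 * pi / \<bar>s\<bar>))"
    using R s by (simp add: ennreal_plus[symmetric] ennreal_mult[symmetric] del: ennreal_plus)
  also have "(s\<^sup>2 + \<bar>s\<bar>) * (2 * pi / \<bar>s\<bar>) = 2 * pi * \<bar>s\<bar> + 2 * pi"
    using s by (simp add: field_simps power2_eq_square abs_mult_self_eq)
  finally have "integral (cbox p q) ?k \<le> 8 * R + (2 * pi * \<bar>s\<bar> + 2 * pi)"
    using R s by (subst (asm) ennreal_le_iff) auto
  moreover have "2 * pi * \<bar>s\<bar> \<le> 2 * pi * s0" using s by (intro mult_left_mono) auto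
  ultimately show ?thesis unfolding R_def by linarith
qed

subsection \<open>Layer potentials\<close>

text \<open>Cramer's rule: up to the determinant, the three cross products are the basis dual to
  \<open>a\<close>, \<open>b\<close>, \<open>c\<close>.\<close>

lemma cross3_expansion:
  fixes a b c w :: "real ^ 3"
  shows "(cross3 a b \<bullet> c) *\<^sub>R w =
    (w \<bullet> cross3 b c) *\<^sub>R a + (w \<bullet> cross3 c a) *\<^sub>R b + (w \<bullet> cross3 a b) *\<^sub>R c"
  by (simp add: vec_eq_iff forall_3 cross_components inner_vec_def sum_3 algebra_simps)

text \<open>For the traceless symmetric map \<open>M u = s u - t (y \<bullet> u) y\<close> this is
  \<open>(M a \<times> b) \<bullet> c + (a \<times> M b) \<bullet> c + (a \<times> b) \<bullet> M c = (tr M) ((a \<times> b) \<bullet> c) = 0\<close>.\<close>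

lemma traceless_cross3:
  fixes a b c y :: "real ^ 3"
  assumes "t * (y \<bullet> y) = 3 * s"
  defines "M \<equiv> \<lambda>u. s *\<^sub>R u - (t * (y \<bullet> u)) *\<^sub>R y"
  shows "cross3 a b \<bullet> M c = cross3 c b \<bullet> M a + cross3 a c \<bullet> M b"
proof -
  define d where "d = cross3 a b \<bullet> c"
  have d: "cross3 b c \<bullet> a = d" "cross3 c a \<bullet> b = d"
    unfolding d_def by (metis cross_triple)+
  have neg: "cross3 c b = - cross3 b c" "cross3 a c = - cross3 c a"
    by (rule cross_skew)+
  \<comment> \<open>Pairing Cramer's expansion of \<open>y\<close> with \<open>y\<close> itself
    gives the contribution of the rank-one part of \<open>M\<close> to the trace; the hypothesis
    makes it cancel the multiple of the identity.\<close>
  have "d * (y \<bullet> y) = (y \<bullet> cross3 b c) * (y \<bullet> a) + (y \<bullet> cross3 c a) * (y \<bullet> b) + (y \<bullet> cross3 a b) * (y \<bullet> c)"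
    using arg_cong[OF cross3_expansion[of a b c y], of "\<lambda>u. y \<bullet> u"]
    unfolding d_def by (simp only: inner_add_right inner_scaleR_right)
  then have "t * ((y \<bullet> cross3 b c) * (y \<bullet> a) + (y \<bullet> cross3 c a) * (y \<bullet> b) + (y \<bullet> cross3 a b) * (y \<bullet> c)) = 3 * s * d"
    using assms(1) by (metis mult.assoc mult.commute)
  then show ?thesis
    unfolding M_def neg
    by (simp add: inner_diff_right d d_def[symmetric] inner_commute[of _ y] algebra_simps)
qed

text \<open>The negative gradient of \<open>1 / |y|\<close>.\<close>

definition newton :: "real ^ 3 \<Rightarrow> real ^ 3" where
  "newton y = (1 / norm y ^ 3) *\<^sub>R y"

lemma Ck_newton:
  assumes "open S" "Ck k S f" "\<And>x. x \<in> S \<Longrightarrow> f x \<noteq> 0"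
  shows "Ck k S (\<lambda>x. newton (f x))"
  unfolding newton_def using assms by (intro Ck_scaleR Ck_divide Ck_power Ck_norm Ck_const) auto

lemma has_derivative_inverse_norm:
  fixes y :: "'a::real_inner"
  assumes "y \<noteq> 0"
  shows "((\<lambda>y. 1 / norm y) has_derivative (\<lambda>h. - (y \<bullet> h) / norm y ^ 3)) (at y)"
proof -
  have "(norm has_derivative (\<lambda>h. h \<bullet> sgn y)) (at y)"
    using GDERIV_norm[OF assms] by (simp add: gderiv_def)
  then have "((\<lambda>y. inverse (norm y)) has_derivative (\<lambda>h. - (inverse (norm y) * (h \<bullet> sgn y) * inverse (norm y)))) (at y)"
    by (rule has_derivative_compose[OF _ has_derivative_inverse']) (use assms in simp)
  moreover have "- (inverse (norm y) * (h \<bullet> sgn y) * inverse (norm y)) = - (y \<bullet> h) / norm y ^ 3" for h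
    by (simp add: sgn_div_norm inner_commute power3_eq_cube field_simps)
  ultimately show ?thesis by (simp add: inverse_eq_divide)
qed

lemma has_derivative_newton:
  assumes "y \<noteq> 0"
  shows "(newton has_derivative (\<lambda>h. (1 / norm y ^ 3) *\<^sub>R h - (3 / norm y ^ 5 * (y \<bullet> h)) *\<^sub>R y)) (at y)"
proof -
  have "((\<lambda>y. ((1 / norm y) ^ 3) *\<^sub>R y) has_derivative
      (\<lambda>h. ((1 / norm y) ^ 3) *\<^sub>R h + (3 * (- (y \<bullet> h) / norm y ^ 3) * (1 / norm y) ^ 2) *\<^sub>R y)) (at y)"
    using has_derivative_scaleR[OF has_derivative_power[OF has_derivative_inverse_norm[OF assms], of 3] has_derivative_ident]
    by (simp add: numeral_2_eq_2 numeral_3_eq_3 mult_ac)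
  moreover have "3 * (- (y \<bullet> h) / norm y ^ 3) * (1 / norm y) ^ 2 = - (3 / norm y ^ 5 * (y \<bullet> h))" for h
    using assms by (simp add: field_simps power_add[symmetric])
  ultimately show ?thesis
    by (simp add: newton_def[abs_def] power_one_over algebra_simps)
qed

lemma dir_deriv_slice: "dir_deriv (0, e) f (y, v) = dir_deriv e (\<lambda>v. f (y, v)) v"
  by (simp add: dir_deriv_def)

lemma dir_deriv_slice_fst: "dir_deriv (h, 0) f (y, v) = dir_deriv h (\<lambda>y. f (y, v)) y"
  by (simp add: dir_deriv_def)

lemma Ck_slice:
  assumes "open Q" "Ck k Q f"
  shows "Ck k {v. (y, v) \<in> Q} (\<lambda>v. f (y, v))"
proof -
  have "open ((\<lambda>v. (y, v)) -` Q)" by (intro open_vimage assms continuous_intros)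
  then have "open {v. (y, v) \<in> Q}" by (simp add: vimage_def)
  then show ?thesis
    by (intro Ck_compose[OF _ assms] Ck_Pair Ck_const Ck_ident) auto
qed

lemma dir_deriv_inner:
  assumes "f differentiable (at z)" "g differentiable (at z)"
  shows "dir_deriv e (\<lambda>z. f z \<bullet> g z) z = dir_deriv e f z \<bullet> g z + f z \<bullet> dir_deriv e g z"
  using dir_deriv_eq[OF has_derivative_inner[OF assms[THEN has_derivative_dir_deriv]]]
  by (simp add: add.commute)

lemma dir_deriv_newton:
  assumes "D differentiable (at z)" "D z \<noteq> 0"
  shows "dir_deriv e (\<lambda>z. newton (D z)) z =
    (1 / norm (D z) ^ 3) *\<^sub>R dir_deriv e D z - (3 / norm (D z) ^ 5 * (D z \<bullet> dir_deriv e D z)) *\<^sub>R D z"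
  using dir_deriv_eq[OF has_derivative_compose[OF has_derivative_dir_deriv[OF assms(1)] has_derivative_newton[OF assms(2)]]]
  by simp

lemma dir_deriv_sum_Basis:
  assumes "f differentiable (at (y, v))"
  shows "dir_deriv (h, 0) f (y, v) = (\<Sum>b\<in>Basis. (h \<bullet> b) *\<^sub>R dir_deriv (b, 0) f (y, v))"
proof -
  interpret bounded_linear "\<lambda>u. dir_deriv u f (y, v)"
    using has_derivative_dir_deriv[OF assms] by (rule has_derivative_bounded_linear)
  have *: "(h, 0) = (\<Sum>b\<in>Basis. (h \<bullet> b) *\<^sub>R (b, 0))"
    by (simp add: prod_eq_iff fst_sum snd_sum euclidean_representation)
  have "dir_deriv (h, 0) f (y, v) = dir_deriv (\<Sum>b\<in>Basis. (h \<bullet> b) *\<^sub>R (b, 0)) f (y, v)"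
    by (rule arg_cong[where f = "\<lambda>u. dir_deriv u f (y, v)", OF *])
  then show ?thesis by (simp only: sum scaleR)
qed

text \<open>\<open>Y\<close> holds the parameters, \<open>D\<close> maps the patch \<open>B\<close>
  into space, and \<open>C\<close> is to contain the supports of the densities. The three
  derivatives of \<open>D\<close> are spent on the frame \<open>ta\<close>, \<open>tb\<close>, on
  the divergence in \<open>deriv_density\<close> and on the divergence in
  \<open>smooth_part\<close>. \<open>indep\<close> says that the patch is immersed.\<close>

locale layer_potential =
  fixes Y :: "'p::euclidean_space set" and B C :: "(real ^ 2) set" and p q :: "real ^ 2"
    and D :: "'p \<times> (real ^ 2) \<Rightarrow> real ^ 3"
  assumes openY: "open Y" and openB: "open B" and closedC: "closed C"
    and CB: "C \<subseteq> B" and Cbox: "C \<subseteq> cbox p q"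
    and D: "Ck (Suc (Suc (Suc 0))) (Y \<times> B) D"
    and indep: "\<And>z. z \<in> Y \<times> B \<Longrightarrow>
      cross3 (dir_deriv (0, axis 1 1) D z) (dir_deriv (0, axis 2 1) D z) \<noteq> 0"
begin

abbreviation e1 :: "'p \<times> (real ^ 2)" where "e1 \<equiv> (0, axis 1 1)"
abbreviation e2 :: "'p \<times> (real ^ 2)" where "e2 \<equiv> (0, axis 2 1)"

definition ta where "ta = dir_deriv e1 D"
definition tb where "tb = dir_deriv e2 D"
definition no where "no z = cross3 (ta z) (tb z)"
text \<open>Coordinates of \<open>w\<close> in the frame \<open>ta\<close>, \<open>tb\<close>,
  \<open>no\<close> by Cramer's rule, whose determinant is here
  \<open>no z \<bullet> no z\<close>.\<close>

definition al where "al w z = (w z \<bullet> cross3 (tb z) (no z)) / (no z \<bullet> no z)"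
definition be where "be w z = (w z \<bullet> cross3 (no z) (ta z)) / (no z \<bullet> no z)"
definition ga where "ga w z = (w z \<bullet> no z) / (no z \<bullet> no z)"

text \<open>The divergence, in the surface coordinates, of the tangential part of \<open>w\<close>;
  it becomes the weight of \<open>1 / norm (D z)\<close> after integration by parts.\<close>

definition smooth_part where "smooth_part w z = dir_deriv e1 (al w) z + dir_deriv e2 (be w) z"

text \<open>Chosen so that, for the Jacobian \<open>M\<close> of \<open>newton\<close> at
  \<open>D z\<close> and \<open>c = dir_deriv (h, 0) D z\<close>, one has \<open>w z \<bullet> M c =
  zeta1 h w z \<bullet> M (ta z) + zeta2 h w z \<bullet> M (tb z)\<close>. The tangential
  coefficients come from the symmetry of \<open>M\<close>, the normal one from its zero
  trace.\<close>

definition zeta1 where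
  "zeta1 h w z = al w z *\<^sub>R dir_deriv (h, 0) D z + ga w z *\<^sub>R cross3 (dir_deriv (h, 0) D z) (tb z)"
definition zeta2 where
  "zeta2 h w z = be w z *\<^sub>R dir_deriv (h, 0) D z + ga w z *\<^sub>R cross3 (ta z) (dir_deriv (h, 0) D z)"
text \<open>The density whose potential is the derivative along \<open>h\<close> of the potential of
  \<open>w\<close>: the two subtracted terms are what integration by parts leaves of the
  Jacobian.\<close>

definition deriv_density where
  "deriv_density h w z = dir_deriv (h, 0) w z - dir_deriv e1 (zeta1 h w) z - dir_deriv e2 (zeta2 h w) z"

definition off_C where "off_C f \<longleftrightarrow> (\<forall>y\<in>Y. \<forall>v. v \<notin> C \<longrightarrow> f (y, v) = 0)"

definition regular where "regular = {z \<in> Y \<times> B. D z \<noteq> 0}"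
text \<open>Parameters for which the layer over \<open>C\<close> avoids the origin, so that the
  integrand of a potential is continuous.\<close>

definition good where "good y \<longleftrightarrow> y \<in> Y \<and> (\<forall>v\<in>C. D (y, v) \<noteq> 0)"

definition potential where
  "potential w y = integral (cbox p q) (\<lambda>v. w (y, v) \<bullet> newton (D (y, v)))"

section \<open>Regularity and support of the frame, the densities and the fields\<close>

lemma openYB: "open (Y \<times> B)" by (intro open_Times openY openB)

lemma openYC: "open (Y \<times> - C)" using closedC openY by (intro open_Times) auto

lemma D_continuous: "continuous_on (Y \<times> B) D" using D by (rule Ck_continuous_on)

lemma open_regular: "open regular"
proof -
  have "open ((Y \<times> B) \<inter> D -` (- {0}))"
    by (rule continuous_open_preimage[OF D_continuous openYB]) auto
  moreover have "regular = (Y \<times> B) \<inter> D -` (- {0})" by (auto simp: regular_def)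
  ultimately show ?thesis by simp
qed

lemma regular_sub: "regular \<subseteq> Y \<times> B" by (auto simp: regular_def)

lemma no_nonzero: "z \<in> Y \<times> B \<Longrightarrow> no z \<noteq> 0" "z \<in> Y \<times> B \<Longrightarrow> no z \<bullet> no z \<noteq> 0"
  using indep by (auto simp: no_def ta_def tb_def)

lemma Ck_D: "k \<le> 3 \<Longrightarrow> Ck k (Y \<times> B) D"
  by (rule Ck_le[OF _ D]) (simp add: eval_nat_numeral)

lemma Ck_frame:
  assumes "k \<le> 2"
  shows "Ck k (Y \<times> B) ta" "Ck k (Y \<times> B) tb" "Ck k (Y \<times> B) no" "Ck k (Y \<times> B) (dir_deriv (h, 0) D)"
proof -
  have D': "Ck k (Y \<times> B) (dir_deriv e D)" for e
    by (rule Ck_le[OF _ Ck_dir_deriv[OF D]]) (use assms in simp)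
  show 1: "Ck k (Y \<times> B) ta" "Ck k (Y \<times> B) tb" "Ck k (Y \<times> B) (dir_deriv (h, 0) D)"
    by (simp_all add: ta_def tb_def D')
  show "Ck k (Y \<times> B) no" unfolding no_def[abs_def] by (intro Ck_cross3 openYB 1)
qed

lemma Ck_coeff:
  assumes "k \<le> 2" "Ck k (Y \<times> B) w"
  shows "Ck k (Y \<times> B) (al w)" "Ck k (Y \<times> B) (be w)" "Ck k (Y \<times> B) (ga w)"
  unfolding al_def[abs_def] be_def[abs_def] ga_def[abs_def]
  by (intro Ck_divide Ck_inner Ck_cross3 openYB Ck_frame assms no_nonzero(2); assumption)+

lemma Ck_zeta:
  assumes "k \<le> 2" "Ck k (Y \<times> B) w"
  shows "Ck k (Y \<times> B) (zeta1 h w)" "Ck k (Y \<times> B) (zeta2 h w)"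
  unfolding zeta1_def[abs_def] zeta2_def[abs_def]
  by (intro Ck_add Ck_scaleR Ck_cross3 openYB Ck_frame Ck_coeff assms)+

lemma Ck_deriv_density:
  assumes "Ck (Suc (Suc 0)) (Y \<times> B) w"
  shows "Ck (Suc 0) (Y \<times> B) (deriv_density h w)"
  unfolding deriv_density_def[abs_def]
  by (intro Ck_diff openYB Ck_dir_deriv Ck_zeta assms) simp_all

lemma decomposition:
  assumes "z \<in> Y \<times> B"
  shows "w z = al w z *\<^sub>R ta z + be w z *\<^sub>R tb z + ga w z *\<^sub>R no z"
proof -
  let ?n = "no z \<bullet> no z"
  have "?n *\<^sub>R w z = (w z \<bullet> cross3 (tb z) (no z)) *\<^sub>R ta z + (w z \<bullet> cross3 (no z) (ta z)) *\<^sub>R tb z + (w z \<bullet> no z) *\<^sub>R no z"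
    using cross3_expansion[of "ta z" "tb z" "no z" "w z"] by (simp add: no_def)
  then have "(1 / ?n) *\<^sub>R (?n *\<^sub>R w z) = (1 / ?n) *\<^sub>R ((w z \<bullet> cross3 (tb z) (no z)) *\<^sub>R ta z +
      (w z \<bullet> cross3 (no z) (ta z)) *\<^sub>R tb z + (w z \<bullet> no z) *\<^sub>R no z)"
    by simp
  then show ?thesis
    using no_nonzero(2)[OF assms] by (simp add: al_def be_def ga_def scaleR_add_right)
qed

lemma off_C_dir_deriv:
  assumes "off_C f"
  shows "off_C (dir_deriv e f)"
  unfolding off_C_def
proof (intro ballI allI impI)
  fix y v assume yv: "y \<in> Y" "v \<notin> C"
  have "dir_deriv e f (y, v) = dir_deriv e (\<lambda>_. 0) (y, v)"
    by (rule dir_deriv_cong_open[OF openYC]) (use yv assms in \<open>auto simp: off_C_def\<close>)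
  then show "dir_deriv e f (y, v) = 0" by (simp add: dir_deriv_def)
qed

lemma off_C_coeff:
  assumes "off_C w"
  shows "off_C (al w)" "off_C (be w)" "off_C (ga w)" "off_C (zeta1 h w)" "off_C (zeta2 h w)"
  using assms by (auto simp: off_C_def al_def be_def ga_def zeta1_def zeta2_def)

lemma off_C_deriv_density: "off_C w \<Longrightarrow> off_C (deriv_density h w)"
  using off_C_dir_deriv[of w "(h, 0)"] off_C_dir_deriv[OF off_C_coeff(4)[of w h], of e1]
    off_C_dir_deriv[OF off_C_coeff(5)[of w h], of e2]
  by (auto simp: off_C_def deriv_density_def)

lemma off_C_smooth_part: "off_C w \<Longrightarrow> off_C (smooth_part w)"
  using off_C_dir_deriv[OF off_C_coeff(1)[of w], of e1] off_C_dir_deriv[OF off_C_coeff(2)[of w], of e2]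
  by (auto simp: off_C_def smooth_part_def)

text \<open>Outside \<open>C\<close> the function is identically zero, so neither a zero of
  \<open>D\<close> there nor the edge of \<open>B\<close> does harm. For a \<open>good\<close>
  parameter the two open pieces cover the whole slice.\<close>

lemma Ck_extend:
  assumes "Ck k regular f" "off_C f"
  shows "Ck k (regular \<union> Y \<times> - C) f"
proof (rule Ck_Un[OF open_regular openYC assms(1)])
  show "Ck k (Y \<times> - C) f"
    by (rule Ck_cong[OF openYC _ Ck_const[OF openYC, of k 0]]) (use assms(2) in \<open>auto simp: off_C_def\<close>)
qed

lemma good_slice: "good y \<Longrightarrow> (y, v) \<in> regular \<union> Y \<times> - C"
  using CB by (auto simp: good_def regular_def)

lemma Ck_extend_slice:
  assumes "Ck k regular f" "off_C f" "good y"
  shows "Ck k UNIV (\<lambda>v. f (y, v))"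
proof -
  have "Ck k {v. (y, v) \<in> regular \<union> Y \<times> - C} (\<lambda>v. f (y, v))"
    by (intro Ck_slice Ck_extend assms open_Un open_regular openYC)
  then show ?thesis using good_slice[OF assms(3)] by simp
qed

lemma integral_e_eq_0:
  fixes f :: "'p \<times> (real ^ 2) \<Rightarrow> real"
  assumes "Ck (Suc 0) regular f" "off_C f" "good y"
  shows "integral (cbox p q) (\<lambda>v. dir_deriv (0, e) f (y, v)) = 0"
  unfolding dir_deriv_slice
proof (rule integral_dir_deriv_eq_0[OF Ck_extend_slice[OF assms]])
  show "f (y, v) = 0" if "v \<notin> cbox p q" for v
    using that assms Cbox by (auto simp: off_C_def good_def)
qed

lemma continuous_slice:
  assumes "Ck 0 regular f" "off_C f" "good y"
  shows "continuous_on (cbox p q) (\<lambda>v. f (y, v))"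
  using Ck_extend_slice[OF assms] by (auto intro: continuous_on_subset)

lemma Ck_newton_D: "k \<le> 3 \<Longrightarrow> Ck k regular (\<lambda>z. newton (D z))"
  by (intro Ck_newton open_regular Ck_subset[OF Ck_D regular_sub]) (auto simp: regular_def)

lemma Ck_norm_D: "k \<le> 3 \<Longrightarrow> Ck k regular (\<lambda>z. 1 / norm (D z))"
  by (intro Ck_divide Ck_const Ck_norm open_regular Ck_subset[OF Ck_D regular_sub]) (auto simp: regular_def)

lemma Ck_field:
  assumes "k \<le> 3" "Ck k (Y \<times> B) w"
  shows "Ck k regular (\<lambda>z. w z \<bullet> newton (D z))"
  by (intro Ck_inner open_regular Ck_newton_D assms(1) Ck_subset[OF assms(2) regular_sub])

lemma off_C_field: "off_C w \<Longrightarrow> off_C (\<lambda>z. w z \<bullet> newton (D z))"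
  by (auto simp: off_C_def)

lemma D_differentiable: "z \<in> Y \<times> B \<Longrightarrow> D differentiable (at z)"
  by (rule Ck_imp_differentiable[OF D])

lemma dir_deriv_field:
  assumes "z \<in> regular" "Ck (Suc 0) (Y \<times> B) w"
  shows "dir_deriv e (\<lambda>z. w z \<bullet> newton (D z)) z = dir_deriv e w z \<bullet> newton (D z) +
    w z \<bullet> ((1 / norm (D z) ^ 3) *\<^sub>R dir_deriv e D z - (3 / norm (D z) ^ 5 * (D z \<bullet> dir_deriv e D z)) *\<^sub>R D z)"
proof -
  have z: "z \<in> Y \<times> B" "D z \<noteq> 0" using assms(1) by (auto simp: regular_def)
  have "(\<lambda>z. newton (D z)) differentiable (at z)"
    using Ck_imp_differentiable[OF Ck_newton_D[of "Suc 0"] assms(1)] by simp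
  then show ?thesis
    using dir_deriv_inner[OF Ck_imp_differentiable[OF assms(2) z(1)]] dir_deriv_newton[OF D_differentiable[OF z(1)] z(2)]
    by simp
qed

text \<open>Each surface derivative on the right splits into a derivative of \<open>zeta1\<close> or
  \<open>zeta2\<close> and a Jacobian term. The Jacobian terms match by the choice of these two
  fields; the others are collected in \<open>deriv_density\<close>.\<close>

lemma dir_deriv_field_param:
  assumes "z \<in> regular" "Ck (Suc (Suc 0)) (Y \<times> B) w"
  shows "dir_deriv (h, 0) (\<lambda>z. w z \<bullet> newton (D z)) z =
    deriv_density h w z \<bullet> newton (D z)
    + dir_deriv e1 (\<lambda>z. zeta1 h w z \<bullet> newton (D z)) z + dir_deriv e2 (\<lambda>z. zeta2 h w z \<bullet> newton (D z)) z"
proof -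
  have z: "z \<in> Y \<times> B" "D z \<noteq> 0" using assms(1) by (auto simp: regular_def)
  define s t where "s = 1 / norm (D z) ^ 3" and "t = 3 / norm (D z) ^ 5"
  define M where "M u = s *\<^sub>R u - (t * (D z \<bullet> u)) *\<^sub>R D z" for u
  \<comment> \<open>The trace of \<open>M\<close> is \<open>3 * s - t * (D z \<bullet> D z)\<close>,
    so this is the vanishing of the divergence of \<open>newton\<close>.\<close>
  have st: "t * (D z \<bullet> D z) = 3 * s"
    using z(2) by (simp add: s_def t_def power2_norm_eq_inner[symmetric] field_simps power_add[symmetric])
  have M_sym: "u \<bullet> M v = v \<bullet> M u" for u v
    by (simp add: M_def inner_diff_right inner_commute)
  let ?c = "dir_deriv (h, 0) D z"
  have "w z \<bullet> M ?c = al w z * (ta z \<bullet> M ?c) + be w z * (tb z \<bullet> M ?c) + ga w z * (no z \<bullet> M ?c)"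
    by (subst decomposition[OF z(1), of w]) (simp add: inner_add_left)
  also have "no z \<bullet> M ?c = cross3 ?c (tb z) \<bullet> M (ta z) + cross3 (ta z) ?c \<bullet> M (tb z)"
    using traceless_cross3[OF st] unfolding no_def M_def .
  also have "ta z \<bullet> M ?c = ?c \<bullet> M (ta z)" by (rule M_sym)
  also have "tb z \<bullet> M ?c = ?c \<bullet> M (tb z)" by (rule M_sym)
  finally have key: "w z \<bullet> M ?c = zeta1 h w z \<bullet> M (ta z) + zeta2 h w z \<bullet> M (tb z)"
    by (simp add: zeta1_def zeta2_def inner_add_left algebra_simps)
  have w1: "Ck (Suc 0) (Y \<times> B) w" using assms(2) by (rule Ck_SucD)
  have zeta: "Ck (Suc 0) (Y \<times> B) (zeta1 h w)" "Ck (Suc 0) (Y \<times> B) (zeta2 h w)"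
    by (intro Ck_zeta w1; simp)+
  show ?thesis
    unfolding dir_deriv_field[OF assms(1) w1] dir_deriv_field[OF assms(1) zeta(1)] dir_deriv_field[OF assms(1) zeta(2)]
    using key unfolding M_def s_def t_def ta_def tb_def deriv_density_def
    by (simp only: inner_diff_left)
qed

text \<open>As \<open>newton\<close> is the negative gradient of \<open>1 / norm\<close>, the
  product \<open>ta z \<bullet> newton (D z)\<close> is minus the derivative of
  \<open>1 / norm (D z)\<close> along \<open>e1\<close>, and likewise for \<open>tb\<close> and
  \<open>e2\<close>. The product rule moves these derivatives onto the coefficients.\<close>

lemma field_decomposition:
  assumes "z \<in> regular" "Ck (Suc 0) (Y \<times> B) w"
  shows "w z \<bullet> newton (D z) = smooth_part w z * (1 / norm (D z)) + ga w z * (no z \<bullet> newton (D z))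
    - dir_deriv e1 (\<lambda>z. al w z * (1 / norm (D z))) z - dir_deriv e2 (\<lambda>z. be w z * (1 / norm (D z))) z"
proof -
  have z: "z \<in> Y \<times> B" "D z \<noteq> 0" using assms(1) by (auto simp: regular_def)
  have deriv: "dir_deriv e (\<lambda>z. f z * (1 / norm (D z))) z =
      dir_deriv e f z * (1 / norm (D z)) - f z * (dir_deriv e D z \<bullet> newton (D z))"
    if f: "Ck (Suc 0) (Y \<times> B) f" for f e
  proof -
    have "((\<lambda>z. 1 / norm (D z)) has_derivative (\<lambda>h. - (D z \<bullet> dir_deriv h D z) / norm (D z) ^ 3)) (at z)"
      by (rule has_derivative_compose[OF has_derivative_dir_deriv[OF D_differentiable[OF z(1)]]
          has_derivative_inverse_norm[OF z(2)]])
    from has_derivative_mult[OF Ck_has_derivative[OF f z(1)] this]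
    show ?thesis by (subst dir_deriv_eq, assumption) (simp add: newton_def inner_commute)
  qed
  have "w z \<bullet> newton (D z) = al w z * (ta z \<bullet> newton (D z)) + be w z * (tb z \<bullet> newton (D z)) + ga w z * (no z \<bullet> newton (D z))"
    by (subst decomposition[OF z(1), of w]) (simp add: inner_add_left)
  moreover have coeff: "Ck (Suc 0) (Y \<times> B) (al w)" "Ck (Suc 0) (Y \<times> B) (be w)"
    by (intro Ck_coeff assms; simp)+
  ultimately show ?thesis
    unfolding deriv[OF coeff(1)] deriv[OF coeff(2)] smooth_part_def ta_def tb_def
    by (simp add: algebra_simps)
qed

text \<open>The two exact derivatives integrate to zero since \<open>al w\<close> and
  \<open>be w\<close> vanish off \<open>C\<close>. What is left is the pair of kernels that can be
  bounded uniformly.\<close>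

lemma potential_decomposition:
  assumes w: "Ck (Suc 0) (Y \<times> B) w" "off_C w" and y: "good y"
  shows "potential w y = integral (cbox p q)
    (\<lambda>v. smooth_part w (y, v) * (1 / norm (D (y, v))) + ga w (y, v) * (no (y, v) \<bullet> newton (D (y, v))))"
    and "continuous_on (cbox p q)
    (\<lambda>v. smooth_part w (y, v) * (1 / norm (D (y, v))) + ga w (y, v) * (no (y, v) \<bullet> newton (D (y, v))))"
proof -
  let ?m = "\<lambda>z. smooth_part w z * (1 / norm (D z)) + ga w z * (no z \<bullet> newton (D z))"
  let ?f1 = "\<lambda>z. al w z * (1 / norm (D z))" and ?f2 = "\<lambda>z. be w z * (1 / norm (D z))"
  have coeff: "Ck (Suc 0) (Y \<times> B) (al w)" "Ck (Suc 0) (Y \<times> B) (be w)" "Ck (Suc 0) (Y \<times> B) (ga w)"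
    by (intro Ck_coeff w; simp)+
  have f: "Ck (Suc 0) regular ?f1" "Ck (Suc 0) regular ?f2"
    by (intro Ck_mult open_regular Ck_norm_D Ck_subset[OF coeff(1) regular_sub] Ck_subset[OF coeff(2) regular_sub]; simp)+
  have foff: "off_C ?f1" "off_C ?f2" using off_C_coeff[OF w(2)] by (auto simp: off_C_def)
  have sm: "Ck 0 (Y \<times> B) (smooth_part w)"
    unfolding smooth_part_def[abs_def] by (intro Ck_add openYB Ck_dir_deriv coeff)
  have m: "Ck 0 regular ?m"
    by (intro Ck_add Ck_mult Ck_inner open_regular Ck_norm_D Ck_newton_D Ck_subset[OF sm regular_sub]
        Ck_subset[OF Ck_SucD[OF coeff(3)] regular_sub] Ck_subset[OF Ck_frame(3) regular_sub]) simp_all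
  have moff: "off_C ?m" using off_C_coeff(3)[OF w(2)] off_C_smooth_part[OF w(2)] by (auto simp: off_C_def)
  show cm: "continuous_on (cbox p q) (\<lambda>v. ?m (y, v))" by (rule continuous_slice[OF m moff y])
  have c1: "continuous_on (cbox p q) (\<lambda>v. dir_deriv e1 ?f1 (y, v))"
    by (rule continuous_slice[OF Ck_dir_deriv[OF f(1)] off_C_dir_deriv[OF foff(1)] y])
  have c2: "continuous_on (cbox p q) (\<lambda>v. dir_deriv e2 ?f2 (y, v))"
    by (rule continuous_slice[OF Ck_dir_deriv[OF f(2)] off_C_dir_deriv[OF foff(2)] y])
  have yY: "y \<in> Y" using y by (simp add: good_def)
  have "w (y, v) \<bullet> newton (D (y, v)) = ?m (y, v) - dir_deriv e1 ?f1 (y, v) - dir_deriv e2 ?f2 (y, v)" for v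
  proof (cases "v \<in> C")
    case True
    then have "(y, v) \<in> regular" using y CB by (auto simp: regular_def good_def)
    then show ?thesis using field_decomposition[OF _ w(1)] by simp
  next
    case False
    then show ?thesis
      using w(2) moff off_C_dir_deriv[OF foff(1), of e1] off_C_dir_deriv[OF foff(2), of e2] yY by (simp add: off_C_def)
  qed
  then have "potential w y = integral (cbox p q) (\<lambda>v. ?m (y, v) - dir_deriv e1 ?f1 (y, v) - dir_deriv e2 ?f2 (y, v))"
    by (simp add: potential_def)
  also have "\<dots> = integral (cbox p q) (\<lambda>v. ?m (y, v)) - integral (cbox p q) (\<lambda>v. dir_deriv e1 ?f1 (y, v))
      - integral (cbox p q) (\<lambda>v. dir_deriv e2 ?f2 (y, v))"
    by (intro integral_unique has_integral_diff integrable_integral integrable_continuous cm c1 c2)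
  finally show "potential w y = integral (cbox p q) (\<lambda>v. ?m (y, v))"
    unfolding integral_e_eq_0[OF f(1) foff(1) y] integral_e_eq_0[OF f(2) foff(2) y] by simp
qed

text \<open>The parameter derivative leads back to a potential, at the cost of one derivative of the
  density, so a Lipschitz estimate reduces to a bound for potentials of densities of order
  1.\<close>

lemma integral_dir_deriv_param:
  assumes w: "Ck (Suc (Suc 0)) (Y \<times> B) w" "off_C w" and y: "good y"
  shows "integral (cbox p q) (\<lambda>v. dir_deriv (h, 0) (\<lambda>z. w z \<bullet> newton (D z)) (y, v)) = potential (deriv_density h w) y"
proof -
  let ?g = "\<lambda>z. deriv_density h w z \<bullet> newton (D z)"
  let ?f1 = "\<lambda>z. zeta1 h w z \<bullet> newton (D z)" and ?f2 = "\<lambda>z. zeta2 h w z \<bullet> newton (D z)"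
  have w1: "Ck (Suc 0) (Y \<times> B) w" using w(1) by (rule Ck_SucD)
  have zeta: "Ck (Suc 0) (Y \<times> B) (zeta1 h w)" "Ck (Suc 0) (Y \<times> B) (zeta2 h w)"
    by (intro Ck_zeta w1; simp)+
  have f: "Ck (Suc 0) regular ?f1" "Ck (Suc 0) regular ?f2" by (intro Ck_field zeta; simp)+
  have foff: "off_C ?f1" "off_C ?f2" by (intro off_C_field off_C_coeff w)+
  have g: "Ck 0 regular ?g" by (intro Ck_field Ck_SucD[OF Ck_deriv_density] w) simp
  have goff: "off_C ?g" by (intro off_C_field off_C_deriv_density w)
  have yY: "y \<in> Y" using y by (simp add: good_def)
  have cg: "continuous_on (cbox p q) (\<lambda>v. ?g (y, v))" by (rule continuous_slice[OF g goff y])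
  have c1: "continuous_on (cbox p q) (\<lambda>v. dir_deriv e1 ?f1 (y, v))"
    by (rule continuous_slice[OF Ck_dir_deriv[OF f(1)] off_C_dir_deriv[OF foff(1)] y])
  have c2: "continuous_on (cbox p q) (\<lambda>v. dir_deriv e2 ?f2 (y, v))"
    by (rule continuous_slice[OF Ck_dir_deriv[OF f(2)] off_C_dir_deriv[OF foff(2)] y])
  have "dir_deriv (h, 0) (\<lambda>z. w z \<bullet> newton (D z)) (y, v) = ?g (y, v) + dir_deriv e1 ?f1 (y, v) + dir_deriv e2 ?f2 (y, v)" for v
  proof (cases "v \<in> C")
    case True
    then have "(y, v) \<in> regular" using y CB by (auto simp: regular_def good_def)
    then show ?thesis using dir_deriv_field_param[OF _ w(1)] by simp
  next
    case False
    then show ?thesis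
      using off_C_dir_deriv[OF off_C_field[OF w(2)], of "(h, 0)"] goff off_C_dir_deriv[OF foff(1), of e1]
        off_C_dir_deriv[OF foff(2), of e2] yY by (simp add: off_C_def)
  qed
  then have "integral (cbox p q) (\<lambda>v. dir_deriv (h, 0) (\<lambda>z. w z \<bullet> newton (D z)) (y, v)) =
      integral (cbox p q) (\<lambda>v. ?g (y, v) + dir_deriv e1 ?f1 (y, v) + dir_deriv e2 ?f2 (y, v))"
    by simp
  also have "\<dots> = integral (cbox p q) (\<lambda>v. ?g (y, v)) + integral (cbox p q) (\<lambda>v. dir_deriv e1 ?f1 (y, v))
      + integral (cbox p q) (\<lambda>v. dir_deriv e2 ?f2 (y, v))"
    by (intro integral_unique has_integral_add integrable_integral integrable_continuous cg c1 c2)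
  finally show ?thesis
    by (simp add: integral_e_eq_0[OF f(1) foff(1) y] integral_e_eq_0[OF f(2) foff(2) y] potential_def)
qed

end

text \<open>\<open>sg\<close> stands for the signed distance between the layer and the origin,
  \<open>vh\<close> for the parameter of the nearest point. \<open>D_lower\<close> compares the
  layer with a plane at that distance; \<open>D_normal\<close> expresses that it leaves its tangent
  plane only quadratically. Both constants are uniform on \<open>K\<close>.\<close>

locale layer_potential_bounds = layer_potential +
  fixes K :: "'a set" and sg :: "'a \<Rightarrow> real" and vh :: "'a \<Rightarrow> real ^ 2" and m cn s0 :: real
  assumes K: "compact K" "K \<subseteq> Y" and m: "m > 0" and cn: "cn \<ge> 0"
    and vh: "\<And>y. y \<in> K \<Longrightarrow> vh y \<in> cbox p q" and s0: "\<And>y. y \<in> K \<Longrightarrow> \<bar>sg y\<bar> \<le> s0"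
    and D_lower: "\<And>y v. y \<in> K \<Longrightarrow> v \<in> C \<Longrightarrow> norm (D (y, v)) \<ge> m * sqrt ((sg y)\<^sup>2 + (norm (v - vh y))\<^sup>2)"
    and D_normal: "\<And>y v. y \<in> K \<Longrightarrow> v \<in> C \<Longrightarrow> \<bar>no (y, v) \<bullet> D (y, v)\<bar> \<le> cn * (\<bar>sg y\<bar> + (norm (v - vh y))\<^sup>2)"
begin

lemma rho_pos: "sg y \<noteq> 0 \<Longrightarrow> sqrt ((sg y)\<^sup>2 + (norm (v - vh y))\<^sup>2) > 0"
  by (simp add: add_pos_nonneg)

lemma K_good: "y \<in> K \<Longrightarrow> sg y \<noteq> 0 \<Longrightarrow> good y"
proof -
  assume y: "y \<in> K" "sg y \<noteq> 0"
  have "D (y, v) \<noteq> 0" if "v \<in> C" for v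
    using D_lower[OF y(1) that] mult_pos_pos[OF m rho_pos[OF y(2), of v]] by auto
  then show ?thesis using y K by (auto simp: good_def)
qed

lemma compact_KC: "compact (K \<times> C)"
proof -
  have "compact C" using closedC Cbox by (metis compact_cbox compact_eq_bounded_closed bounded_subset)
  then show ?thesis using K by (intro compact_Times)
qed

lemma bounded_on_KC:
  fixes f :: "'a \<times> (real ^ 2) \<Rightarrow> real"
  assumes "continuous_on (Y \<times> B) f"
  shows "\<exists>M\<ge>0. \<forall>z\<in>K \<times> C. \<bar>f z\<bar> \<le> M"
proof -
  have "compact (f ` (K \<times> C))"
    using K CB by (intro compact_continuous_image compact_KC continuous_on_subset[OF assms]) auto
  then obtain M where M: "\<forall>x\<in>f ` (K \<times> C). norm x \<le> M"
    using compact_imp_bounded bounded_iff by blast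
  have "\<forall>z\<in>K \<times> C. \<bar>f z\<bar> \<le> \<bar>M\<bar>"
  proof
    fix z assume "z \<in> K \<times> C"
    then have "norm (f z) \<le> M" using M by blast
    then show "\<bar>f z\<bar> \<le> \<bar>M\<bar>" by simp
  qed
  then show ?thesis by (intro exI[of _ "\<bar>M\<bar>"]) simp
qed

text \<open>With r the square root in \<open>D_lower\<close>, the kernels of the decomposition are
  at most \<open>1 / (m * r)\<close> and
  \<open>cn * (\<bar>s\<bar> + r\<^sup>2) / (m * r) ^ 3\<close>, hence at most multiples of
  \<open>1 / r + \<bar>s\<bar> / r ^ 3\<close>. The bound does not degenerate as \<open>sg y\<close>
  tends to 0.\<close>

lemma potential_bound:
  assumes w: "Ck (Suc 0) (Y \<times> B) w" "off_C w"
  shows "\<exists>M\<ge>0. \<forall>y\<in>K. sg y \<noteq> 0 \<longrightarrow> \<bar>potential w y\<bar> \<le> M"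
proof (cases "K = {}")
  case True
  then show ?thesis by (intro exI[of _ 0]) simp
next
  case False
  then have s0': "s0 \<ge> 0" using s0 by fastforce
  have coeff: "Ck (Suc 0) (Y \<times> B) (al w)" "Ck (Suc 0) (Y \<times> B) (be w)" "Ck (Suc 0) (Y \<times> B) (ga w)"
    by (intro Ck_coeff w; simp)+
  have "continuous_on (Y \<times> B) (smooth_part w)"
    unfolding smooth_part_def[abs_def]
    by (intro Ck_continuous_on[of 0] Ck_add openYB Ck_dir_deriv coeff)
  then obtain M1 where M1: "M1 \<ge> 0" "\<forall>z\<in>K \<times> C. \<bar>smooth_part w z\<bar> \<le> M1" using bounded_on_KC by blast
  obtain M2 where M2: "M2 \<ge> 0" "\<forall>z\<in>K \<times> C. \<bar>ga w z\<bar> \<le> M2"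
    using bounded_on_KC[OF Ck_continuous_on[OF coeff(3)]] by blast
  define c where "c = M1 / m + M2 * cn / m ^ 3"
  have c: "c \<ge> 0" using M1 M2 cn m by (auto simp: c_def)
  define M where "M = c * ((2 * pi * s0 + 8 * norm (q - p)) + 2 * pi)"
  have "\<bar>potential w y\<bar> \<le> M" if y: "y \<in> K" and s: "sg y \<noteq> 0" for y
  proof -
    let ?r = "\<lambda>v. sqrt ((sg y)\<^sup>2 + (norm (v - vh y))\<^sup>2)"
    let ?k = "\<lambda>v. 1 / ?r v + \<bar>sg y\<bar> / ?r v ^ 3"
    let ?g = "\<lambda>v. smooth_part w (y, v) * (1 / norm (D (y, v))) + ga w (y, v) * (no (y, v) \<bullet> newton (D (y, v)))"
    have r: "?r v > 0" for v using rho_pos[OF s] .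
    have kpos: "?k v \<ge> 0" for v using r[of v] by (intro add_nonneg_nonneg divide_nonneg_pos) auto
    have g: "norm (?g v) \<le> c * ?k v" for v
    proof (cases "v \<in> C")
      case False
      then show ?thesis
        using off_C_smooth_part[OF w(2)] off_C_coeff(3)[OF w(2)] y K kpos[of v] c
        by (auto simp: off_C_def subset_iff)
    next
      case True
      define d where "d = norm (D (y, v))"
      have d: "d \<ge> m * ?r v" using D_lower[OF y True] by (simp add: d_def)
      have mr: "m * ?r v > 0" using m r by simp
      have d0: "d > 0" using d mr by linarith
      have 1: "\<bar>smooth_part w (y, v) * (1 / d)\<bar> \<le> M1 * (1 / (m * ?r v))"
        unfolding abs_mult using M1 y True d mr d0
        by (intro mult_mono) (auto simp: frac_le)
      have v2: "(norm (v - vh y))\<^sup>2 \<le> ?r v ^ 2" by simp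
      have "\<bar>no (y, v) \<bullet> newton (D (y, v))\<bar> = \<bar>no (y, v) \<bullet> D (y, v)\<bar> / d ^ 3"
        using d0 by (simp add: newton_def d_def abs_mult)
      also have "\<dots> \<le> (cn * (\<bar>sg y\<bar> + ?r v ^ 2)) / (m * ?r v) ^ 3"
      proof (rule frac_le)
        show "0 \<le> cn * (\<bar>sg y\<bar> + ?r v ^ 2)" using cn by (intro mult_nonneg_nonneg add_nonneg_nonneg) auto
        have "\<bar>no (y, v) \<bullet> D (y, v)\<bar> \<le> cn * (\<bar>sg y\<bar> + (norm (v - vh y))\<^sup>2)" by (rule D_normal[OF y True])
        also have "\<dots> \<le> cn * (\<bar>sg y\<bar> + ?r v ^ 2)" using v2 cn by (intro mult_left_mono add_left_mono)
        finally show "\<bar>no (y, v) \<bullet> D (y, v)\<bar> \<le> cn * (\<bar>sg y\<bar> + ?r v ^ 2)" .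
        show "0 < (m * ?r v) ^ 3" using mr by (rule zero_less_power)
        show "(m * ?r v) ^ 3 \<le> d ^ 3" using d mr by (intro power_mono) auto
      qed
      also have "\<dots> = cn / m ^ 3 * ?k v"
      proof -
        have "(cn * (\<bar>sg y\<bar> + R ^ 2)) / (m * R) ^ 3 = cn / m ^ 3 * (1 / R + \<bar>sg y\<bar> / R ^ 3)" if "R > 0" for R
          using that m by (simp add: field_simps power2_eq_square power3_eq_cube)
        then show ?thesis using r by blast
      qed
      finally have 2: "\<bar>no (y, v) \<bullet> newton (D (y, v))\<bar> \<le> cn / m ^ 3 * ?k v" .
      have "\<bar>ga w (y, v) * (no (y, v) \<bullet> newton (D (y, v)))\<bar> \<le> M2 * (cn / m ^ 3 * ?k v)"
        unfolding abs_mult using M2 y True 2 by (intro mult_mono) auto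
      moreover have "M1 * (1 / (m * ?r v)) \<le> M1 / m * ?k v"
      proof -
        have "M1 / m * (1 / ?r v) \<le> M1 / m * ?k v"
          using M1 m r[of v] by (intro mult_left_mono) auto
        then show ?thesis by simp
      qed
      ultimately have "\<bar>?g v\<bar> \<le> M1 / m * ?k v + M2 * (cn / m ^ 3 * ?k v)"
        using 1 abs_triangle_ineq[of "smooth_part w (y, v) * (1 / d)" "ga w (y, v) * (no (y, v) \<bullet> newton (D (y, v)))"]
        unfolding d_def by linarith
      also have "\<dots> = c * ?k v"
      proof -
        have "M1 / m * k + M2 * (cn / m ^ 3 * k) = c * k" for k by (simp add: c_def distrib_right)
        then show ?thesis by blast
      qed
      finally show ?thesis by simp
    qed
    have contk: "continuous_on (cbox p q) ?k"
      using s by (intro continuous_intros) auto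
    have "\<bar>potential w y\<bar> = norm (integral (cbox p q) ?g)"
      by (simp add: potential_decomposition(1)[OF w K_good[OF y s]])
    also have "\<dots> \<le> integral (cbox p q) (\<lambda>v. c * ?k v)"
      by (intro integral_norm_bound_integral integrable_continuous g
          potential_decomposition(2)[OF w K_good[OF y s]] continuous_on_mult continuous_on_const contk)
    also have "\<dots> = c * integral (cbox p q) ?k" by (rule integral_mult_right)
    also have "\<dots> \<le> M"
      unfolding M_def using kernel_integral_bound[of "sg y" s0 "vh y" p q] s s0[OF y] vh[OF y] c
      by (intro mult_left_mono) auto
    finally show ?thesis .
  qed
  moreover have "M \<ge> 0" unfolding M_def using c s0' by (intro mult_nonneg_nonneg add_nonneg_nonneg) auto
  ultimately show ?thesis by blast
qed

text \<open>Differentiation under the integral asks for a regular integrand, hence for a segment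
  that never meets \<open>sg z = 0\<close>. The bound on the derivative is uniform up to that set,
  so the constant does not depend on how close the segment comes.\<close>

lemma potential_lipschitz:
  assumes w: "Ck (Suc (Suc 0)) (Y \<times> B) w" "off_C w"
  shows "\<exists>L\<ge>0. \<forall>x y. (\<forall>z\<in>closed_segment x y. z \<in> K \<and> sg z \<noteq> 0) \<longrightarrow>
    \<bar>potential w x - potential w y\<bar> \<le> L * norm (x - y)"
proof -
  let ?F = "\<lambda>z. w z \<bullet> newton (D z)"
  have "\<exists>M\<ge>0. \<forall>y\<in>K. sg y \<noteq> 0 \<longrightarrow> \<bar>potential (deriv_density b w) y\<bar> \<le> M" for b
    by (intro potential_bound Ck_deriv_density off_C_deriv_density w)
  then obtain M where M: "\<And>b. M b \<ge> 0"
    "\<And>b y. y \<in> K \<Longrightarrow> sg y \<noteq> 0 \<Longrightarrow> \<bar>potential (deriv_density b w) y\<bar> \<le> M b" by metis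
  define L where "L = (\<Sum>b\<in>Basis. M b)"
  have w1: "Ck (Suc 0) (Y \<times> B) w" using w(1) by (rule Ck_SucD)
  have F: "Ck (Suc 0) regular ?F" by (intro Ck_field w1) simp
  have Foff: "off_C ?F" by (intro off_C_field w)
  define Q where "Q = regular \<union> Y \<times> - C"
  have FQ: "Ck (Suc 0) Q ?F" unfolding Q_def by (rule Ck_extend[OF F Foff])
  have inQ: "(y, v) \<in> Q" if "y \<in> K" "sg y \<noteq> 0" for y v
    unfolding Q_def by (rule good_slice[OF K_good[OF that]])
  have bound: "\<bar>integral (cbox p q) (\<lambda>v. dir_deriv (h, 0) ?F (y, v))\<bar> \<le> L * norm h"
    if y: "y \<in> K" "sg y \<noteq> 0" for y h
  proof -
    have "dir_deriv (h, 0) ?F (y, v) = (\<Sum>b\<in>Basis. (h \<bullet> b) *\<^sub>R dir_deriv (b, 0) ?F (y, v))" for v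
      by (rule dir_deriv_sum_Basis[OF Ck_imp_differentiable[OF FQ inQ[OF y]]])
    then have "integral (cbox p q) (\<lambda>v. dir_deriv (h, 0) ?F (y, v)) =
        integral (cbox p q) (\<lambda>v. \<Sum>b\<in>Basis. (h \<bullet> b) *\<^sub>R dir_deriv (b, 0) ?F (y, v))"
      by simp
    also have "\<dots> = (\<Sum>b\<in>Basis. integral (cbox p q) (\<lambda>v. (h \<bullet> b) *\<^sub>R dir_deriv (b, 0) ?F (y, v)))"
    proof (rule integral_sum)
      show "(\<lambda>v. (h \<bullet> b) *\<^sub>R dir_deriv (b, 0) ?F (y, v)) integrable_on cbox p q" for b
        by (intro integrable_continuous continuous_on_scaleR continuous_on_const
            continuous_slice[OF Ck_dir_deriv[OF F] off_C_dir_deriv[OF Foff] K_good[OF y]])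
    qed simp
    also have "\<dots> = (\<Sum>b\<in>Basis. (h \<bullet> b) * potential (deriv_density b w) y)"
      using integral_dir_deriv_param[OF w K_good[OF y]] by simp
    finally have "\<bar>integral (cbox p q) (\<lambda>v. dir_deriv (h, 0) ?F (y, v))\<bar> \<le>
        (\<Sum>b\<in>Basis. \<bar>(h \<bullet> b) * potential (deriv_density b w) y\<bar>)"
      by (simp add: sum_abs)
    also have "\<dots> \<le> (\<Sum>b\<in>Basis. M b * norm h)"
    proof (rule sum_mono)
      fix b :: 'a assume b: "b \<in> Basis"
      have "\<bar>h \<bullet> b\<bar> * \<bar>potential (deriv_density b w) y\<bar> \<le> norm h * M b"
        using Basis_le_norm[OF b] M(2)[OF y] by (intro mult_mono) auto
      then show "\<bar>(h \<bullet> b) * potential (deriv_density b w) y\<bar> \<le> M b * norm h"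
        by (simp add: abs_mult mult.commute)
    qed
    finally show ?thesis by (simp add: L_def sum_distrib_right)
  qed
  have "\<bar>potential w x - potential w y\<bar> \<le> L * norm (x - y)"
    if seg: "\<forall>z\<in>closed_segment x y. z \<in> K \<and> sg z \<noteq> 0" for x y
  proof -
    let ?h = "y - x"
    have path: "x + t *\<^sub>R ?h \<in> K" "sg (x + t *\<^sub>R ?h) \<noteq> 0" if "t \<in> {0..1}" for t
    proof -
      have "x + t *\<^sub>R ?h \<in> closed_segment x y"
        using that unfolding closed_segment_def by (auto intro!: exI[of _ t] simp: algebra_simps)
      then show "x + t *\<^sub>R ?h \<in> K" "sg (x + t *\<^sub>R ?h) \<noteq> 0" using seg by auto
    qed
    have deriv: "((\<lambda>t. potential w (x + t *\<^sub>R ?h)) has_field_derivative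
        integral (cbox p q) (\<lambda>v. dir_deriv (?h, 0) ?F (x + t *\<^sub>R ?h, v))) (at t within {0..1})"
      if t: "t \<in> {0..1}" for t
      unfolding potential_def
    proof (rule leibniz_rule_field_derivative[where fx = "\<lambda>t v. dir_deriv (?h, 0) ?F (x + t *\<^sub>R ?h, v)"])
      show "((\<lambda>t. ?F (x + t *\<^sub>R ?h, v)) has_field_derivative dir_deriv (?h, 0) ?F (x + t *\<^sub>R ?h, v))
          (at t within {0..1})" if t: "t \<in> {0..1}" for t v
      proof -
        have "?F differentiable (at ((x, v) + t *\<^sub>R (?h, 0)))"
          using Ck_imp_differentiable[OF FQ inQ[OF path[OF t]], of v] by simp
        from dir_deriv_line[OF this] show ?thesis
          by (simp add: has_real_derivative_iff_has_vector_derivative has_vector_derivative_at_within)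
      qed
      show "(\<lambda>v. ?F (x + t *\<^sub>R ?h, v)) integrable_on cbox p q" if t: "t \<in> {0..1}" for t
        by (intro integrable_continuous continuous_slice[OF Ck_SucD[OF F] Foff K_good[OF path[OF t]]])
      show "continuous_on ({0..1} \<times> cbox p q) (\<lambda>(t, v). dir_deriv (?h, 0) ?F (x + t *\<^sub>R ?h, v))"
        unfolding case_prod_beta
        by (rule continuous_on_compose2[OF Ck_continuous_on[OF Ck_dir_deriv[OF FQ]]])
          (auto intro!: continuous_intros inQ path)
    qed (use t in auto)
    have "norm (potential w (x + 1 *\<^sub>R ?h) - potential w (x + 0 *\<^sub>R ?h)) \<le> (L * norm ?h) * norm (1 - 0 :: real)"
    proof (rule field_differentiable_bound[OF _ deriv])
      show "norm (integral (cbox p q) (\<lambda>v. dir_deriv (?h, 0) ?F (x + t *\<^sub>R ?h, v))) \<le> L * norm ?h"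
        if "t \<in> {0..1}" for t using bound[OF path[OF that]] by simp
    qed auto
    then show ?thesis by (simp add: norm_minus_commute abs_minus_commute)
  qed
  moreover have "L \<ge> 0" unfolding L_def using M by (intro sum_nonneg) auto
  ultimately show ?thesis by blast
qed

end

subsection \<open>The jump relation\<close>

text \<open>Passes to the Lebesgue integral over the plane, to which substitution and dominated
  convergence are applied.\<close>

lemma integral_cbox_eq_lborel:
  fixes F :: "real ^ 2 \<Rightarrow> real"
  assumes cont: "continuous_on UNIV F" and supp: "\<And>v. v \<notin> cbox p q \<Longrightarrow> F v = 0"
  shows "integral (cbox p q) F = (\<integral>v. F v \<partial>lborel)"
proof -
  have "integrable lborel (\<lambda>v. indicator (cbox p q) v *\<^sub>R F v)"
    by (intro borel_integrable_compact compact_cbox continuous_on_subset[OF cont]) simp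
  moreover have "(\<lambda>v. indicator (cbox p q) v *\<^sub>R F v) = F"
    using supp by (auto simp: fun_eq_iff indicator_def)
  ultimately have "integral UNIV F = (\<integral>v. F v \<partial>lborel)" by (simp add: integral_lborel)
  moreover have "integral UNIV F = integral (cbox p q) F"
  proof -
    have "(F has_integral integral (cbox p q) F) UNIV"
      by (rule has_integral_on_superset[OF integrable_integral[OF integrable_continuous]])
        (use supp continuous_on_subset[OF cont] in auto)
    then show ?thesis by (rule integral_unique)
  qed
  ultimately show ?thesis by simp
qed

lemma lborel_integral_scale:
  fixes F :: "real ^ 2 \<Rightarrow> real"
  assumes F: "F \<in> borel_measurable borel" and s: "s > 0"
  shows "(\<integral>v. F v \<partial>lborel) = (\<integral>u. s\<^sup>2 * F (c + s *\<^sub>R u) \<partial>lborel)"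
proof -
  let ?T = "\<lambda>u :: real ^ 2. c + s *\<^sub>R u"
  have T: "?T \<in> measurable lborel borel" by simp
  have "(\<integral>v. F v \<partial>lborel) = integral\<^sup>L (density (distr lborel borel ?T) (\<lambda>_. ennreal (s\<^sup>2))) F"
    using lborel_affine[of s c] s by (simp add: DIM_cart)
  also have "\<dots> = integral\<^sup>L (distr lborel borel ?T) (\<lambda>v. s\<^sup>2 *\<^sub>R F v)"
    using F by (intro integral_density) auto
  also have "\<dots> = (\<integral>u. s\<^sup>2 *\<^sub>R F (?T u) \<partial>lborel)"
    using F by (intro integral_distr T) simp
  finally show ?thesis by simp
qed

text \<open>Homogeneity of degree -2 exactly balances the area factor \<open>s\<^sup>2\<close> of a
  dilation of the plane; the rescaled jump therefore has a nontrivial limit.\<close>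

lemma newton_scale: "s > 0 \<Longrightarrow> s\<^sup>2 *\<^sub>R newton (s *\<^sub>R y) = newton y"
  by (cases "y = 0") (auto simp: newton_def power2_eq_square power3_eq_cube)

text \<open>Gains one power of decay over a single value of \<open>newton\<close>, which makes the
  difference of the two sides integrable over the plane. The constant is 1 from the difference of
  the vectors plus 3 from the factors of a difference of cubes.\<close>

lemma newton_diff_bound:
  assumes r: "r > 0" "norm y \<ge> r" "norm z \<ge> r"
  shows "norm (newton y - newton z) \<le> 4 * norm (y - z) / r ^ 3"
proof -
  define P Q where "P = norm y" and "Q = norm z"
  have PQ: "P \<ge> r" "Q \<ge> r" "P > 0" "Q > 0" using r by (auto simp: P_def Q_def)
  have "newton y - newton z = (1 / P ^ 3) *\<^sub>R (y - z) + (1 / P ^ 3 - 1 / Q ^ 3) *\<^sub>R z"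
    by (simp add: newton_def P_def Q_def algebra_simps)
  then have "norm (newton y - newton z) \<le> norm (y - z) / P ^ 3 + \<bar>1 / P ^ 3 - 1 / Q ^ 3\<bar> * Q"
    using norm_triangle_ineq[of "(1 / P ^ 3) *\<^sub>R (y - z)" "(1 / P ^ 3 - 1 / Q ^ 3) *\<^sub>R z"] PQ
    by (simp add: Q_def)
  also have "1 / P ^ 3 - 1 / Q ^ 3 = (Q - P) * (Q\<^sup>2 + Q * P + P\<^sup>2) / (P ^ 3 * Q ^ 3)"
    using PQ by (simp add: field_simps power2_eq_square power3_eq_cube)
  also have "\<bar>(Q - P) * (Q\<^sup>2 + Q * P + P\<^sup>2) / (P ^ 3 * Q ^ 3)\<bar> * Q = \<bar>Q - P\<bar> * (1 / P ^ 3 + 1 / (P\<^sup>2 * Q) + 1 / (P * Q\<^sup>2))"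
  proof -
    have "\<bar>(Q - P) * (Q\<^sup>2 + Q * P + P\<^sup>2) / (P ^ 3 * Q ^ 3)\<bar> = \<bar>Q - P\<bar> * (Q\<^sup>2 + Q * P + P\<^sup>2) / (P ^ 3 * Q ^ 3)"
      using PQ by (simp add: abs_mult abs_divide)
    then show ?thesis using PQ by (simp add: field_simps power2_eq_square power3_eq_cube)
  qed
  also have "\<bar>Q - P\<bar> * (1 / P ^ 3 + 1 / (P\<^sup>2 * Q) + 1 / (P * Q\<^sup>2)) \<le> norm (y - z) * (1 / r ^ 3 + 1 / r ^ 3 + 1 / r ^ 3)"
  proof (intro mult_mono add_mono)
    show "\<bar>Q - P\<bar> \<le> norm (y - z)"
      unfolding P_def Q_def using norm_triangle_ineq3[of y z] by (simp add: abs_minus_commute)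
    have "r ^ 3 \<le> P ^ 3" using PQ r by (intro power_mono) auto
    then show "1 / P ^ 3 \<le> 1 / r ^ 3" using r by (intro frac_le) auto
    have "r\<^sup>2 * r \<le> P\<^sup>2 * Q" "r * r\<^sup>2 \<le> P * Q\<^sup>2" using PQ r by (auto intro!: mult_mono power_mono)
    then show "1 / (P\<^sup>2 * Q) \<le> 1 / r ^ 3" "1 / (P * Q\<^sup>2) \<le> 1 / r ^ 3"
      using r by (auto intro!: frac_le simp: power2_eq_square power3_eq_cube)
  qed (use PQ in auto)
  also have "norm (y - z) / P ^ 3 \<le> norm (y - z) / r ^ 3"
    using PQ r by (intro divide_left_mono power_mono mult_pos_pos) auto
  finally show ?thesis by (simp add: algebra_simps)
qed

text \<open>In the scale of its distance \<open>S k\<close> to the origin, the layer converges to its tangent plane.\<close>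

lemma potential_jump:
  fixes w D0 :: "real ^ 2 \<Rightarrow> real ^ 3" and a b n :: "real ^ 3" and c p q :: "real ^ 2"
  assumes w: "continuous_on UNIV w" "\<And>v. v \<notin> C \<Longrightarrow> w v = 0" "C \<subseteq> cbox p q"
    and D0: "(D0 has_derivative (\<lambda>u. (u $ 1) *\<^sub>R a + (u $ 2) *\<^sub>R b)) (at c)" "D0 c = 0"
    and n: "norm n = 1" "n \<bullet> a = 0" "n \<bullet> b = 0" and ab: "cross3 a b \<noteq> 0"
    and lower: "\<And>v s. v \<in> C \<Longrightarrow> \<bar>s\<bar> \<le> s0 \<Longrightarrow> norm (D0 v + s *\<^sub>R n) \<ge> m * sqrt (s\<^sup>2 + (norm (v - c))\<^sup>2)"
    and m: "m > 0"
    and cont: "\<And>s. s \<noteq> 0 \<Longrightarrow> \<bar>s\<bar> \<le> s0 \<Longrightarrow> continuous_on UNIV (\<lambda>v. w v \<bullet> newton (D0 v + s *\<^sub>R n))"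
    and S: "S \<longlonglongrightarrow> 0" "\<And>k. 0 < S k" "\<And>k. S k \<le> s0"
  shows "(\<lambda>k. integral (cbox p q) (\<lambda>v. w v \<bullet> newton (D0 v + S k *\<^sub>R n)) -
      integral (cbox p q) (\<lambda>v. w v \<bullet> newton (D0 v + (- S k) *\<^sub>R n)))
    \<longlonglongrightarrow> 4 * pi * (w c \<bullet> n) / norm (cross3 a b)"
proof -
  define L where "L u = (u $ 1) *\<^sub>R a + (u $ 2) *\<^sub>R b" for u :: "real ^ 2"
  \<comment> \<open>The integrand of the difference after the substitution
    \<open>v = c + S k *\<^sub>R u\<close>, with the area factor absorbed by homogeneity. The
    function \<open>g\<close> below is its limit, in which \<open>D0\<close> is replaced by the
    tangent plane.\<close>
  define G where "G k u = w (c + S k *\<^sub>R u) \<bullet> (newton ((1 / S k) *\<^sub>R D0 (c + S k *\<^sub>R u) + n)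
      - newton ((1 / S k) *\<^sub>R D0 (c + S k *\<^sub>R u) - n))" for k u
  define g where "g u = 2 * (w c \<bullet> n) * (1 / sqrt (1\<^sup>2 + (norm (L u))\<^sup>2) ^ 3)" for u
  have Ssmall: "S k \<noteq> 0" "\<bar>S k\<bar> \<le> s0" "- S k \<noteq> 0" "\<bar>- S k\<bar> \<le> s0" for k
    using S(2)[of k] S(3)[of k] by auto
  have scaled: "S k ^ 2 * (w (c + S k *\<^sub>R u) \<bullet> newton (D0 (c + S k *\<^sub>R u) + S k *\<^sub>R n)
      - w (c + S k *\<^sub>R u) \<bullet> newton (D0 (c + S k *\<^sub>R u) + (- S k) *\<^sub>R n)) = G k u" for k u
  proof -
    have "D0 (c + S k *\<^sub>R u) + S k *\<^sub>R n = S k *\<^sub>R ((1 / S k) *\<^sub>R D0 (c + S k *\<^sub>R u) + n)"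
      "D0 (c + S k *\<^sub>R u) + (- S k) *\<^sub>R n = S k *\<^sub>R ((1 / S k) *\<^sub>R D0 (c + S k *\<^sub>R u) - n)"
      using S(2)[of k] by (simp_all add: algebra_simps)
    then have "newton ((1 / S k) *\<^sub>R D0 (c + S k *\<^sub>R u) + n) = S k ^ 2 *\<^sub>R newton (D0 (c + S k *\<^sub>R u) + S k *\<^sub>R n)"
      "newton ((1 / S k) *\<^sub>R D0 (c + S k *\<^sub>R u) - n) = S k ^ 2 *\<^sub>R newton (D0 (c + S k *\<^sub>R u) + (- S k) *\<^sub>R n)"
      by (simp_all only: newton_scale[OF S(2)[of k]])
    then show ?thesis
      unfolding G_def by (simp only: inner_diff_right inner_scaleR_right right_diff_distrib)
  qed
  have eq: "integral (cbox p q) (\<lambda>v. w v \<bullet> newton (D0 v + S k *\<^sub>R n)) -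
      integral (cbox p q) (\<lambda>v. w v \<bullet> newton (D0 v + (- S k) *\<^sub>R n)) = (\<integral>u. G k u \<partial>lborel)"
    and G_meas: "G k \<in> borel_measurable lborel" for k
  proof -
    let ?F = "\<lambda>v. w v \<bullet> newton (D0 v + S k *\<^sub>R n) - w v \<bullet> newton (D0 v + (- S k) *\<^sub>R n)"
    have c1: "continuous_on UNIV (\<lambda>v. w v \<bullet> newton (D0 v + S k *\<^sub>R n))"
      and c2: "continuous_on UNIV (\<lambda>v. w v \<bullet> newton (D0 v + (- S k) *\<^sub>R n))"
      by (intro cont Ssmall)+
    have cF: "continuous_on UNIV ?F" by (intro continuous_on_diff c1 c2)
    then have mF: "?F \<in> borel_measurable borel" by (rule borel_measurable_continuous_onI)
    have "integral (cbox p q) (\<lambda>v. w v \<bullet> newton (D0 v + S k *\<^sub>R n)) -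
      integral (cbox p q) (\<lambda>v. w v \<bullet> newton (D0 v + (- S k) *\<^sub>R n)) = integral (cbox p q) ?F"
      by (intro integral_diff[symmetric] integrable_continuous continuous_on_subset[OF c1] continuous_on_subset[OF c2]) auto
    also have "\<dots> = (\<integral>v. ?F v \<partial>lborel)"
    proof (rule integral_cbox_eq_lborel[OF cF])
      fix v assume "v \<notin> cbox p q"
      then have "w v = 0" using w(2,3) by blast
      then show "?F v = 0" by simp
    qed
    also have "\<dots> = (\<integral>u. S k ^ 2 * ?F (c + S k *\<^sub>R u) \<partial>lborel)"
      by (rule lborel_integral_scale[OF mF S(2)])
    finally show "integral (cbox p q) (\<lambda>v. w v \<bullet> newton (D0 v + S k *\<^sub>R n)) -
      integral (cbox p q) (\<lambda>v. w v \<bullet> newton (D0 v + (- S k) *\<^sub>R n)) = (\<integral>u. G k u \<partial>lborel)"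
      by (simp only: scaled)
    have "(\<lambda>u. S k ^ 2 * ?F (c + S k *\<^sub>R u)) \<in> borel_measurable lborel"
      using mF by measurable
    then show "G k \<in> borel_measurable lborel" by (simp only: scaled)
  qed
  have nL: "n \<bullet> L u = 0" for u using n by (simp add: L_def inner_add_right)
  have normL: "norm (L u + n) = sqrt (1\<^sup>2 + (norm (L u))\<^sup>2)" "norm (L u - n) = sqrt (1\<^sup>2 + (norm (L u))\<^sup>2)" for u
  proof -
    have "(norm (L u + n))\<^sup>2 = 1\<^sup>2 + (norm (L u))\<^sup>2" "(norm (L u - n))\<^sup>2 = 1\<^sup>2 + (norm (L u))\<^sup>2"
      using nL[of u] n(1) unfolding power2_norm_eq_inner
      by (simp_all add: inner_add_left inner_add_right inner_diff_left inner_diff_right inner_commute norm_eq_1)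
    then show "norm (L u + n) = sqrt (1\<^sup>2 + (norm (L u))\<^sup>2)" "norm (L u - n) = sqrt (1\<^sup>2 + (norm (L u))\<^sup>2)"
      by (metis norm_ge_zero real_sqrt_unique)+
  qed
  have rpos: "sqrt (1\<^sup>2 + (norm (L u))\<^sup>2) > 0" for u by (simp add: add_pos_nonneg)
  \<comment> \<open>Both points have the same norm, so the tangential parts cancel and only
    \<open>2 *\<^sub>R n\<close> remains.\<close>
  have g_eq: "g u = w c \<bullet> (newton (L u + n) - newton (L u - n))" for u
  proof -
    have "(L u + n) - (L u - n) = 2 *\<^sub>R n" by (simp add: scaleR_2)
    then show ?thesis
      unfolding newton_def normL scaleR_diff_right[symmetric] by (simp add: g_def)
  qed
  have lim: "(\<lambda>k. G k u) \<longlonglongrightarrow> g u" for u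
  proof -
    have "(\<lambda>k. c + S k *\<^sub>R u) \<longlonglongrightarrow> c + 0 *\<^sub>R u" by (intro tendsto_intros S)
    then have arg: "(\<lambda>k. c + S k *\<^sub>R u) \<longlonglongrightarrow> c" by simp
    have wlim: "(\<lambda>k. w (c + S k *\<^sub>R u)) \<longlonglongrightarrow> w c"
      using w(1) arg by (intro isCont_tendsto_compose[of c w]) (auto simp: continuous_on_eq_continuous_at)
    have "((\<lambda>t. D0 (c + t *\<^sub>R u)) has_vector_derivative L u) (at 0)"
    proof -
      have "((\<lambda>t. c + t *\<^sub>R u) has_derivative (\<lambda>t. t *\<^sub>R u)) (at 0)"
        by (auto intro!: derivative_eq_intros)
      moreover have "(D0 has_derivative (\<lambda>u. (u $ 1) *\<^sub>R a + (u $ 2) *\<^sub>R b)) (at (c + 0 *\<^sub>R u))" using D0(1) by simp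
      ultimately have "((\<lambda>t. D0 (c + t *\<^sub>R u)) has_derivative (\<lambda>t. ((t *\<^sub>R u) $ 1) *\<^sub>R a + ((t *\<^sub>R u) $ 2) *\<^sub>R b)) (at 0)"
        by (rule has_derivative_compose)
      then show ?thesis
        by (simp add: has_vector_derivative_def L_def algebra_simps)
    qed
    then have "((\<lambda>t. (1 / t) *\<^sub>R D0 (c + t *\<^sub>R u)) \<longlongrightarrow> L u) (at 0)"
    proof -
      assume "((\<lambda>t. D0 (c + t *\<^sub>R u)) has_vector_derivative L u) (at 0)"
      then have "((\<lambda>t. norm (D0 (c + t *\<^sub>R u) - t *\<^sub>R L u) / norm t) \<longlongrightarrow> 0) (at 0)"
        unfolding has_vector_derivative_def has_derivative_at using D0(2) by simp
      then have "((\<lambda>t. norm ((1 / t) *\<^sub>R D0 (c + t *\<^sub>R u) - L u)) \<longlongrightarrow> 0) (at 0)"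
      proof (rule Lim_transform_eventually)
        show "\<forall>\<^sub>F t in at 0. norm (D0 (c + t *\<^sub>R u) - t *\<^sub>R L u) / norm t = norm ((1 / t) *\<^sub>R D0 (c + t *\<^sub>R u) - L u)"
          unfolding eventually_at_filter
        proof (rule always_eventually, intro allI impI)
          fix t :: real assume "t \<noteq> 0"
          then have "(1 / t) *\<^sub>R D0 (c + t *\<^sub>R u) - L u = (1 / t) *\<^sub>R (D0 (c + t *\<^sub>R u) - t *\<^sub>R L u)"
            by (simp add: scaleR_diff_right)
          then show "norm (D0 (c + t *\<^sub>R u) - t *\<^sub>R L u) / norm t = norm ((1 / t) *\<^sub>R D0 (c + t *\<^sub>R u) - L u)"
            by simp
        qed
      qed
      then show ?thesis by (rule LIM_zero_cancel[OF tendsto_norm_zero_cancel])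
    qed
    then have "(\<lambda>k. (1 / S k) *\<^sub>R D0 (c + S k *\<^sub>R u)) \<longlonglongrightarrow> L u"
      by (rule filterlim_compose) (use S Ssmall in \<open>auto simp: filterlim_at\<close>)
    then have "(\<lambda>k. newton ((1 / S k) *\<^sub>R D0 (c + S k *\<^sub>R u) + n)) \<longlonglongrightarrow> newton (L u + n)"
      "(\<lambda>k. newton ((1 / S k) *\<^sub>R D0 (c + S k *\<^sub>R u) - n)) \<longlonglongrightarrow> newton (L u - n)"
    proof -
      have "L u + n \<noteq> 0" "L u - n \<noteq> 0" using rpos[of u] normL[of u] by auto
      then have "isCont newton (L u + n)" "isCont newton (L u - n)"
        using has_derivative_continuous[OF has_derivative_newton] by blast+
      then show "(\<lambda>k. newton ((1 / S k) *\<^sub>R D0 (c + S k *\<^sub>R u) + n)) \<longlonglongrightarrow> newton (L u + n)"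
        "(\<lambda>k. newton ((1 / S k) *\<^sub>R D0 (c + S k *\<^sub>R u) - n)) \<longlonglongrightarrow> newton (L u - n)"
        if "(\<lambda>k. (1 / S k) *\<^sub>R D0 (c + S k *\<^sub>R u)) \<longlonglongrightarrow> L u"
        using that by (intro isCont_tendsto_compose[where g = newton] tendsto_intros; simp)+
    qed
    then show ?thesis unfolding G_def g_eq by (intro tendsto_intros wlim)
  qed
  obtain Wm where Wm: "\<And>v. norm (w v) \<le> Wm"
  proof -
    have "compact (w ` cbox p q)"
      by (intro compact_continuous_image compact_cbox continuous_on_subset[OF w(1)]) simp
    then obtain M where M: "\<forall>x\<in>w ` cbox p q. norm x \<le> M" using compact_imp_bounded bounded_iff by blast
    have "norm (w v) \<le> \<bar>M\<bar>" for v
      using M w(2)[of v] w(3) by (cases "v \<in> C") fastforce+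
    then show ?thesis by (rule that)
  qed
  \<comment> \<open>The factor 8 is the constant 4 of \<open>newton_diff_bound\<close> times
    \<open>norm (2 *\<^sub>R n)\<close>; the denominator comes from \<open>lower\<close>, whose form
    is preserved by the rescaling.\<close>
  define H where "H u = Wm * (8 / m ^ 3) * (1 / sqrt (1\<^sup>2 + (norm u)\<^sup>2) ^ 3)" for u :: "real ^ 2"
  have H0: "H u \<ge> 0" for u using m order_trans[OF norm_ge_zero Wm] by (simp add: H_def)
  have bound: "norm (G k u) \<le> H u" for k u
  proof (cases "c + S k *\<^sub>R u \<in> C")
    case False
    then show ?thesis using w(2) H0 by (simp add: G_def)
  next
    case True
    let ?z = "(1 / S k) *\<^sub>R D0 (c + S k *\<^sub>R u)"
    let ?r = "sqrt (1\<^sup>2 + (norm u)\<^sup>2)"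
    have r: "?r > 0" by (simp add: add_pos_nonneg)
    have "sqrt (s\<^sup>2 + (norm ((c + S k *\<^sub>R u) - c))\<^sup>2) = S k * ?r" if "\<bar>s\<bar> = S k" for s
    proof -
      have "s\<^sup>2 = S k ^ 2" using that by (metis power2_abs)
      then have "s\<^sup>2 + (norm ((c + S k *\<^sub>R u) - c))\<^sup>2 = S k ^ 2 * (1\<^sup>2 + (norm u)\<^sup>2)"
        by (simp add: power_mult_distrib algebra_simps)
      then show ?thesis using S(2)[of k] by (simp add: real_sqrt_mult)
    qed
    then have low: "m * (S k * ?r) \<le> norm (D0 (c + S k *\<^sub>R u) + s *\<^sub>R n)" if "\<bar>s\<bar> = S k" for s
      using lower[OF True, of s] that S(3)[of k] by simp
    have "norm (?z + n) = norm (D0 (c + S k *\<^sub>R u) + S k *\<^sub>R n) / S k"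
      "norm (?z - n) = norm (D0 (c + S k *\<^sub>R u) + (- S k) *\<^sub>R n) / S k"
    proof -
      have "?z + n = (1 / S k) *\<^sub>R (D0 (c + S k *\<^sub>R u) + S k *\<^sub>R n)"
        "?z - n = (1 / S k) *\<^sub>R (D0 (c + S k *\<^sub>R u) + (- S k) *\<^sub>R n)"
        using S(2)[of k] by (simp_all add: algebra_simps)
      then show "norm (?z + n) = norm (D0 (c + S k *\<^sub>R u) + S k *\<^sub>R n) / S k"
        "norm (?z - n) = norm (D0 (c + S k *\<^sub>R u) + (- S k) *\<^sub>R n) / S k"
        using S(2)[of k] by (simp_all only: norm_scaleR) simp_all
    qed
    then have low': "m * ?r \<le> norm (?z + n)" "m * ?r \<le> norm (?z - n)"
      using low[of "S k"] low[of "- S k"] S(2)[of k] by (simp_all add: pos_le_divide_eq mult_ac)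
    have "norm (G k u) \<le> norm (w (c + S k *\<^sub>R u)) * norm (newton (?z + n) - newton (?z - n))"
      unfolding G_def real_norm_def by (rule Cauchy_Schwarz_ineq2)
    also have "\<dots> \<le> Wm * (4 * norm ((?z + n) - (?z - n)) / (m * ?r) ^ 3)"
      using m r low' order_trans[OF norm_ge_zero Wm] by (intro mult_mono Wm newton_diff_bound) auto
    also have "(?z + n) - (?z - n) = 2 *\<^sub>R n" by (simp add: scaleR_2)
    also have "Wm * (4 * norm (2 *\<^sub>R n) / (m * ?r) ^ 3) = H u"
      using n(1) by (simp add: H_def power_mult_distrib)
    finally show ?thesis .
  qed
  have int_H: "integrable lborel H"
  proof -
    have "has_bochner_integral lborel (\<lambda>u :: real ^ 2. 1 / sqrt (1\<^sup>2 + (norm u)\<^sup>2) ^ 3) (2 * pi)"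
      using nn_integral_norm_kernel[of 1] by (intro has_bochner_integral_nn_integral) auto
    then have "integrable lborel (\<lambda>u :: real ^ 2. 1 / sqrt (1\<^sup>2 + (norm u)\<^sup>2) ^ 3)"
      by (simp add: has_bochner_integral_iff)
    then show ?thesis unfolding H_def[abs_def] by (rule integrable_mult_right)
  qed
  have a0: "a \<noteq> 0" using ab by auto
  \<comment> \<open>Lagrange's identity: the Gram determinant of the tangent vectors is the squared
    area of their parallelogram.\<close>
  have det: "(norm a)\<^sup>2 * (norm b)\<^sup>2 - (a \<bullet> b)\<^sup>2 = (norm (cross3 a b))\<^sup>2"
    using norm_cross_dot[of a b] by (simp add: power_mult_distrib)
  have Lq: "(norm (L u))\<^sup>2 = (norm a)\<^sup>2 * (u $ 1)\<^sup>2 + 2 * (a \<bullet> b) * (u $ 1) * (u $ 2) + (norm b)\<^sup>2 * (u $ 2)\<^sup>2" for u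
    unfolding L_def power2_norm_eq_inner
    by (simp add: inner_add_left inner_add_right inner_commute power2_eq_square algebra_simps)
  have g_int: "has_bochner_integral lborel (\<lambda>u. 1 / sqrt (1\<^sup>2 + (norm (L u))\<^sup>2) ^ 3) (2 * pi / norm (cross3 a b))"
  proof (rule has_bochner_integral_nn_integral)
    show "(\<lambda>u. 1 / sqrt (1\<^sup>2 + (norm (L u))\<^sup>2) ^ 3) \<in> borel_measurable lborel"
      unfolding Lq by measurable
    show "(\<integral>\<^sup>+u. ennreal (1 / sqrt (1\<^sup>2 + (norm (L u))\<^sup>2) ^ 3) \<partial>lborel) = ennreal (2 * pi / norm (cross3 a b))"
      unfolding Lq using nn_integral_quadratic_kernel[of 1 "(norm a)\<^sup>2" "(norm b)\<^sup>2" "a \<bullet> b"] a0 ab by (simp add: det)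
  qed auto
  have "(\<lambda>k. \<integral>u. G k u \<partial>lborel) \<longlonglongrightarrow> (\<integral>u. g u \<partial>lborel)"
  proof (rule integral_dominated_convergence[OF _ G_meas int_H])
    show "g \<in> borel_measurable lborel"
      unfolding g_def[abs_def]
      by (intro borel_measurable_times borel_measurable_const
          borel_measurable_integrable[OF integrable.intros[OF g_int]])
  qed (use lim bound in auto)
  moreover have "(\<integral>u. g u \<partial>lborel) = 4 * pi * (w c \<bullet> n) / norm (cross3 a b)"
    using has_bochner_integral_mult_right[OF g_int, of "2 * (w c \<bullet> n)"]
    by (simp add: g_def[abs_def] has_bochner_integral_iff mult_ac)
  ultimately show ?thesis unfolding eq by simp
qed

subsection \<open>Cutoff functions\<close>

lemma DERIV_max_0_power:
  fixes x :: real
  shows "DERIV (\<lambda>x. max 0 x ^ Suc (Suc n)) x :> real (Suc (Suc n)) * max 0 x ^ Suc n"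
proof -
  consider "x > 0" | "x < 0" | "x = 0" by linarith
  then show ?thesis
  proof cases
    case 1
    have "DERIV (\<lambda>x. x ^ Suc (Suc n)) x :> real (Suc (Suc n)) * x ^ Suc n"
      using DERIV_pow[of "Suc (Suc n)" x] by simp
    then show ?thesis
      using 1 by (subst DERIV_cong_ev[OF refl eventually_mono[OF eventually_nhds_in_open[of "{0<..}" x]] refl,
          where g = "\<lambda>x. x ^ Suc (Suc n)"]) auto
  next
    case 2
    have "DERIV (\<lambda>x. 0) x :> 0" by simp
    then show ?thesis
      using 2 by (subst DERIV_cong_ev[OF refl eventually_mono[OF eventually_nhds_in_open[of "{..<0}" x]] refl,
          where g = "\<lambda>x. 0"]) auto
  next
    case 3
    have "((\<lambda>h. max 0 h ^ Suc n) \<longlongrightarrow> max 0 0 ^ Suc n) (at (0::real))" by (intro tendsto_intros)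
    then have "((\<lambda>h. max 0 h ^ Suc n) \<longlongrightarrow> 0) (at (0::real))" by simp
    then have "((\<lambda>h. (max 0 (0 + h) ^ Suc (Suc n) - max 0 0 ^ Suc (Suc n)) / h) \<longlongrightarrow> 0) (at (0::real))"
    proof (rule Lim_transform_eventually)
      show "\<forall>\<^sub>F h in at 0. max 0 h ^ Suc n = (max 0 (0 + h) ^ Suc (Suc n) - max 0 0 ^ Suc (Suc n)) / (h::real)"
        unfolding eventually_at_filter by (rule always_eventually) (auto simp: max_def)
    qed
    then show ?thesis using 3 by (simp add: DERIV_def)
  qed
qed

text \<open>The cube is the lowest integer power whose positive part is twice continuously
  differentiable, the regularity demanded of a density.\<close>

lemma Ck_max_0_cubed: "Ck (Suc (Suc 0)) UNIV (\<lambda>x::real. max 0 x ^ 3)"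
proof -
  have 1: "Ck (Suc 0) UNIV (\<lambda>x::real. max 0 x ^ Suc (Suc 0))"
    using DERIV_max_0_power[of 0]
    by (intro Ck_SucI[where F = "\<lambda>x v. real (Suc (Suc 0)) * max 0 x ^ Suc 0 * v"])
      (auto simp: has_field_derivative_def intro!: continuous_intros)
  have "Ck (Suc (Suc 0)) UNIV (\<lambda>x::real. max 0 x ^ Suc (Suc (Suc 0)))"
  proof (rule Ck_SucI[where F = "\<lambda>x v. real (Suc (Suc (Suc 0))) * max 0 x ^ Suc (Suc 0) * v"])
    show "((\<lambda>x. max 0 x ^ Suc (Suc (Suc 0))) has_derivative (\<lambda>v. real (Suc (Suc (Suc 0))) * max 0 x ^ Suc (Suc 0) * v)) (at x)"
      for x :: real
      using DERIV_max_0_power[of "Suc 0" x] unfolding has_field_derivative_def .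
    show "Ck (Suc 0) UNIV (\<lambda>x::real. real (Suc (Suc (Suc 0))) * max 0 x ^ Suc (Suc 0) * v)" for v
      by (intro Ck_mult Ck_const 1 open_UNIV)
  qed simp
  then show ?thesis by (simp add: numeral_3_eq_3)
qed

lemma cutoff_exists:
  fixes c :: "'a::euclidean_space"
  assumes "0 < r2" "r2 < r1"
  shows "\<exists>ph :: 'a \<Rightarrow> real. Ck (Suc (Suc 0)) UNIV ph \<and> (\<forall>v\<in>cball c r2. ph v = 1) \<and> (\<forall>v. v \<notin> cball c r1 \<longrightarrow> ph v = 0)"
proof -
  define P where "P x = max 0 x ^ 3" for x :: real
  \<comment> \<open>The squared distance is smooth at \<open>c\<close> as well, unlike the
    distance.\<close>
  define t where "t v = (v - c) \<bullet> (v - c)" for v :: 'a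
  define ph where "ph v = P (r1\<^sup>2 - t v) / (P (r1\<^sup>2 - t v) + P (t v - r2\<^sup>2))" for v
  have r: "r2\<^sup>2 < r1\<^sup>2" using assms by (intro power_strict_mono) auto
  have pos: "P x \<ge> 0" "x > 0 \<Longrightarrow> P x > 0" "x \<le> 0 \<Longrightarrow> P x = 0" for x by (auto simp: P_def max_def)
  \<comment> \<open>The two summands cannot vanish together, since
    \<open>t v \<ge> r1\<^sup>2\<close> and \<open>t v \<le> r2\<^sup>2\<close> exclude each
    other.\<close>
  have den: "P (r1\<^sup>2 - t v) + P (t v - r2\<^sup>2) \<noteq> 0" for v
    using pos(1)[of "r1\<^sup>2 - t v"] pos(1)[of "t v - r2\<^sup>2"] pos(2)[of "r1\<^sup>2 - t v"] pos(2)[of "t v - r2\<^sup>2"] r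
    by (cases "t v < r1\<^sup>2") auto
  have t: "Ck k UNIV t" for k unfolding t_def[abs_def] by (intro Ck_inner Ck_diff Ck_ident Ck_const open_UNIV)
  have "Ck (Suc (Suc 0)) UNIV ph"
    unfolding ph_def[abs_def] P_def
  proof (intro Ck_divide Ck_add open_UNIV)
    show 1: "Ck (Suc (Suc 0)) UNIV (\<lambda>x. max 0 (r1\<^sup>2 - t x) ^ 3)"
      by (rule Ck_compose[OF _ _ Ck_max_0_cubed]) (auto intro!: Ck_diff Ck_const t)
    show "Ck (Suc (Suc 0)) UNIV (\<lambda>x. max 0 (t x - r2\<^sup>2) ^ 3)"
      by (rule Ck_compose[OF _ _ Ck_max_0_cubed]) (auto intro!: Ck_diff Ck_const t)
    show "Ck (Suc (Suc 0)) UNIV (\<lambda>x. max 0 (r1\<^sup>2 - t x) ^ 3)" by (rule 1)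
    show "max 0 (r1\<^sup>2 - t x) ^ 3 + max 0 (t x - r2\<^sup>2) ^ 3 \<noteq> 0" for x
      using den[of x] by (simp add: P_def)
  qed
  moreover have "ph v = 1" if "v \<in> cball c r2" for v
  proof -
    have "norm (v - c) \<le> r2" using that by (simp add: dist_norm norm_minus_commute)
    then have "t v \<le> r2\<^sup>2" unfolding t_def power2_norm_eq_inner[symmetric] by (intro power_mono) auto
    then have "P (t v - r2\<^sup>2) = 0" "P (r1\<^sup>2 - t v) > 0" using pos r by auto
    then show ?thesis by (simp add: ph_def)
  qed
  moreover have "ph v = 0" if "v \<notin> cball c r1" for v
  proof -
    have "norm (v - c) \<ge> r1" using that by (simp add: dist_norm norm_minus_commute)
    then have "t v \<ge> r1\<^sup>2" unfolding t_def power2_norm_eq_inner[symmetric] using assms by (intro power_mono) auto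
    then have "P (r1\<^sup>2 - t v) = 0" using pos by auto
    then show ?thesis by (simp add: ph_def)
  qed
  ultimately show ?thesis by blast
qed

subsection \<open>The perturbing function\<close>

lemma norm_rot_z: "norm (rot_z t *v x) = norm x"
proof -
  have "(norm (rot_z t *v x))\<^sup>2 = ((cos t)\<^sup>2 + (sin t)\<^sup>2) * (x $ 1)\<^sup>2 + ((cos t)\<^sup>2 + (sin t)\<^sup>2) * (x $ 2)\<^sup>2 + (x $ 3)\<^sup>2"
    unfolding power2_norm_eq_inner
    by (simp add: rot_z_def matrix_vector_mult_def inner_vec_def sum_3 power2_eq_square algebra_simps
        del: sin_cos_squared_add sin_cos_squared_add2 sin_cos_squared_add3)
  also have "\<dots> = (norm x)\<^sup>2"
    unfolding power2_norm_eq_inner by (simp add: inner_vec_def sum_3 power2_eq_square)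
  finally show ?thesis by simp
qed

lemma norm_rot_x: "norm (rot_x t *v x) = norm x"
proof -
  have "(norm (rot_x t *v x))\<^sup>2 = (x $ 1)\<^sup>2 + ((cos t)\<^sup>2 + (sin t)\<^sup>2) * (x $ 2)\<^sup>2 + ((cos t)\<^sup>2 + (sin t)\<^sup>2) * (x $ 3)\<^sup>2"
    unfolding power2_norm_eq_inner
    by (simp add: rot_x_def matrix_vector_mult_def inner_vec_def sum_3 power2_eq_square algebra_simps
        del: sin_cos_squared_add sin_cos_squared_add2 sin_cos_squared_add3)
  also have "\<dots> = (norm x)\<^sup>2"
    unfolding power2_norm_eq_inner by (simp add: inner_vec_def sum_3 power2_eq_square)
  finally show ?thesis by simp
qed

text \<open>Rotations preserve the norm, so a vanishing position would give \<open>cos u = e\<close>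
  and \<open>sin u = 0\<close>, hence \<open>e\<^sup>2 = 1\<close>. This keeps the denominator of
  the indirect term away from 0.\<close>

lemma position_nonzero:
  assumes E: "E \<in> regular_elements" and k0: "k0 > 0"
  shows "position k0 E l \<noteq> 0"
proof
  assume 0: "position k0 E l = 0"
  define a e u where "a = semimajor_axis k0 E" and "e = eccentricity E" and "u = eccentric_anomaly e l"
  let ?v = "vector [a * (cos u - e), a * sqrt (1 - e\<^sup>2) * sin u, 0] :: real ^ 3"
  have a: "a > 0" using regular_elements_pos[OF E] k0 by (simp add: a_def semimajor_axis_def)
  have e: "\<bar>e\<bar> < 1" unfolding e_def by (rule eccentricity_bounds[OF E])
  then have e2: "1 - e\<^sup>2 > 0" by (simp add: abs_square_less_1)
  have "norm ?v = norm (position k0 E l)"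
    by (simp add: position_def Let_def norm_rot_z norm_rot_x a_def e_def u_def)
  then have "?v = 0" using 0 by simp
  then have "?v $ 1 = 0" "?v $ 2 = 0" by simp_all
  then have "a * (cos u - e) = 0" "a * sqrt (1 - e\<^sup>2) * sin u = 0" by simp_all
  then have "cos u = e" "sin u = 0" using a e2 by auto
  then show False using e2 sin_cos_squared_add[of u] by simp
qed

abbreviation (input) regular_pairs :: "config set" where
  "regular_pairs \<equiv> regular_elements \<times> regular_elements"

lemma open_regular_pairs: "open regular_pairs"
  by (intro open_Times open_regular_elements)

lemma Ck_position_fst: "Ck k (regular_pairs \<times> (UNIV :: (real ^ 2) set)) (\<lambda>z. position k0 (fst (fst z)) (snd z $ 1))"
  and Ck_position_snd: "Ck k (regular_pairs \<times> (UNIV :: (real ^ 2) set)) (\<lambda>z. position k0 (snd (fst z)) (snd z $ 2))"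
proof -
  let ?Z = "regular_pairs \<times> (UNIV :: (real ^ 2) set)"
  have o: "open ?Z" by (intro open_Times open_regular_pairs open_UNIV)
  have oS: "open (regular_elements \<times> (UNIV :: real set))" by (intro open_Times open_regular_elements open_UNIV)
  have "Ck k ?Z (\<lambda>z. (\<lambda>z. position k0 (fst z) (snd z)) (fst (fst z), snd z $ 1))"
    by (rule Ck_compose[OF o oS Ck_position]) (auto intro!: Ck_Pair Ck_fst' Ck_fst Ck_snd Ck_nth o)
  then show "Ck k ?Z (\<lambda>z. position k0 (fst (fst z)) (snd z $ 1))" by simp
  have "Ck k ?Z (\<lambda>z. (\<lambda>z. position k0 (fst z) (snd z)) (snd (fst z), snd z $ 2))"
    by (rule Ck_compose[OF o oS Ck_position]) (auto intro!: Ck_Pair Ck_snd' Ck_fst Ck_snd Ck_nth o)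
  then show "Ck k ?Z (\<lambda>z. position k0 (snd (fst z)) (snd z $ 2))" by simp
qed

lemma open_Z: "open (regular_pairs \<times> (UNIV :: (real ^ 2) set))"
  by (intro open_Times open_regular_pairs open_UNIV)

lemma Ck_Delta: "Ck k (regular_pairs \<times> UNIV) (\<lambda>z. Delta k0 (fst z) (snd z))"
  unfolding Delta_def by (intro Ck_diff Ck_position_fst Ck_position_snd open_Z)

lemma Basis_real2_cases: "b \<in> (Basis :: (real ^ 2) set) \<Longrightarrow> b = axis 1 1 \<or> b = axis 2 1"
  using Basis_real2 by auto

lemma axis_2_components [simp]:
  "(axis 1 1 :: real ^ 2) $ 1 = 1" "(axis 1 1 :: real ^ 2) $ 2 = 0"
  "(axis 2 1 :: real ^ 2) $ 1 = 0" "(axis 2 1 :: real ^ 2) $ 2 = 1"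
  by (simp_all add: axis_def)

lemma perturbing_function_periodic:
  assumes "\<E> \<in> regular_pairs" "b \<in> Basis"
  shows "perturbing_function k0 \<mu> \<E> (V + (2 * pi) *\<^sub>R b) = perturbing_function k0 \<mu> \<E> V"
  using assms Basis_real2_cases[of b] position_periodic by (auto simp: perturbing_function_def Let_def)

lemma dR_periodic:
  assumes "\<E> \<in> regular_pairs" "b \<in> Basis"
  shows "dR k0 \<mu> i \<E> (V + (2 * pi) *\<^sub>R b) = dR k0 \<mu> i \<E> V"
  unfolding dR_def
  by (rule dir_deriv_cong_open[OF open_regular_pairs assms(1)]) (rule perturbing_function_periodic[OF _ assms(2)])

text \<open>The indirect term of the perturbing function, divided by \<open>- \<mu> k0\<^sup>2\<close>; it is smooth also at crossings.\<close>

definition indirect :: "real \<Rightarrow> config \<times> (real ^ 2) \<Rightarrow> real" where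
  "indirect k0 z = (position k0 (fst (fst z)) (snd z $ 1) \<bullet> position k0 (snd (fst z)) (snd z $ 2)) /
    norm (position k0 (snd (fst z)) (snd z $ 2)) ^ 3"

lemma Ck_indirect: "k0 > 0 \<Longrightarrow> Ck k (regular_pairs \<times> UNIV) (indirect k0)"
  unfolding indirect_def[abs_def]
  by (intro Ck_divide Ck_inner Ck_power Ck_norm Ck_position_fst Ck_position_snd open_Z)
    (auto simp: position_nonzero)

lemma dR_eq:
  assumes E: "\<E> \<in> regular_pairs" and k0: "k0 > 0" and D: "Delta k0 \<E> V \<noteq> 0"
  shows "dR k0 \<mu> i \<E> V = - (\<mu> * k0\<^sup>2) *
    (dir_deriv (asteroid_dir i, 0) (\<lambda>z. Delta k0 (fst z) (snd z)) (\<E>, V) \<bullet> newton (Delta k0 \<E> V)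
      + dir_deriv (asteroid_dir i, 0) (indirect k0) (\<E>, V))"
proof -
  let ?D = "\<lambda>z. Delta k0 (fst z) (snd z)"
  let ?z = "(\<E>, V)"
  have z: "?z \<in> regular_pairs \<times> UNIV" using E by simp
  have "(?D has_derivative (\<lambda>h. dir_deriv h ?D ?z)) (at ?z)" by (rule Ck_has_derivative[OF Ck_Delta z])
  moreover have "?D ?z \<noteq> 0" using D by simp
  ultimately have 1: "((\<lambda>z. 1 / norm (?D z)) has_derivative (\<lambda>h. - (?D ?z \<bullet> dir_deriv h ?D ?z) / norm (?D ?z) ^ 3)) (at ?z)"
    using has_derivative_compose[OF _ has_derivative_inverse_norm] by blast
  have "((\<lambda>z. \<mu> * k0\<^sup>2 * (1 / norm (?D z) - indirect k0 z)) has_derivative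
      (\<lambda>h. \<mu> * k0\<^sup>2 * (- (?D ?z \<bullet> dir_deriv h ?D ?z) / norm (?D ?z) ^ 3 - dir_deriv h (indirect k0) ?z))) (at ?z)"
    by (intro has_derivative_mult_right has_derivative_diff 1 Ck_has_derivative[OF Ck_indirect[OF k0] z])
  moreover have "(\<lambda>z. \<mu> * k0\<^sup>2 * (1 / norm (?D z) - indirect k0 z)) = (\<lambda>z. perturbing_function k0 \<mu> (fst z) (snd z))"
    by (simp add: fun_eq_iff perturbing_function_def Delta_def indirect_def Let_def)
  ultimately have "dir_deriv (asteroid_dir i, 0) (\<lambda>z. perturbing_function k0 \<mu> (fst z) (snd z)) ?z =
      \<mu> * k0\<^sup>2 * (- (?D ?z \<bullet> dir_deriv (asteroid_dir i, 0) ?D ?z) / norm (?D ?z) ^ 3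
        - dir_deriv (asteroid_dir i, 0) (indirect k0) ?z)"
    by (simp add: dir_deriv_eq)
  moreover have "dR k0 \<mu> i \<E> V = dir_deriv (asteroid_dir i, 0) (\<lambda>z. perturbing_function k0 \<mu> (fst z) (snd z)) ?z"
    by (simp add: dR_def dir_deriv_slice_fst)
  ultimately show ?thesis by (simp add: newton_def inner_commute algebra_simps)
qed

lemma torus_box_eq: "torus_box = cbox 0 ((2 * pi) *\<^sub>R One)"
proof -
  have "(\<chi> i. 2 * pi) = (2 * pi) *\<^sub>R (One :: real ^ 2)"
    by (simp add: vec_eq_iff forall_2 Basis_real2 axis_1_neq_2)
  then show ?thesis by (simp add: torus_box_def)
qed

text \<open>A segment joining the two sides meets the crossing set, where the jump relation holds.\<close>

lemma lipschitz_two_sided_extension: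
  fixes av dt J Sm j :: "'a::euclidean_space \<Rightarrow> real" and N :: "'a \<times> real \<Rightarrow> real"
  assumes W: "convex W" and dt: "continuous_on W dt" "\<And>x y. x \<in> W \<Longrightarrow> y \<in> W \<Longrightarrow> \<bar>dt x - dt y\<bar> \<le> L1 * norm (x - y)"
      "\<And>x. x \<in> W \<Longrightarrow> \<bar>dt x\<bar> \<le> s0"
    and av: "\<And>x. x \<in> W \<Longrightarrow> dt x \<noteq> 0 \<Longrightarrow> av x = \<kappa> * N (x, dt x) + Sm x"
    and N: "\<And>x y s t. x \<in> W \<Longrightarrow> y \<in> W \<Longrightarrow> s * t > 0 \<Longrightarrow> \<bar>s\<bar> \<le> s0 \<Longrightarrow> \<bar>t\<bar> \<le> s0 \<Longrightarrow>
      \<bar>N (x, s) - N (y, t)\<bar> \<le> L * (norm (x - y) + \<bar>s - t\<bar>)"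
    and jump: "\<And>x. x \<in> W \<Longrightarrow> dt x = 0 \<Longrightarrow> (\<lambda>k. N (x, S k) - N (x, - S k)) \<longlonglongrightarrow> j x"
    and S: "S \<longlonglongrightarrow> 0" "\<And>k::nat. 0 < S k" "\<And>k. S k \<le> s0"
    and Jj: "\<And>x. x \<in> W \<Longrightarrow> dt x = 0 \<Longrightarrow> J x = - \<kappa> * j x"
    and J: "\<And>x y. x \<in> W \<Longrightarrow> y \<in> W \<Longrightarrow> \<bar>J x - J y\<bar> \<le> L2 * norm (x - y)"
    and Sm: "\<And>x y. x \<in> W \<Longrightarrow> y \<in> W \<Longrightarrow> \<bar>Sm x - Sm y\<bar> \<le> L3 * norm (x - y)"
    and pos: "L \<ge> 0" "L1 \<ge> 0" "L2 \<ge> 0" "L3 \<ge> 0"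
  shows "\<exists>Rplus Rminus. (\<exists>C. C-lipschitz_on W Rplus) \<and> (\<exists>C. C-lipschitz_on W Rminus) \<and>
    (\<forall>x\<in>W. dt x > 0 \<longrightarrow> Rplus x = av x) \<and> (\<forall>x\<in>W. dt x < 0 \<longrightarrow> Rminus x = av x) \<and>
    (\<forall>x\<in>W. Rminus x - Rplus x = J x)"
proof -
  \<comment> \<open>The candidate for the plus side: on the minus side the prescribed difference
    \<open>J\<close> is taken off, so that \<open>P + J\<close> is the average there. The value at
    \<open>dt x = 0\<close> is discarded later.\<close>
  define P where "P x = (if dt x > 0 then av x else av x - J x)" for x
  define M where "M = \<bar>\<kappa>\<bar> * (L * (1 + L1)) + L2 + L3"
  have M: "M \<ge> 0" using pos by (simp add: M_def)
  have same: "\<bar>N (x, dt x) - N (y, dt y)\<bar> \<le> L * (1 + L1) * norm (x - y)"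
    if "x \<in> W" "y \<in> W" "dt x * dt y > 0" for x y
  proof -
    have "\<bar>N (x, dt x) - N (y, dt y)\<bar> \<le> L * (norm (x - y) + \<bar>dt x - dt y\<bar>)"
      by (rule N) (use that dt(3) in auto)
    also have "\<dots> \<le> L * (norm (x - y) + L1 * norm (x - y))"
      using pos dt(2)[OF that(1,2)] by (intro mult_left_mono add_left_mono)
    finally show ?thesis by (simp add: algebra_simps)
  qed
  have cross: "\<bar>P x - P y\<bar> \<le> M * norm (x - y)"
    if xy: "x \<in> W" "y \<in> W" "dt x > 0" "dt y < 0" for x y
  proof -
    have seg: "closed_segment x y \<subseteq> W" using xy W by (simp add: closed_segment_subset)
    have "connected (dt ` closed_segment x y)"
      by (intro connected_continuous_image continuous_on_subset[OF dt(1)] seg) simp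
    then have "0 \<in> dt ` closed_segment x y"
      using connectedD_interval[of "dt ` closed_segment x y" "dt y" "dt x" 0] xy by auto
    then obtain z where z: "z \<in> closed_segment x y" "dt z = 0" by auto
    have zW: "z \<in> W" using z seg by auto
    \<comment> \<open>As \<open>z\<close> lies on the segment, the two partial distances add up
      exactly.\<close>
    have nz: "norm (x - z) + norm (z - y) = norm (x - y)"
      using z(1) by (metis between between_mem_segment dist_norm)
    let ?a = "N (x, dt x)" and ?b = "N (y, dt y)"
    have side: "\<bar>N (u, dt u) - N (z, t)\<bar> \<le> L * ((1 + L1) * norm (u - z) + \<bar>t\<bar>)"
      if "u \<in> W" "dt u * t > 0" "\<bar>t\<bar> \<le> s0" for u t
    proof -
      have "\<bar>N (u, dt u) - N (z, t)\<bar> \<le> L * (norm (u - z) + \<bar>dt u - t\<bar>)"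
        by (rule N) (use that dt(3) zW in auto)
      also have "\<dots> \<le> L * ((1 + L1) * norm (u - z) + \<bar>t\<bar>)"
        using dt(2)[OF that(1) zW] z(2) pos by (intro mult_left_mono) (auto simp: algebra_simps)
      finally show ?thesis .
    qed
    \<comment> \<open>The two sides of \<open>z\<close> are approached through \<open>S k\<close>
      and \<open>- S k\<close>, each with the sign of the endpoint it is compared with; the extra
      term vanishes in the limit.\<close>
    have le: "\<bar>(?a - ?b) - (N (z, S k) - N (z, - S k))\<bar> \<le> L * (1 + L1) * norm (x - y) + 2 * L * S k" for k
    proof -
      have "\<bar>?a - N (z, S k)\<bar> \<le> L * ((1 + L1) * norm (x - z) + \<bar>S k\<bar>)"
        using xy S(2)[of k] S(3)[of k] by (intro side) auto
      moreover have "\<bar>?b - N (z, - S k)\<bar> \<le> L * ((1 + L1) * norm (y - z) + \<bar>- S k\<bar>)"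
        using xy S(2)[of k] S(3)[of k] by (intro side) (auto simp: mult_neg_pos)
      moreover have "\<bar>S k\<bar> = S k" "\<bar>- S k\<bar> = S k" using S(2)[of k] by auto
      ultimately have "\<bar>?a - N (z, S k)\<bar> \<le> L * ((1 + L1) * norm (x - z) + S k)"
        "\<bar>?b - N (z, - S k)\<bar> \<le> L * ((1 + L1) * norm (y - z) + S k)" by (simp_all only:)
      then have "\<bar>(?a - ?b) - (N (z, S k) - N (z, - S k))\<bar> \<le>
          L * ((1 + L1) * norm (x - z) + S k) + L * ((1 + L1) * norm (y - z) + S k)"
        by linarith
      also have "\<dots> = L * (1 + L1) * (norm (x - z) + norm (z - y)) + 2 * L * S k"
        by (simp add: algebra_simps norm_minus_commute)
      finally show ?thesis unfolding nz .
    qed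
    have lim1: "(\<lambda>k. \<bar>(?a - ?b) - (N (z, S k) - N (z, - S k))\<bar>) \<longlonglongrightarrow> \<bar>(?a - ?b) - j z\<bar>"
      by (intro tendsto_intros jump zW z)
    have lim2: "(\<lambda>k. L * (1 + L1) * norm (x - y) + 2 * L * S k) \<longlonglongrightarrow> L * (1 + L1) * norm (x - y) + 2 * L * 0"
      by (intro tendsto_intros S)
    have "\<bar>(?a - ?b) - j z\<bar> \<le> L * (1 + L1) * norm (x - y) + 2 * L * 0"
      by (rule LIMSEQ_le[OF lim1 lim2]) (use le in blast)
    then have lim: "\<bar>(?a - ?b) - j z\<bar> \<le> L * (1 + L1) * norm (x - y)"
      by simp
    \<comment> \<open>At the crossing \<open>J z = - \<kappa> * j z\<close>, so the jump of the
      potential cancels against \<open>J\<close> up to the variation of \<open>J\<close> between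
      \<open>z\<close> and \<open>y\<close>.\<close>
    have "P x - P y = \<kappa> * ((?a - ?b) - j z) + (Sm x - Sm y) + (J y - J z)"
      using xy av Jj[OF zW z(2)] by (simp add: P_def algebra_simps)
    moreover have "\<bar>\<kappa> * ((?a - ?b) - j z)\<bar> = \<bar>\<kappa>\<bar> * \<bar>(?a - ?b) - j z\<bar>" by (rule abs_mult)
    ultimately have "\<bar>P x - P y\<bar> \<le> \<bar>\<kappa>\<bar> * \<bar>(?a - ?b) - j z\<bar> + \<bar>Sm x - Sm y\<bar> + \<bar>J y - J z\<bar>"
      by linarith
    also have "\<dots> \<le> \<bar>\<kappa>\<bar> * (L * (1 + L1) * norm (x - y)) + L3 * norm (x - y) + L2 * norm (y - z)"
      using lim Sm J xy zW by (intro add_mono mult_left_mono) auto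
    also have "\<dots> \<le> \<bar>\<kappa>\<bar> * (L * (1 + L1) * norm (x - y)) + L3 * norm (x - y) + L2 * norm (x - y)"
    proof (intro add_left_mono mult_left_mono)
      have "norm (y - z) = norm (z - y)" by (rule norm_minus_commute)
      then show "norm (y - z) \<le> norm (x - y)" using nz norm_ge_zero[of "x - z"] by linarith
    qed (use pos in simp)
    also have "\<dots> = M * norm (x - y)" by (simp add: M_def algebra_simps)
    finally show ?thesis .
  qed
  have P: "\<bar>P x - P y\<bar> \<le> M * dist x y" if xy: "x \<in> {x \<in> W. dt x \<noteq> 0}" "y \<in> {x \<in> W. dt x \<noteq> 0}" for x y
  proof -
    have W': "x \<in> W" "y \<in> W" and nz: "dt x \<noteq> 0" "dt y \<noteq> 0" using xy by auto
    consider "dt x > 0" "dt y < 0" | "dt x < 0" "dt y > 0" | "dt x * dt y > 0"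
      using nz by (metis linorder_neqE_linordered_idom mult_neg_neg mult_pos_pos)
    then show ?thesis
    proof cases
      case 1 then show ?thesis using cross[OF W'] by (simp add: dist_norm)
    next
      case 2 then show ?thesis using cross[OF W'(2,1)] by (simp add: dist_norm norm_minus_commute abs_minus_commute)
    next
      case 3
      have "\<bar>P x - P y\<bar> \<le> \<bar>\<kappa>\<bar> * \<bar>N (x, dt x) - N (y, dt y)\<bar> + \<bar>Sm x - Sm y\<bar> + \<bar>J x - J y\<bar>"
      proof -
        have "P x - P y = \<kappa> * (N (x, dt x) - N (y, dt y)) + (Sm x - Sm y) \<or>
          P x - P y = \<kappa> * (N (x, dt x) - N (y, dt y)) + (Sm x - Sm y) - (J x - J y)"
          using 3 av[OF W'(1) nz(1)] av[OF W'(2) nz(2)] by (auto simp: P_def algebra_simps zero_less_mult_iff)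
        moreover have "\<bar>\<kappa> * (N (x, dt x) - N (y, dt y))\<bar> = \<bar>\<kappa>\<bar> * \<bar>N (x, dt x) - N (y, dt y)\<bar>" by (rule abs_mult)
        ultimately show ?thesis by linarith
      qed
      also have "\<dots> \<le> \<bar>\<kappa>\<bar> * (L * (1 + L1) * norm (x - y)) + L3 * norm (x - y) + L2 * norm (x - y)"
        using same[OF W' 3] Sm[OF W'] J[OF W'] by (intro add_mono mult_left_mono) auto
      also have "\<dots> = M * norm (x - y)" by (simp add: M_def algebra_simps)
      finally show ?thesis by (simp add: dist_norm)
    qed
  qed
  \<comment> \<open>Extension from the complement of the crossing set fixes the values on the set
    itself; the minus side is then forced to be \<open>Rp + J\<close>.\<close>
  obtain Rp where Rp: "M-lipschitz_on UNIV Rp" "\<And>x. x \<in> {x \<in> W. dt x \<noteq> 0} \<Longrightarrow> Rp x = P x"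
    using lipschitz_extend_UNIV[OF M P] by blast
  have "L2-lipschitz_on W J" using J pos by (intro lipschitz_onI) (auto simp: dist_norm)
  moreover have RpW: "M-lipschitz_on W Rp" using Rp(1) by (rule lipschitz_on_subset) simp
  ultimately have "(M + L2)-lipschitz_on W (\<lambda>x. Rp x + J x)" by (intro lipschitz_on_add)
  moreover have "Rp x = av x" if "x \<in> W" "dt x > 0" for x using Rp(2)[of x] that by (simp add: P_def)
  moreover have "Rp x + J x = av x" if "x \<in> W" "dt x < 0" for x using Rp(2)[of x] that by (simp add: P_def)
  ultimately show ?thesis using RpW by (intro exI[of _ Rp] exI[of _ "\<lambda>x. Rp x + J x"]) auto
qed

subsection \<open>The minimal distance near a crossing\<close>

definition ed :: "2 \<Rightarrow> config \<times> (real ^ 2)" where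
  "ed j = (0, axis j 1)"

lemma dir_deriv_split:
  fixes g :: "config \<times> (real ^ 2) \<Rightarrow> 'b::euclidean_space"
  assumes "g differentiable (at z)"
  shows "dir_deriv (v, k) g z = dir_deriv (v, 0) g z + (k $ 1) *\<^sub>R dir_deriv (ed 1) g z + (k $ 2) *\<^sub>R dir_deriv (ed 2) g z"
proof -
  interpret bounded_linear "\<lambda>u. dir_deriv u g z"
    using has_derivative_dir_deriv[OF assms] by (rule has_derivative_bounded_linear)
  have "(k $ 1) *\<^sub>R axis 1 1 + (k $ 2) *\<^sub>R axis 2 1 = k" by (simp add: vec_eq_iff forall_2)
  then have *: "(v, k) = (v, 0) + (k $ 1) *\<^sub>R ed 1 + (k $ 2) *\<^sub>R ed 2"
    by (simp add: ed_def)
  have "dir_deriv (v, k) g z = dir_deriv ((v, 0) + (k $ 1) *\<^sub>R ed 1 + (k $ 2) *\<^sub>R ed 2) g z"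
    by (rule arg_cong[where f = "\<lambda>u. dir_deriv u g z", OF *])
  then show ?thesis by (simp only: add scaleR)
qed

lemma dir_deriv_nth:
  fixes g :: "'a::real_normed_vector \<Rightarrow> real ^ 'n"
  assumes "g differentiable (at z)"
  shows "dir_deriv v (\<lambda>z. g z $ j) z = dir_deriv v g z $ j"
  by (rule dir_deriv_eq[OF bounded_linear.has_derivative[OF bounded_linear_vec_nth has_derivative_dir_deriv[OF assms]]])

locale crossing_config =
  fixes k0 :: real and \<E>c :: config and U :: "config set" and Vh :: "config \<Rightarrow> real ^ 2"
  assumes k0: "k0 > 0"
    and nondeg: "non_degenerate k0 \<E>c" and one_crossing: "one_crossing_point k0 \<E>c"
    and cont: "local_min_continuation k0 \<E>c U Vh"
    and cross0: "kepler_dist k0 \<E>c (Vh \<E>c) = 0"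
begin

abbreviation "Z \<equiv> regular_pairs \<times> (UNIV :: (real ^ 2) set)"

text \<open>In the notation of the paper, at \<open>(\<E>, Vh \<E>)\<close> the vectors \<open>Dj 1\<close> and \<open>Dj 2\<close> are \<open>\<tau>\<close> and \<open>- \<tau>'\<close>. Hence
  \<open>no0\<close> below is \<open>- \<tau>\<^sub>3\<close>, while \<open>nh\<close> is the normalisation of \<open>\<tau>\<^sub>3\<close> itself, and \<open>dt\<close> is the signed distance.\<close>

definition Dl where "Dl z = Delta k0 (fst z) (snd z)"
definition Dj where "Dj j = dir_deriv (ed j) Dl"
definition d2 where "d2 z = (kepler_dist k0 (fst z) (snd z))\<^sup>2"
definition Hess where "Hess i j = dir_deriv (ed i) (dir_deriv (ed j) d2)"
definition hdet where "hdet z = Hess 1 1 z * Hess 2 2 z - Hess 1 2 z * Hess 2 1 z"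
definition grad where "grad z = (\<chi> j. dir_deriv (ed j) d2 z)"

lemma openU: "open U" and EcU: "\<E>c \<in> U" and U_reg: "U \<subseteq> regular_pairs" and contV: "continuous_on U Vh"
  using cont by (auto simp: local_min_continuation_def)

lemma inZ: "\<E> \<in> U \<Longrightarrow> (\<E>, V) \<in> Z"
  using U_reg by auto

lemma Ck_Dl: "Ck k Z Dl"
  using Ck_Delta by (simp add: Dl_def[abs_def])

lemma Ck_Dj: "Ck k Z (Dj j)"
  unfolding Dj_def by (rule Ck_dir_deriv[OF Ck_Dl])

lemma d2_eq: "d2 = (\<lambda>z. Dl z \<bullet> Dl z)"
  by (simp add: d2_def Dl_def kepler_dist_def power2_norm_eq_inner fun_eq_iff)

lemma Ck_d2: "Ck k Z d2"
  unfolding d2_eq by (intro Ck_inner open_Z Ck_Dl)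

lemma dir_deriv_d2: "z \<in> Z \<Longrightarrow> dir_deriv (ed j) d2 z = 2 * (Dl z \<bullet> Dj j z)"
  unfolding d2_eq
  by (subst dir_deriv_inner[OF Ck_imp_differentiable[OF Ck_Dl] Ck_imp_differentiable[OF Ck_Dl]])
    (simp_all add: Dj_def inner_commute)

lemma Ck_Hess: "Ck k Z (Hess i j)"
  unfolding Hess_def by (intro Ck_dir_deriv Ck_d2)

lemma Ck_hdet: "Ck k Z hdet"
  unfolding hdet_def[abs_def] by (intro Ck_diff Ck_mult Ck_Hess open_Z)

lemma Ck_grad: "Ck k Z grad"
proof (rule Ck_vec[OF open_Z])
  show "Ck k Z (\<lambda>z. grad z $ i)" for i
    unfolding grad_def vec_lambda_beta by (intro Ck_dir_deriv Ck_d2)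
qed

lemma Hess_eq:
  assumes "z \<in> Z"
  shows "Hess i j z = 2 * (Dj i z \<bullet> Dj j z + Dl z \<bullet> dir_deriv (ed i) (Dj j) z)"
proof -
  have "Hess i j z = dir_deriv (ed i) (\<lambda>z. 2 * (Dl z \<bullet> Dj j z)) z"
    unfolding Hess_def by (rule dir_deriv_cong_open[OF open_Z assms dir_deriv_d2])
  also have "\<dots> = 2 * dir_deriv (ed i) (\<lambda>z. Dl z \<bullet> Dj j z) z"
  proof (rule dir_deriv_eq)
    have "Ck (Suc 0) Z (\<lambda>z. Dl z \<bullet> Dj j z)" by (intro Ck_inner open_Z Ck_Dl Ck_Dj)
    then show "((\<lambda>z. 2 * (Dl z \<bullet> Dj j z)) has_derivative (\<lambda>v. 2 * dir_deriv v (\<lambda>z. Dl z \<bullet> Dj j z) z)) (at z)"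
      using assms by (intro has_derivative_mult_right Ck_has_derivative)
  qed
  also have "dir_deriv (ed i) (\<lambda>z. Dl z \<bullet> Dj j z) z = Dj i z \<bullet> Dj j z + Dl z \<bullet> dir_deriv (ed i) (Dj j) z"
    by (subst dir_deriv_inner[OF Ck_imp_differentiable[OF Ck_Dl assms] Ck_imp_differentiable[OF Ck_Dj assms]])
      (simp add: Dj_def)
  finally show ?thesis .
qed

lemma hessian_V_eq: "hessian_V (\<lambda>V. (kepler_dist k0 \<E> V)\<^sup>2) V $ i $ j = Hess i j (\<E>, V)"
proof -
  have "dir_deriv (axis j 1) (\<lambda>V. (kepler_dist k0 \<E> V)\<^sup>2) = (\<lambda>V. dir_deriv (ed j) d2 (\<E>, V))"
    by (simp add: ed_def dir_deriv_slice d2_def)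
  then show ?thesis
    by (simp add: hessian_V_def Hess_def ed_def dir_deriv_slice)
qed

lemma det_A_h: "det (A_h k0 Vh \<E>) = hdet (\<E>, Vh \<E>) / 4"
  by (simp add: A_h_def det_2 hessian_V_eq hdet_def)

lemma critical:
  assumes "\<E> \<in> U"
  shows "dir_deriv (ed j) d2 (\<E>, Vh \<E>) = 0"
proof -
  let ?f = "\<lambda>V. d2 (\<E>, V)"
  have "Ck (Suc 0) {V. (\<E>, V) \<in> Z} ?f" by (intro Ck_slice Ck_d2 open_Z)
  then have "(?f has_derivative (\<lambda>h. dir_deriv h ?f (Vh \<E>))) (at (Vh \<E>))"
    using assms inZ by (intro Ck_has_derivative) auto
  moreover have "\<forall>\<^sub>F V in nhds (Vh \<E>). ?f (Vh \<E>) \<le> ?f V"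
    using cont assms by (simp add: local_min_continuation_def d2_def)
  then have "\<forall>\<^sub>F V in at (Vh \<E>). ?f (Vh \<E>) \<le> ?f V"
    unfolding eventually_at_filter by (rule eventually_mono) simp
  ultimately have "(\<lambda>h. dir_deriv h ?f (Vh \<E>)) = (\<lambda>h. 0)" by (rule has_derivative_local_min)
  then show ?thesis unfolding ed_def dir_deriv_slice by (rule fun_cong)
qed

lemma Dl_orthogonal: "\<E> \<in> U \<Longrightarrow> Dl (\<E>, Vh \<E>) \<bullet> Dj j (\<E>, Vh \<E>) = 0"
  using critical[of \<E> j] dir_deriv_d2[where j = j, OF inZ[where V = "Vh \<E>"]] by simp

definition no0 where "no0 \<E> = cross3 (Dj 1 (\<E>, Vh \<E>)) (Dj 2 (\<E>, Vh \<E>))"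

text \<open>Positivity of the determinant makes the root of \<open>det (A_h k0 Vh \<E>)\<close>
  smooth, and \<open>no0 \<E> \<noteq> 0\<close> does the same for the unit normal.\<close>

definition U1 where "U1 = {\<E> \<in> U. hdet (\<E>, Vh \<E>) > 0 \<and> no0 \<E> \<noteq> 0}"

text \<open>At a zero of \<open>Dl\<close> the second derivatives of the distance vector drop out of
  \<open>Hess\<close>, which becomes twice the Gram matrix of the tangent vectors; Lagrange's
  identity does the rest.\<close>

lemma hdet_crossing:
  assumes z: "z \<in> Z" and 0: "Dl z = 0"
  shows "hdet z = 4 * (norm (cross3 (Dj 1 z) (Dj 2 z)))\<^sup>2"
proof -
  have "hdet z = 4 * ((Dj 1 z \<bullet> Dj 1 z) * (Dj 2 z \<bullet> Dj 2 z) - (Dj 1 z \<bullet> Dj 2 z)\<^sup>2)"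
    unfolding hdet_def Hess_eq[OF z] 0 by (simp add: power2_eq_square inner_commute algebra_simps)
  also have "(Dj 1 z \<bullet> Dj 1 z) * (Dj 2 z \<bullet> Dj 2 z) - (Dj 1 z \<bullet> Dj 2 z)\<^sup>2 = (norm (cross3 (Dj 1 z) (Dj 2 z)))\<^sup>2"
    using norm_cross_dot[of "Dj 1 z" "Dj 2 z"] by (simp add: power_mult_distrib power2_norm_eq_inner)
  finally show ?thesis .
qed

lemma Dl_crossing: "Dl (\<E>c, Vh \<E>c) = 0"
  using cross0 by (simp add: Dl_def kepler_dist_def)

text \<open>By the preceding identity, non-degeneracy at the crossing amounts to transversality of
  the two orbits, and the determinant is then positive.\<close>

lemma EcU1: "\<E>c \<in> U1"
proof -
  have crit: "\<forall>i. dir_deriv (axis i 1) (\<lambda>V. (kepler_dist k0 \<E>c V)\<^sup>2) (Vh \<E>c) = 0"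
    using critical[OF EcU] by (simp add: ed_def dir_deriv_slice d2_def)
  then have "det (hessian_V (\<lambda>V. (kepler_dist k0 \<E>c V)\<^sup>2) (Vh \<E>c)) \<noteq> 0"
    using nondeg unfolding non_degenerate_def by blast
  then have "hdet (\<E>c, Vh \<E>c) \<noteq> 0" by (simp add: det_2 hessian_V_eq hdet_def)
  then show ?thesis
    using EcU hdet_crossing[OF inZ[OF EcU] Dl_crossing] by (simp add: U1_def no0_def)
qed

lemma cont_graph: "continuous_on U (\<lambda>\<E>. (\<E>, Vh \<E>))"
  by (intro continuous_intros contV)

lemma openU1: "open U1"
proof -
  have c: "continuous_on U (\<lambda>\<E>. g (\<E>, Vh \<E>))" if "continuous_on Z g" for g :: "_ \<Rightarrow> 'x::topological_space"
    by (rule continuous_on_compose2[OF that cont_graph]) (use inZ in auto)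
  have c1: "continuous_on U (\<lambda>\<E>. hdet (\<E>, Vh \<E>))" by (rule c[OF Ck_continuous_on[OF Ck_hdet]])
  have c2: "continuous_on U no0"
    unfolding no0_def[abs_def]
    by (rule c[OF Ck_continuous_on[OF Ck_cross3[OF open_Z Ck_Dj Ck_Dj]]])
  have "open (U \<inter> (\<lambda>\<E>. hdet (\<E>, Vh \<E>)) -` {0<..})" "open (U \<inter> no0 -` (- {0}))"
    by (rule continuous_open_preimage[OF c1 openU], simp, rule continuous_open_preimage[OF c2 openU], simp add: open_Compl)
  then have "open ((U \<inter> (\<lambda>\<E>. hdet (\<E>, Vh \<E>)) -` {0<..}) \<inter> (U \<inter> no0 -` (- {0})))" by (rule open_Int)
  also have "(U \<inter> (\<lambda>\<E>. hdet (\<E>, Vh \<E>)) -` {0<..}) \<inter> (U \<inter> no0 -` (- {0})) = U1"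
    by (auto simp: U1_def)
  finally show ?thesis .
qed

lemma U1_D: "\<E> \<in> U1 \<Longrightarrow> \<E> \<in> U" "\<E> \<in> U1 \<Longrightarrow> hdet (\<E>, Vh \<E>) > 0" "\<E> \<in> U1 \<Longrightarrow> no0 \<E> \<noteq> 0"
  by (auto simp: U1_def)

text \<open>The inverse of the Hessian, by Cramer's rule.\<close>

definition solve :: "config \<times> (real ^ 2) \<Rightarrow> real ^ 2 \<Rightarrow> real ^ 2" where
  "solve z y = vector [(Hess 2 2 z * y $ 1 - Hess 2 1 z * y $ 2) / hdet z,
    (Hess 1 1 z * y $ 2 - Hess 1 2 z * y $ 1) / hdet z]"

lemma bounded_linear_solve: "bounded_linear (solve z)"
proof -
  have "linear (solve z)"
    by (rule linearI) (simp_all add: solve_def vec_eq_iff forall_2 algebra_simps diff_divide_distrib add_divide_distrib)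
  then show ?thesis by (simp add: linear_conv_bounded_linear)
qed

lemma solve_grad:
  assumes "z \<in> Z" "hdet z \<noteq> 0"
  shows "solve z (dir_deriv (0, k) grad z) = k"
proof -
  have "dir_deriv (0, k) grad z = dir_deriv (0, 0) grad z + (k $ 1) *\<^sub>R dir_deriv (ed 1) grad z + (k $ 2) *\<^sub>R dir_deriv (ed 2) grad z"
    by (rule dir_deriv_split[OF Ck_imp_differentiable[OF Ck_grad assms(1)]])
  moreover have "dir_deriv (0, 0) grad z = 0" by (simp add: dir_deriv_def zero_prod_def[symmetric])
  moreover have "dir_deriv (ed i) grad z $ j = Hess i j z" for i j
    using dir_deriv_nth[OF Ck_imp_differentiable[OF Ck_grad assms(1)], of "ed i" j]
    by (simp add: grad_def Hess_def)
  ultimately have "dir_deriv (0, k) grad z $ j = k $ 1 * Hess 1 j z + k $ 2 * Hess 2 j z" for j by simp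
  then have "solve z (dir_deriv (0, k) grad z) = vector [(k $ 1 * hdet z) / hdet z, (k $ 2 * hdet z) / hdet z]"
    by (simp add: solve_def hdet_def algebra_simps)
  also have "\<dots> = k" using assms(2) by (simp add: vec_eq_iff forall_2)
  finally show ?thesis .
qed

text \<open>Implicit differentiation of \<open>grad (\<E>, Vh \<E>) = 0\<close>, starting from mere
  continuity of \<open>Vh\<close>.\<close>

lemma Vh_has_derivative:
  assumes "\<E> \<in> U1"
  shows "(Vh has_derivative (\<lambda>h. - solve (\<E>, Vh \<E>) (dir_deriv (h, 0) grad (\<E>, Vh \<E>)))) (at \<E>)"
proof (rule has_derivative_implicit[where f = grad and f' = "\<lambda>v. dir_deriv v grad (\<E>, Vh \<E>)"])
  have EU: "\<E> \<in> U" using assms by (rule U1_D)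
  show "(grad has_derivative (\<lambda>v. dir_deriv v grad (\<E>, Vh \<E>))) (at (\<E>, Vh \<E>))"
    by (rule Ck_has_derivative[OF Ck_grad inZ[OF EU]])
  show "isCont Vh \<E>" using contV openU EU by (simp add: continuous_on_eq_continuous_at)
  have "\<forall>\<^sub>F x in nhds \<E>. x \<in> U" using openU EU by (rule eventually_nhds_in_open)
  then show "\<forall>\<^sub>F x in nhds \<E>. grad (x, Vh x) = 0"
    by eventually_elim (simp add: grad_def vec_eq_iff critical)
  show "bounded_linear (solve (\<E>, Vh \<E>))" by (rule bounded_linear_solve)
  show "solve (\<E>, Vh \<E>) (dir_deriv (0, k) grad (\<E>, Vh \<E>)) = k" for k
    using U1_D[OF assms] by (intro solve_grad inZ) auto
qed

text \<open>The formula for the derivative contains \<open>Vh\<close> only inside functions smooth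
  on \<open>Z\<close>, so each order of regularity of \<open>Vh\<close> produces the next.\<close>

lemma Ck_Vh: "Ck k U1 Vh"
proof (induction k)
  case 0
  show ?case using contV by (auto intro: continuous_on_subset simp: U1_def)
next
  case (Suc k)
  have g: "Ck k U1 (\<lambda>\<E>. F (\<E>, Vh \<E>))" if "Ck k Z F" for F :: "config \<times> (real ^ 2) \<Rightarrow> 'b::euclidean_space"
    by (rule Ck_compose[OF openU1 open_Z that])
      (auto intro!: Ck_Pair Ck_ident openU1 Suc dest: U1_D(1)[THEN inZ])
  show ?case
  proof (rule Ck_SucI[OF openU1 Vh_has_derivative])
    fix v
    have gv: "Ck k Z (\<lambda>z. dir_deriv (v, 0) grad z $ i)" for i by (intro Ck_nth open_Z Ck_dir_deriv Ck_grad)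
    have comp: "Ck k U1 (\<lambda>\<E>. (Hess i j (\<E>, Vh \<E>) * dir_deriv (v, 0) grad (\<E>, Vh \<E>) $ i' -
        Hess i'' j' (\<E>, Vh \<E>) * dir_deriv (v, 0) grad (\<E>, Vh \<E>) $ j'') / hdet (\<E>, Vh \<E>))" for i j i' i'' j' j''
      using U1_D(2)
      by (intro Ck_divide Ck_diff Ck_mult openU1 g[OF Ck_Hess] g[OF gv] g[OF Ck_hdet]) (auto simp: less_imp_neq[symmetric])
    show "Ck k U1 (\<lambda>\<E>. - solve (\<E>, Vh \<E>) (dir_deriv (v, 0) grad (\<E>, Vh \<E>)))"
    proof (intro Ck_minus openU1 Ck_vec[OF openU1])
      fix i :: 2
      show "Ck k U1 (\<lambda>\<E>. solve (\<E>, Vh \<E>) (dir_deriv (v, 0) grad (\<E>, Vh \<E>)) $ i)"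
        using exhaust_2[of i] comp[of 2 2 1 2 1 2] comp[of 1 1 2 1 2 1] by (auto simp: solve_def)
    qed
  qed
qed

lemma Ck_graph: "Ck k Z F \<Longrightarrow> Ck k U1 (\<lambda>\<E>. F (\<E>, Vh \<E>))"
  by (rule Ck_compose[OF openU1 open_Z])
    (auto intro!: Ck_Pair Ck_ident openU1 Ck_Vh dest: U1_D(1)[THEN inZ])

section \<open>Tangent vectors, the unit normal and the signed distance\<close>

lemma position_vector_derivative:
  assumes "E \<in> regular_elements"
  shows "(position k0 E has_vector_derivative vector_derivative (position k0 E) (at l)) (at l)"
proof -
  have "open (regular_elements \<times> (UNIV :: real set))" by (intro open_Times open_regular_elements open_UNIV)
  from Ck_slice[OF this Ck_position, of "Suc 0" E k0]
  have "Ck (Suc 0) UNIV (position k0 E)" using assms by simp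
  then have "position k0 E differentiable (at l)" by (rule Ck_imp_differentiable) simp
  then show ?thesis by (simp add: vector_derivative_works)
qed

lemma Dj_eq:
  assumes "\<E> \<in> regular_pairs"
  shows "Dj 1 (\<E>, V) = vector_derivative (position k0 (fst \<E>)) (at (V $ 1))"
    and "Dj 2 (\<E>, V) = - vector_derivative (position k0 (snd \<E>)) (at (V $ 2))"
proof -
  have E: "fst \<E> \<in> regular_elements" "snd \<E> \<in> regular_elements" using assms by auto
  have shift: "((\<lambda>t. position k0 E (l + t)) has_vector_derivative vector_derivative (position k0 E) (at l)) (at 0)"
    if "E \<in> regular_elements" for E l
  proof -
    have "((\<lambda>t. l + t) has_vector_derivative 1) (at 0)" by (auto intro!: derivative_eq_intros)
    from vector_diff_chain_at[OF this, of "position k0 E"] show ?thesis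
      using position_vector_derivative[OF that, of l] by (simp add: o_def)
  qed
  have "((\<lambda>t. position k0 (fst \<E>) (V $ 1 + t) - position k0 (snd \<E>) (V $ 2)) has_vector_derivative
      vector_derivative (position k0 (fst \<E>)) (at (V $ 1))) (at 0)"
    using has_vector_derivative_diff[OF shift[OF E(1)] has_vector_derivative_const] by simp
  then show "Dj 1 (\<E>, V) = vector_derivative (position k0 (fst \<E>)) (at (V $ 1))"
    unfolding Dj_def dir_deriv_def Dl_def Delta_def ed_def by (simp add: vector_derivative_at)
  have "((\<lambda>t. position k0 (fst \<E>) (V $ 1) - position k0 (snd \<E>) (V $ 2 + t)) has_vector_derivative
      - vector_derivative (position k0 (snd \<E>)) (at (V $ 2))) (at 0)"
    using has_vector_derivative_diff[OF has_vector_derivative_const shift[OF E(2)]] by simp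
  then show "Dj 2 (\<E>, V) = - vector_derivative (position k0 (snd \<E>)) (at (V $ 2))"
    unfolding Dj_def dir_deriv_def Dl_def Delta_def ed_def by (simp add: vector_derivative_at)
qed

lemma tau3_eq: "\<E> \<in> U \<Longrightarrow> tau3 k0 Vh \<E> = - no0 \<E>"
  using U_reg Dj_eq[of \<E> "Vh \<E>"] by (auto simp: tau3_def no0_def)

definition nh where "nh \<E> = sgn (tau3 k0 Vh \<E>)"
abbreviation dt where "dt \<equiv> signed_dist k0 Vh"

lemma Ck_no0: "Ck k U1 no0"
  unfolding no0_def[abs_def] by (intro Ck_cross3 openU1 Ck_graph Ck_Dj)

lemma nh_eq: "\<E> \<in> U1 \<Longrightarrow> nh \<E> = - (inverse (norm (no0 \<E>)) *\<^sub>R no0 \<E>)"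
  using tau3_eq[OF U1_D(1)] by (simp add: nh_def sgn_div_norm)

lemma Ck_nh: "Ck k U1 nh"
proof -
  have "Ck k U1 (\<lambda>\<E>. - (inverse (norm (no0 \<E>)) *\<^sub>R no0 \<E>))"
    using U1_D(3) by (intro Ck_minus Ck_scaleR Ck_inverse Ck_norm Ck_no0 openU1) auto
  then show ?thesis by (rule Ck_cong[OF openU1, rotated]) (simp add: nh_eq)
qed

lemma norm_nh: "\<E> \<in> U1 \<Longrightarrow> norm (nh \<E>) = 1"
  using tau3_eq U1_D by (simp add: nh_def norm_sgn)

lemma nh_Dj: "\<E> \<in> U1 \<Longrightarrow> nh \<E> \<bullet> Dj j (\<E>, Vh \<E>) = 0"
  using exhaust_2[of j] by (auto simp: nh_eq no0_def dot_cross_self)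

text \<open>Also valid at distance 0, where both sides are 0. This form shows that the signed
  distance is smooth across the crossing set, although the distance is not.\<close>

lemma dt_eq: "dt \<E> = nh \<E> \<bullet> Dl (\<E>, Vh \<E>)"
proof -
  let ?D = "Delta k0 \<E> (Vh \<E>)"
  have "norm ?D *\<^sub>R sgn ?D = ?D" by (cases "?D = 0") (auto simp: sgn_div_norm)
  then have "nh \<E> \<bullet> ?D = nh \<E> \<bullet> (norm ?D *\<^sub>R sgn ?D)" by simp
  then show ?thesis by (simp add: signed_dist_def nh_def Dl_def kepler_dist_def)
qed

lemma Ck_dt: "Ck k U1 dt"
proof -
  have "Ck k U1 (\<lambda>\<E>. nh \<E> \<bullet> Dl (\<E>, Vh \<E>))"
    by (intro Ck_inner openU1 Ck_nh Ck_graph Ck_Dl)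
  then show ?thesis by (simp add: dt_eq[abs_def])
qed

text \<open>At a critical point of the squared distance the connecting vector is orthogonal to both
  tangents, hence parallel to \<open>nh \<E>\<close>.\<close>

lemma Dl_h: 
  assumes "\<E> \<in> U1"
  shows "Dl (\<E>, Vh \<E>) = dt \<E> *\<^sub>R nh \<E>"
proof -
  let ?a = "Dj 1 (\<E>, Vh \<E>)" and ?b = "Dj 2 (\<E>, Vh \<E>)" and ?n = "no0 \<E>" and ?w = "Dl (\<E>, Vh \<E>)"
  have w: "?w \<bullet> ?a = 0" "?w \<bullet> ?b = 0" using Dl_orthogonal[OF U1_D(1)[OF assms]] by auto
  have "?w \<bullet> cross3 ?b ?n = 0" "?w \<bullet> cross3 ?n ?a = 0"
    using w by (simp_all add: no0_def Lagrange cross_skew[of "cross3 ?a ?b" ?a] inner_diff_right)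
  then have "(?n \<bullet> ?n) *\<^sub>R ?w = (?w \<bullet> ?n) *\<^sub>R ?n"
    using cross3_expansion[of ?a ?b ?n ?w] by (simp add: no0_def)
  moreover have n: "?n = - (norm ?n *\<^sub>R nh \<E>)" using U1_D(3)[OF assms] by (simp add: nh_eq[OF assms])
  ultimately have *: "(norm ?n)\<^sup>2 *\<^sub>R ?w = (norm ?n)\<^sup>2 *\<^sub>R (dt \<E> *\<^sub>R nh \<E>)"
  proof -
    assume 1: "(?n \<bullet> ?n) *\<^sub>R ?w = (?w \<bullet> ?n) *\<^sub>R ?n"
    have "(?w \<bullet> ?n) *\<^sub>R ?n = (?w \<bullet> (- (norm ?n *\<^sub>R nh \<E>))) *\<^sub>R (- (norm ?n *\<^sub>R nh \<E>))"
      using n by metis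
    also have "\<dots> = (norm ?n)\<^sup>2 *\<^sub>R (dt \<E> *\<^sub>R nh \<E>)"
      by (simp add: dt_eq power2_eq_square inner_commute mult_ac)
    finally show ?thesis using 1 by (simp add: power2_norm_eq_inner)
  qed
  have "(norm ?n)\<^sup>2 \<noteq> 0" using U1_D(3)[OF assms] by simp
  then show ?thesis using * by (rule scaleR_left_imp_eq)
qed

text \<open>Two terms of the product and chain rules disappear: the motion of \<open>Vh\<close>
  contributes tangent vectors, which are orthogonal to \<open>nh\<close>, and the derivative of the
  unit vector \<open>nh\<close> is orthogonal to \<open>nh\<close>, to which the connecting vector
  is parallel.\<close>

lemma dt_has_derivative:
  assumes "\<E> \<in> U1"
  shows "(dt has_derivative (\<lambda>v. nh \<E> \<bullet> dir_deriv (v, 0) Dl (\<E>, Vh \<E>))) (at \<E>)"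
proof -
  let ?z = "(\<E>, Vh \<E>)"
  have z: "?z \<in> Z" using inZ[OF U1_D(1)[OF assms]] .
  have V': "(Vh has_derivative (\<lambda>v. dir_deriv v Vh \<E>)) (at \<E>)"
    by (rule Ck_has_derivative[OF Ck_Vh assms])
  have "((\<lambda>\<E>. (\<E>, Vh \<E>)) has_derivative (\<lambda>v. (v, dir_deriv v Vh \<E>))) (at \<E>)"
    by (intro has_derivative_Pair has_derivative_ident V')
  from has_derivative_compose[OF this Ck_has_derivative[OF Ck_Dl z]]
  have D': "((\<lambda>\<E>. Dl (\<E>, Vh \<E>)) has_derivative (\<lambda>v. dir_deriv (v, dir_deriv v Vh \<E>) Dl ?z)) (at \<E>)" .
  have n': "(nh has_derivative (\<lambda>v. dir_deriv v nh \<E>)) (at \<E>)"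
    by (rule Ck_has_derivative[OF Ck_nh assms])
  have nn: "dir_deriv v nh \<E> \<bullet> nh \<E> = 0" for v
  proof -
    have "dir_deriv v (\<lambda>\<E>. nh \<E> \<bullet> nh \<E>) \<E> = dir_deriv v (\<lambda>\<E>. 1) \<E>"
      by (rule dir_deriv_cong_open[OF openU1 assms]) (use norm_nh in \<open>simp add: norm_eq_1\<close>)
    also have "\<dots> = 0" by (simp add: dir_deriv_def)
    finally show ?thesis
      using dir_deriv_inner[OF Ck_imp_differentiable[OF Ck_nh assms] Ck_imp_differentiable[OF Ck_nh assms], of v]
      by (simp add: inner_commute)
  qed
  have "((\<lambda>\<E>. nh \<E> \<bullet> Dl (\<E>, Vh \<E>)) has_derivative
      (\<lambda>v. nh \<E> \<bullet> dir_deriv (v, dir_deriv v Vh \<E>) Dl ?z + dir_deriv v nh \<E> \<bullet> Dl ?z)) (at \<E>)"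
    by (rule has_derivative_inner[OF n' D'])
  moreover have "nh \<E> \<bullet> dir_deriv (v, dir_deriv v Vh \<E>) Dl ?z + dir_deriv v nh \<E> \<bullet> Dl ?z =
      nh \<E> \<bullet> dir_deriv (v, 0) Dl ?z" for v
  proof -
    have "dir_deriv v nh \<E> \<bullet> Dl ?z = 0" unfolding Dl_h[OF assms] by (simp add: nn)
    then show ?thesis
      using nh_Dj[OF assms, unfolded Dj_def]
      by (subst dir_deriv_split[OF Ck_imp_differentiable[OF Ck_Dl z]]) (simp add: inner_add_right)
  qed
  ultimately show ?thesis by (simp add: dt_eq[abs_def])
qed

end

lemma integral_lipschitz_param:
  fixes f :: "'a::euclidean_space \<times> 'c::euclidean_space \<Rightarrow> real"
  assumes f: "Ck (Suc 0) Q f" and K: "compact K" "convex K" and Q: "K \<times> cbox p q \<subseteq> Q"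
  shows "\<exists>L\<ge>0. \<forall>x\<in>K. \<forall>y\<in>K.
    \<bar>integral (cbox p q) (\<lambda>v. f (x, v)) - integral (cbox p q) (\<lambda>v. f (y, v))\<bar> \<le> L * norm (x - y)"
proof -
  obtain L where L: "L \<ge> 0"
    "\<And>v x y. v \<in> cbox p q \<Longrightarrow> x \<in> K \<Longrightarrow> y \<in> K \<Longrightarrow> norm (f (x, v) - f (y, v)) \<le> L * norm (x - y)"
    using Ck_lipschitz_fst[OF f K compact_cbox Q] by blast
  have int: "(\<lambda>v. f (x, v)) integrable_on cbox p q" if "x \<in> K" for x
    by (intro integrable_continuous continuous_on_compose2[OF Ck_continuous_on[OF f]] continuous_intros)
      (use that Q in auto)
  have "\<bar>integral (cbox p q) (\<lambda>v. f (x, v)) - integral (cbox p q) (\<lambda>v. f (y, v))\<bar>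
      \<le> (L * measure lborel (cbox p q)) * norm (x - y)" if xy: "x \<in> K" "y \<in> K" for x y
  proof -
    have "integral (cbox p q) (\<lambda>v. f (x, v)) - integral (cbox p q) (\<lambda>v. f (y, v)) =
        integral (cbox p q) (\<lambda>v. f (x, v) - f (y, v))"
      by (rule integral_diff[symmetric]) (intro int xy)+
    moreover have "norm (integral (cbox p q) (\<lambda>v. f (x, v) - f (y, v))) \<le> (L * norm (x - y)) * measure lborel (cbox p q)"
      by (rule integrable_bound) (use L xy in \<open>auto intro!: integrable_diff int\<close>)
    ultimately show ?thesis by (simp add: mult_ac)
  qed
  then show ?thesis using L(1) by (intro exI[of _ "L * measure lborel (cbox p q)"]) auto
qed

section \<open>Anomalies modulo the periods\<close>

lemma One_nth [simp]: "(One :: real ^ 2) $ i = 1"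
  using exhaust_2[of i] by (auto simp: Basis_real2 axis_1_neq_2)

lemma sum_Basis_nth [simp]: "(\<Sum>b\<in>(Basis :: (real ^ 2) set). b $ i) = 1"
  using One_nth[of i] by (simp del: One_nth)

lemma position_periodic_int:
  assumes "E \<in> regular_elements"
  shows "position k0 E (l + 2 * pi * of_int n) = position k0 E l"
proof (induction n rule: int_induct[of _ 0])
  case (step1 n)
  then show ?case using position_periodic[OF assms, of k0 "l + 2 * pi * of_int n"] by (simp add: algebra_simps)
next
  case (step2 n)
  then show ?case using position_periodic[OF assms, of k0 "l + 2 * pi * of_int (n - 1)"] by (simp add: algebra_simps)
qed simp

lemma reduce_angle: "\<exists>n. a \<le> l + 2 * pi * of_int n \<and> l + 2 * pi * of_int n < a + 2 * pi" for a l :: real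
proof -
  define n where "n = \<lfloor>(l - a) / (2 * pi)\<rfloor>"
  have "of_int n \<le> (l - a) / (2 * pi)" "(l - a) / (2 * pi) < of_int n + 1"
    unfolding n_def by linarith+
  then have "of_int n * (2 * pi) \<le> l - a" "l - a < (of_int n + 1) * (2 * pi)"
    using pi_gt_zero by (simp_all add: pos_le_divide_eq pos_divide_less_eq)
  then have "a \<le> l + 2 * pi * of_int (- n) \<and> l + 2 * pi * of_int (- n) < a + 2 * pi"
    by (simp add: algebra_simps)
  then show ?thesis by blast
qed

text \<open>The period multiples are returned as well, since uniqueness of the crossing point has to
  be transported between two period boxes.\<close>

lemma reduce_Delta:
  assumes "\<E> \<in> regular_pairs"
  shows "\<exists>V' n. (\<forall>i. c $ i \<le> V' $ i \<and> V' $ i < c $ i + 2 * pi) \<and> Delta k0 \<E> V' = Delta k0 \<E> V \<and>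
    (\<forall>i. V' $ i = V $ i + 2 * pi * of_int (n i))"
proof -
  have E: "fst \<E> \<in> regular_elements" "snd \<E> \<in> regular_elements" using assms by auto
  have "\<forall>i. \<exists>n. c $ i \<le> V $ i + 2 * pi * of_int n \<and> V $ i + 2 * pi * of_int n < c $ i + 2 * pi"
    using reduce_angle by blast
  then obtain n where n: "\<And>i. c $ i \<le> V $ i + 2 * pi * of_int (n i) \<and> V $ i + 2 * pi * of_int (n i) < c $ i + 2 * pi"
    by metis
  have "Delta k0 \<E> (\<chi> i. V $ i + 2 * pi * of_int (n i)) = Delta k0 \<E> V"
    by (simp add: Delta_def position_periodic_int[OF E(1)] position_periodic_int[OF E(2)])
  then show ?thesis
    by (intro exI[of _ "\<chi> i. V $ i + 2 * pi * of_int (n i)"] exI[of _ n]) (use n in auto)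
qed

context crossing_config
begin

abbreviation Vc where "Vc \<equiv> Vh \<E>c"
text \<open>With \<open>qb\<close>, a period box centred at the crossing point, so that small balls
  around that point do not meet its boundary.\<close>

definition pb where "pb = Vc - pi *\<^sub>R One"
definition qb where "qb = Vc + pi *\<^sub>R One"

lemma qb_eq: "qb = pb + (2 * pi) *\<^sub>R One"
  by (simp add: pb_def qb_def vec_eq_iff)

lemma box_iff: "V \<in> cbox pb qb \<longleftrightarrow> (\<forall>i. \<bar>V $ i - Vc $ i\<bar> \<le> pi)"
  by (auto simp: mem_box_cart pb_def qb_def abs_le_iff) (smt (verit))+

lemma cball_box: "r \<le> pi \<Longrightarrow> cball Vc r \<subseteq> cbox pb qb"
proof
  fix V assume r: "r \<le> pi" "V \<in> cball Vc r"
  have "\<bar>V $ i - Vc $ i\<bar> \<le> pi" for i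
    using component_le_norm_cart[of "V - Vc" i] r by (simp add: dist_norm norm_minus_commute)
  then show "V \<in> cbox pb qb" by (simp add: box_iff)
qed

text \<open>A zero \<open>V\<close> and \<open>Vc\<close> both reduce to the one zero in the
  standard box, so they differ by multiples of the periods. Their coordinates differ by at most
  \<open>pi\<close>, which leaves only the multiple 0, even on the closed box.\<close>

lemma Dl_Ec_nonzero:
  assumes "V \<in> cbox pb qb" "V \<noteq> Vc"
  shows "Dl (\<E>c, V) \<noteq> 0"
proof
  assume 0: "Dl (\<E>c, V) = 0"
  have reg: "\<E>c \<in> regular_pairs" using EcU U_reg by blast
  obtain V1 n1 where V1: "\<forall>i. (0 :: real ^ 2) $ i \<le> V1 $ i \<and> V1 $ i < (0 :: real ^ 2) $ i + 2 * pi"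
      "Delta k0 \<E>c V1 = Delta k0 \<E>c V" "\<forall>i. V1 $ i = V $ i + 2 * pi * of_int (n1 i)"
    using reduce_Delta[OF reg, of 0 k0 V] by blast
  obtain V2 n2 where V2: "\<forall>i. (0 :: real ^ 2) $ i \<le> V2 $ i \<and> V2 $ i < (0 :: real ^ 2) $ i + 2 * pi"
      "Delta k0 \<E>c V2 = Delta k0 \<E>c Vc" "\<forall>i. V2 $ i = Vc $ i + 2 * pi * of_int (n2 i)"
    using reduce_Delta[OF reg, of 0 k0 Vc] by blast
  have "V1 = V2"
    using one_crossing V1(1,2) V2(1,2) 0 Dl_crossing unfolding one_crossing_point_def kepler_dist_def Dl_def
    by (metis (no_types, lifting) add_0 fst_conv norm_zero snd_conv zero_index)
  have "V $ i = Vc $ i" for i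
  proof -
    have "V $ i - Vc $ i = 2 * pi * of_int (n2 i - n1 i)"
      using V1(3)[rule_format, of i] V2(3)[rule_format, of i] \<open>V1 = V2\<close> by (simp add: algebra_simps)
    moreover have "\<bar>V $ i - Vc $ i\<bar> \<le> pi" using assms(1) by (simp add: box_iff)
    ultimately have "2 * pi * \<bar>of_int (n2 i - n1 i) :: real\<bar> \<le> pi * 1" by (simp add: abs_mult)
    then have "2 * \<bar>of_int (n2 i - n1 i) :: real\<bar> \<le> 1" using pi_gt_zero by (simp only: mult.assoc mult.left_commute[of 2 pi] mult_le_cancel_left_pos)
    then have "real_of_int (2 * \<bar>n2 i - n1 i\<bar>) \<le> real_of_int 1" by simp
    then have "2 * \<bar>n2 i - n1 i\<bar> \<le> 1" by (simp only: of_int_le_iff)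
    then have "n2 i - n1 i = 0" by arith
    then show ?thesis using \<open>V $ i - Vc $ i = 2 * pi * of_int (n2 i - n1 i)\<close> by simp
  qed
  then show False using assms(2) by (simp add: vec_eq_iff)
qed

section \<open>Quantitative bounds near the crossing point\<close>

lemma Dl_slice_derivative:
  assumes "\<E> \<in> U"
  shows "((\<lambda>V. Dl (\<E>, V)) has_derivative (\<lambda>h. (h $ 1) *\<^sub>R Dj 1 (\<E>, V) + (h $ 2) *\<^sub>R Dj 2 (\<E>, V))) (at V)"
proof -
  have z: "(\<E>, V) \<in> Z" by (rule inZ[OF assms])
  have "((\<lambda>V. (\<E>, V)) has_derivative (\<lambda>h. (0, h))) (at V)" by (auto intro!: derivative_eq_intros)
  from has_derivative_compose[OF this Ck_has_derivative[OF Ck_Dl z]]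
  have "((\<lambda>V. Dl (\<E>, V)) has_derivative (\<lambda>h. dir_deriv (0, h) Dl (\<E>, V))) (at V)" .
  moreover have "dir_deriv (0, h) Dl (\<E>, V) = (h $ 1) *\<^sub>R Dj 1 (\<E>, V) + (h $ 2) *\<^sub>R Dj 2 (\<E>, V)" for h
  proof -
    have "dir_deriv (0, h) Dl (\<E>, V) = dir_deriv (0, 0) Dl (\<E>, V) + (h $ 1) *\<^sub>R dir_deriv (ed 1) Dl (\<E>, V) + (h $ 2) *\<^sub>R dir_deriv (ed 2) Dl (\<E>, V)"
      by (rule dir_deriv_split[OF Ck_imp_differentiable[OF Ck_Dl z]])
    moreover have "dir_deriv (0, 0) Dl (\<E>, V) = 0" by (simp add: dir_deriv_def zero_prod_def[symmetric])
    ultimately show ?thesis by (simp add: Dj_def)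
  qed
  ultimately show ?thesis by simp
qed

text \<open>Mean value estimate for \<open>Dl\<close> minus a fixed linear map. It is used with
  \<open>a\<close>, \<open>b\<close> frozen at the crossing, where the error is a small multiple of
  \<open>norm (V - V')\<close>, and frozen at \<open>V\<close> itself, where it is quadratic. The
  factor 2 counts the two coordinates.\<close>

lemma first_order_remainder:
  assumes E: "\<E> \<in> U" and S: "convex S" "V \<in> S" "V' \<in> S" and e: "e \<ge> 0"
    and close: "\<And>X. X \<in> S \<Longrightarrow> norm (Dj 1 (\<E>, X) - a) \<le> e" "\<And>X. X \<in> S \<Longrightarrow> norm (Dj 2 (\<E>, X) - b) \<le> e"
  shows "norm (Dl (\<E>, V) - Dl (\<E>, V') - (((V - V') $ 1) *\<^sub>R a + ((V - V') $ 2) *\<^sub>R b)) \<le> 2 * e * norm (V - V')"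
proof -
  let ?L = "\<lambda>X :: real ^ 2. (X $ 1) *\<^sub>R a + (X $ 2) *\<^sub>R b"
  let ?g = "\<lambda>X. Dl (\<E>, X) - ?L X"
  have L: "bounded_linear ?L"
    by (intro bounded_linear_add bounded_linear_scaleR_left[THEN bounded_linear_compose] bounded_linear_vec_nth)
  have "norm (?g V - ?g V') \<le> (2 * e) * norm (V - V')"
  proof (rule differentiable_bound[OF S(1) _ _ S(2,3),
        of ?g "\<lambda>X h. ((h $ 1) *\<^sub>R Dj 1 (\<E>, X) + (h $ 2) *\<^sub>R Dj 2 (\<E>, X)) - ?L h"])
    fix X assume X: "X \<in> S"
    have "(?g has_derivative (\<lambda>h. ((h $ 1) *\<^sub>R Dj 1 (\<E>, X) + (h $ 2) *\<^sub>R Dj 2 (\<E>, X)) - ?L h)) (at X)"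
      by (intro has_derivative_diff Dl_slice_derivative E bounded_linear_imp_has_derivative L)
    then show "(?g has_derivative (\<lambda>h. ((h $ 1) *\<^sub>R Dj 1 (\<E>, X) + (h $ 2) *\<^sub>R Dj 2 (\<E>, X)) - ?L h)) (at X within S)"
      by (rule has_derivative_at_withinI)
    show "onorm (\<lambda>h. ((h $ 1) *\<^sub>R Dj 1 (\<E>, X) + (h $ 2) *\<^sub>R Dj 2 (\<E>, X)) - ?L h) \<le> 2 * e"
    proof (rule onorm_le)
      fix h :: "real ^ 2"
      have "((h $ 1) *\<^sub>R Dj 1 (\<E>, X) + (h $ 2) *\<^sub>R Dj 2 (\<E>, X)) - ?L h =
          (h $ 1) *\<^sub>R (Dj 1 (\<E>, X) - a) + (h $ 2) *\<^sub>R (Dj 2 (\<E>, X) - b)"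
        by (simp add: algebra_simps)
      then have "norm (((h $ 1) *\<^sub>R Dj 1 (\<E>, X) + (h $ 2) *\<^sub>R Dj 2 (\<E>, X)) - ?L h) \<le>
          \<bar>h $ 1\<bar> * norm (Dj 1 (\<E>, X) - a) + \<bar>h $ 2\<bar> * norm (Dj 2 (\<E>, X) - b)"
        using norm_triangle_ineq[of "(h $ 1) *\<^sub>R (Dj 1 (\<E>, X) - a)" "(h $ 2) *\<^sub>R (Dj 2 (\<E>, X) - b)"] by simp
      also have "\<dots> \<le> norm h * e + norm h * e"
        using close[OF X] e by (intro add_mono mult_mono component_le_norm_cart) auto
      finally show "norm (((h $ 1) *\<^sub>R Dj 1 (\<E>, X) + (h $ 2) *\<^sub>R Dj 2 (\<E>, X)) - ?L h) \<le> 2 * e * norm h"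
        by (simp add: algebra_simps)
    qed
  qed
  then show ?thesis by (simp add: algebra_simps)
qed

text \<open>The tangential map is injective by transversality, hence bounded below;
  \<open>nh \<E>c\<close> is a unit vector orthogonal to its range, so Pythagoras combines the two
  bounds.\<close>

lemma frame_lower_bound:
  obtains m1 where "m1 > 0"
    "\<And>s (v :: real ^ 2). m1 * sqrt (s\<^sup>2 + (norm v)\<^sup>2) \<le> norm (s *\<^sub>R nh \<E>c + ((v $ 1) *\<^sub>R Dj 1 (\<E>c, Vc) + (v $ 2) *\<^sub>R Dj 2 (\<E>c, Vc)))"
proof -
  let ?a = "Dj 1 (\<E>c, Vc)" and ?b = "Dj 2 (\<E>c, Vc)"
  let ?L = "\<lambda>v :: real ^ 2. (v $ 1) *\<^sub>R ?a + (v $ 2) *\<^sub>R ?b"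
  have n0: "cross3 ?a ?b \<noteq> 0" using U1_D(3)[OF EcU1] by (simp add: no0_def)
  have lin: "linear ?L" by (rule linearI) (simp_all add: algebra_simps)
  have "inj ?L"
  proof (subst linear_injective_0[OF lin], intro allI impI)
    fix v assume v: "?L v = 0"
    have "cross3 (?L v) ?b = (v $ 1) *\<^sub>R cross3 ?a ?b" "cross3 ?a (?L v) = (v $ 2) *\<^sub>R cross3 ?a ?b"
      by (simp_all add: cross_add_left cross_add_right cross_mult_left cross_mult_right)
    then have "(v $ 1) *\<^sub>R cross3 ?a ?b = 0" "(v $ 2) *\<^sub>R cross3 ?a ?b = 0" unfolding v by simp_all
    then have "v $ 1 = 0" "v $ 2 = 0" using n0 by simp_all
    then show "v = 0" by (simp add: vec_eq_iff forall_2)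
  qed
  from linear_inj_bounded_below_pos[OF lin this]
  obtain B where B: "B > 0" "\<And>v. B * norm v \<le> norm (?L v)" by blast
  define m1 where "m1 = min 1 B"
  have m1: "0 < m1" "m1 \<le> 1" "m1 \<le> B" using B by (auto simp: m1_def)
  have "m1 * sqrt (s\<^sup>2 + (norm v)\<^sup>2) \<le> norm (s *\<^sub>R nh \<E>c + ?L v)" for s v
  proof (rule power2_le_imp_le)
    have "nh \<E>c \<bullet> ?L v = 0" using nh_Dj[OF EcU1] by (simp add: inner_add_right)
    then have eq: "(norm (s *\<^sub>R nh \<E>c + ?L v))\<^sup>2 = s\<^sup>2 + (norm (?L v))\<^sup>2"
      using norm_nh[OF EcU1] norm_add_Pythagorean[of "s *\<^sub>R nh \<E>c" "?L v"] by (simp add: orthogonal_def)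
    have "m1\<^sup>2 \<le> 1" using m1 by (simp add: power_le_one)
    then have "m1\<^sup>2 * s\<^sup>2 \<le> 1 * s\<^sup>2" by (intro mult_right_mono) auto
    moreover have "(m1 * norm v)\<^sup>2 \<le> (norm (?L v))\<^sup>2"
      using m1 B(2)[of v] mult_right_mono[OF m1(3), of "norm v"] by (intro power_mono) auto
    ultimately show "(m1 * sqrt (s\<^sup>2 + (norm v)\<^sup>2))\<^sup>2 \<le> (norm (s *\<^sub>R nh \<E>c + ?L v))\<^sup>2"
      unfolding eq by (simp add: power_mult_distrib algebra_simps)
  qed simp
  with m1(1) show ?thesis by (rule that)
qed

lemma local_nbhd:
  assumes "e > 0"
  obtains A r where "open A" "\<E>c \<in> A" "A \<subseteq> U1" "0 < r" "r \<le> pi"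
    "\<And>\<E> V. \<E> \<in> A \<Longrightarrow> V \<in> ball Vc r \<Longrightarrow> norm (Dj 1 (\<E>, V) - Dj 1 (\<E>c, Vc)) \<le> e \<and>
      norm (Dj 2 (\<E>, V) - Dj 2 (\<E>c, Vc)) \<le> e \<and> norm (nh \<E> - nh \<E>c) \<le> e \<and> cross3 (Dj 1 (\<E>, V)) (Dj 2 (\<E>, V)) \<noteq> 0"
proof -
  let ?Z1 = "U1 \<times> (UNIV :: (real ^ 2) set)"
  have o: "open ?Z1" by (intro open_Times openU1 open_UNIV)
  have sub: "?Z1 \<subseteq> Z" using U1_D(1) U_reg by auto
  have c: "continuous_on ?Z1 (Dj j)" for j by (rule continuous_on_subset[OF Ck_continuous_on[OF Ck_Dj] sub])
  have c3: "continuous_on ?Z1 (\<lambda>z. nh (fst z))"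
    by (rule continuous_on_compose2[OF Ck_continuous_on[OF Ck_nh]]) (auto intro!: continuous_intros)
  have c4: "continuous_on ?Z1 (\<lambda>z. cross3 (Dj 1 z) (Dj 2 z))"
    by (rule continuous_on_subset[OF Ck_continuous_on[OF Ck_cross3[OF open_Z Ck_Dj Ck_Dj]] sub])
  let ?S = "(?Z1 \<inter> Dj 1 -` ball (Dj 1 (\<E>c, Vc)) e) \<inter> (?Z1 \<inter> Dj 2 -` ball (Dj 2 (\<E>c, Vc)) e) \<inter>
    (?Z1 \<inter> (\<lambda>z. nh (fst z)) -` ball (nh \<E>c) e) \<inter> (?Z1 \<inter> (\<lambda>z. cross3 (Dj 1 z) (Dj 2 z)) -` (- {0}))"
  have "open ?S"
    by (intro open_Int continuous_open_preimage o c c3 c4 open_ball) auto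
  moreover have "(\<E>c, Vc) \<in> ?S" using assms EcU1 U1_D(3)[OF EcU1] by (simp add: no0_def)
  ultimately obtain A B where AB': "open A" "open B" "(\<E>c, Vc) \<in> A \<times> B" "A \<times> B \<subseteq> ?S"
    by (rule open_prod_elim)
  then have AB: "open A" "open B" "\<E>c \<in> A" "Vc \<in> B" by simp_all
  obtain r where r: "r > 0" "ball Vc r \<subseteq> B" using AB(2,4) by (rule openE)
  have inS: "(\<E>, V) \<in> ?S" if "\<E> \<in> A" "V \<in> ball Vc (min r pi)" for \<E> V
  proof -
    have "V \<in> B" using that(2) r(2) by auto
    then have "(\<E>, V) \<in> A \<times> B" using that(1) by simp
    then show ?thesis using AB'(4) by (rule subsetD[rotated])
  qed
  show ?thesis
  proof (rule that[OF AB(1,3)])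
    show "A \<subseteq> U1" using inS[of _ Vc] r(1) by auto
    show "0 < min r pi" "min r pi \<le> pi" using r by auto
    show "norm (Dj 1 (\<E>, V) - Dj 1 (\<E>c, Vc)) \<le> e \<and>
      norm (Dj 2 (\<E>, V) - Dj 2 (\<E>c, Vc)) \<le> e \<and> norm (nh \<E> - nh \<E>c) \<le> e \<and> cross3 (Dj 1 (\<E>, V)) (Dj 2 (\<E>, V)) \<noteq> 0"
      if "\<E> \<in> A" "V \<in> ball Vc (min r pi)" for \<E> V
      using inS[OF that] by (auto simp: dist_norm norm_minus_commute)
  qed
qed

lemma local_lower_bound:
  obtains A r m where "open A" "\<E>c \<in> A" "A \<subseteq> U1" "0 < r" "r \<le> pi" "m > 0"
    "\<And>\<E> V. \<E> \<in> A \<Longrightarrow> V \<in> ball Vc r \<Longrightarrow> cross3 (Dj 1 (\<E>, V)) (Dj 2 (\<E>, V)) \<noteq> 0"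
    "\<And>\<E> V s. \<E> \<in> A \<Longrightarrow> V \<in> ball Vc r \<Longrightarrow> Vh \<E> \<in> ball Vc r \<Longrightarrow>
      m * sqrt (s\<^sup>2 + (norm (V - Vh \<E>))\<^sup>2) \<le> norm (Dl (\<E>, V) + (s - dt \<E>) *\<^sub>R nh \<E>)"
proof -
  obtain m1 where m1: "m1 > 0"
    "\<And>s (v :: real ^ 2). m1 * sqrt (s\<^sup>2 + (norm v)\<^sup>2) \<le> norm (s *\<^sub>R nh \<E>c + ((v $ 1) *\<^sub>R Dj 1 (\<E>c, Vc) + (v $ 2) *\<^sub>R Dj 2 (\<E>c, Vc)))"
    using frame_lower_bound by blast
  \<comment> \<open>With the tolerance \<open>m1 / 8\<close> the errors below add up to at most
    \<open>3 * m1 / 8\<close> times the root: two shares from the tangents and one from the normal.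
    More than half of \<open>m1\<close> survives.\<close>
  obtain A r where A: "open A" "\<E>c \<in> A" "A \<subseteq> U1" "0 < r" "r \<le> pi"
    and close: "\<And>\<E> V. \<E> \<in> A \<Longrightarrow> V \<in> ball Vc r \<Longrightarrow> norm (Dj 1 (\<E>, V) - Dj 1 (\<E>c, Vc)) \<le> m1 / 8 \<and>
      norm (Dj 2 (\<E>, V) - Dj 2 (\<E>c, Vc)) \<le> m1 / 8 \<and> norm (nh \<E> - nh \<E>c) \<le> m1 / 8 \<and> cross3 (Dj 1 (\<E>, V)) (Dj 2 (\<E>, V)) \<noteq> 0"
    using local_nbhd[of "m1 / 8"] m1(1) by auto
  show ?thesis
  proof (rule that[OF A, of "m1 / 2"])
    show "m1 / 2 > 0" using m1 by simp
    show "cross3 (Dj 1 (\<E>, V)) (Dj 2 (\<E>, V)) \<noteq> 0" if "\<E> \<in> A" "V \<in> ball Vc r" for \<E> V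
      using close[OF that] by blast
    fix \<E> V s assume E: "\<E> \<in> A" and V: "V \<in> ball Vc r" "Vh \<E> \<in> ball Vc r"
    have EU1: "\<E> \<in> U1" using E A by blast
    let ?v = "V - Vh \<E>"
    let ?L = "(?v $ 1) *\<^sub>R Dj 1 (\<E>c, Vc) + (?v $ 2) *\<^sub>R Dj 2 (\<E>c, Vc)"
    let ?R = "Dl (\<E>, V) - Dl (\<E>, Vh \<E>) - ?L"
    let ?rho = "sqrt (s\<^sup>2 + (norm ?v)\<^sup>2)"
    have R: "norm ?R \<le> 2 * (m1 / 8) * norm ?v"
      by (rule first_order_remainder[OF U1_D(1)[OF EU1] convex_ball V]) (use close[OF E] m1 in auto)
    have eq: "s *\<^sub>R nh \<E>c + ?L = (Dl (\<E>, V) + (s - dt \<E>) *\<^sub>R nh \<E>) - ?R - s *\<^sub>R (nh \<E> - nh \<E>c)"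
      by (subst Dl_h[OF EU1]) (simp add: algebra_simps)
    have "m1 * ?rho \<le> norm (s *\<^sub>R nh \<E>c + ?L)" by (rule m1(2))
    also have "\<dots> \<le> norm (Dl (\<E>, V) + (s - dt \<E>) *\<^sub>R nh \<E>) + norm ?R + norm (s *\<^sub>R (nh \<E> - nh \<E>c))"
      unfolding eq by (meson norm_triangle_ineq4 add_right_mono order_trans)
    also have "norm (s *\<^sub>R (nh \<E> - nh \<E>c)) \<le> ?rho * (m1 / 8)"
      using close[OF E V(1)] m1 by (simp only: norm_scaleR) (intro mult_mono, auto)
    also have "norm ?R \<le> 2 * (m1 / 8) * ?rho"
    proof -
      have "norm ?v \<le> ?rho" by simp
      then have "2 * (m1 / 8) * norm ?v \<le> 2 * (m1 / 8) * ?rho" using m1 by (intro mult_left_mono) auto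
      then show ?thesis using R by linarith
    qed
    finally have "m1 * ?rho \<le> norm (Dl (\<E>, V) + (s - dt \<E>) *\<^sub>R nh \<E>) + 2 * (m1 / 8) * ?rho + ?rho * (m1 / 8)"
      by simp
    moreover have "?rho \<ge> 0" by simp
    then have "m1 * ?rho \<ge> 0" using m1 by simp
    ultimately show "m1 / 2 * ?rho \<le> norm (Dl (\<E>, V) + (s - dt \<E>) *\<^sub>R nh \<E>)" by (simp add: algebra_simps)
  qed
qed

text \<open>The normal at \<open>V\<close> is orthogonal to the tangent vectors at \<open>V\<close>,
  so the expansion is taken there rather than at \<open>Vh \<E>\<close>. What the normal still sees
  is \<open>s *\<^sub>R nh \<E>\<close> and a remainder that is quadratic because \<open>Dj\<close>
  is Lipschitz.\<close>

lemma local_normal_bound: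
  assumes K: "compact K" "convex K" "K \<subseteq> U1" and Vh: "\<And>\<E>. \<E> \<in> K \<Longrightarrow> Vh \<E> \<in> cball Vc r"
  obtains cn where "cn \<ge> 0" "\<And>\<E> V s. \<E> \<in> K \<Longrightarrow> V \<in> cball Vc r \<Longrightarrow>
    \<bar>cross3 (Dj 1 (\<E>, V)) (Dj 2 (\<E>, V)) \<bullet> (Dl (\<E>, V) + (s - dt \<E>) *\<^sub>R nh \<E>)\<bar> \<le> cn * (\<bar>s\<bar> + (norm (V - Vh \<E>))\<^sup>2)"
proof -
  let ?T = "K \<times> cball Vc r"
  have T: "compact ?T" "convex ?T" "?T \<subseteq> Z"
    using K U1_D(1) U_reg by (auto intro!: compact_Times convex_Times)
  have lip: "\<exists>L\<ge>0. \<forall>x\<in>?T. \<forall>y\<in>?T. norm (Dj j x - Dj j y) \<le> L * norm (x - y)" for j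
    using Ck_lipschitz[OF Ck_Dj[of "Suc 0" j] T] by metis
  obtain L1 where L1: "L1 \<ge> 0" "\<forall>x\<in>?T. \<forall>y\<in>?T. norm (Dj 1 x - Dj 1 y) \<le> L1 * norm (x - y)" using lip by blast
  obtain L2 where L2: "L2 \<ge> 0" "\<forall>x\<in>?T. \<forall>y\<in>?T. norm (Dj 2 x - Dj 2 y) \<le> L2 * norm (x - y)" using lip by blast
  define L where "L = max L1 L2"
  have L: "L \<ge> 0" "L1 \<le> L" "L2 \<le> L" using L1 by (auto simp: L_def)
  have "compact ((\<lambda>z. cross3 (Dj 1 z) (Dj 2 z)) ` ?T)"
    by (intro compact_continuous_image T
        continuous_on_subset[OF Ck_continuous_on[OF Ck_cross3[OF open_Z Ck_Dj Ck_Dj]] T(3)])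
  then obtain Nm' where Nm': "\<forall>x\<in>(\<lambda>z. cross3 (Dj 1 z) (Dj 2 z)) ` ?T. norm x \<le> Nm'"
    using compact_imp_bounded bounded_iff by blast
  define Nm where "Nm = \<bar>Nm'\<bar>"
  have Nm: "Nm \<ge> 0" "\<And>z. z \<in> ?T \<Longrightarrow> norm (cross3 (Dj 1 z) (Dj 2 z)) \<le> Nm"
    using Nm' by (auto simp: Nm_def) force
  define cn where "cn = Nm * (1 + 2 * L)"
  have "\<bar>cross3 (Dj 1 (\<E>, V)) (Dj 2 (\<E>, V)) \<bullet> (Dl (\<E>, V) + (s - dt \<E>) *\<^sub>R nh \<E>)\<bar> \<le> cn * (\<bar>s\<bar> + (norm (V - Vh \<E>))\<^sup>2)"
    if E: "\<E> \<in> K" and V: "V \<in> cball Vc r" for \<E> V s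
  proof -
    have EU1: "\<E> \<in> U1" using E K by blast
    let ?n = "cross3 (Dj 1 (\<E>, V)) (Dj 2 (\<E>, V))"
    let ?v = "V - Vh \<E>"
    let ?L = "(?v $ 1) *\<^sub>R Dj 1 (\<E>, V) + (?v $ 2) *\<^sub>R Dj 2 (\<E>, V)"
    let ?R = "Dl (\<E>, V) - Dl (\<E>, Vh \<E>) - ?L"
    have segV: "closed_segment V (Vh \<E>) \<subseteq> cball Vc r"
      using V Vh[OF E] by (intro closed_segment_subset) auto
    have close: "norm (Dj j (\<E>, X) - Dj j (\<E>, V)) \<le> L * norm ?v"
      if X: "X \<in> closed_segment V (Vh \<E>)" and j: "j = 1 \<or> j = 2" for X j
    proof -
      let ?d = "norm ((\<E>, X) - (\<E>, V))"
      have inT: "(\<E>, X) \<in> ?T" "(\<E>, V) \<in> ?T" using E V X segV by auto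
      have "norm (Dj 1 (\<E>, X) - Dj 1 (\<E>, V)) \<le> L1 * ?d" "norm (Dj 2 (\<E>, X) - Dj 2 (\<E>, V)) \<le> L2 * ?d"
        by (rule L1(2)[rule_format, OF inT], rule L2(2)[rule_format, OF inT])
      moreover have "L1 * ?d \<le> L * ?d" "L2 * ?d \<le> L * ?d"
        by (intro mult_right_mono L norm_ge_zero)+
      ultimately have "norm (Dj 1 (\<E>, X) - Dj 1 (\<E>, V)) \<le> L * ?d" "norm (Dj 2 (\<E>, X) - Dj 2 (\<E>, V)) \<le> L * ?d"
        by linarith+
      with j have "norm (Dj j (\<E>, X) - Dj j (\<E>, V)) \<le> L * ?d" by (elim disjE) simp_all
      also have "\<dots> = L * norm (X - V)" by (simp add: norm_Pair)
      also have "\<dots> \<le> L * norm ?v"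
        using L segment_bound(1)[OF X] by (intro mult_left_mono) (auto simp: norm_minus_commute)
      finally show ?thesis .
    qed
    have R: "norm ?R \<le> 2 * (L * norm ?v) * norm ?v"
      by (rule first_order_remainder[OF U1_D(1)[OF EU1] convex_closed_segment[of V "Vh \<E>"]])
        (use L close in auto)
    have eq: "Dl (\<E>, V) + (s - dt \<E>) *\<^sub>R nh \<E> = s *\<^sub>R nh \<E> + ?R + ?L"
      by (subst Dl_h[OF EU1]) (simp add: algebra_simps)
    have "?n \<bullet> ?L = 0" by (simp add: inner_add_right dot_cross_self)
    then have "?n \<bullet> (Dl (\<E>, V) + (s - dt \<E>) *\<^sub>R nh \<E>) = ?n \<bullet> (s *\<^sub>R nh \<E> + ?R)"
      unfolding eq by (simp only: inner_add_right[of ?n "s *\<^sub>R nh \<E> + ?R"])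
    then have "\<bar>?n \<bullet> (Dl (\<E>, V) + (s - dt \<E>) *\<^sub>R nh \<E>)\<bar> \<le> norm ?n * norm (s *\<^sub>R nh \<E> + ?R)"
      using Cauchy_Schwarz_ineq2[of ?n "s *\<^sub>R nh \<E> + ?R"] by simp
    also have "\<dots> \<le> Nm * (\<bar>s\<bar> + 2 * (L * norm ?v) * norm ?v)"
    proof (intro mult_mono)
      show "norm ?n \<le> Nm" using Nm(2)[of "(\<E>, V)"] E V by simp
      have "norm (s *\<^sub>R nh \<E> + ?R) \<le> norm (s *\<^sub>R nh \<E>) + norm ?R" by (rule norm_triangle_ineq)
      then show "norm (s *\<^sub>R nh \<E> + ?R) \<le> \<bar>s\<bar> + 2 * (L * norm ?v) * norm ?v"
        using R norm_nh[OF EU1] by simp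
    qed (use Nm in auto)
    also have "\<dots> \<le> Nm * ((1 + 2 * L) * (\<bar>s\<bar> + (norm ?v)\<^sup>2))"
      using Nm L by (intro mult_left_mono) (auto simp: algebra_simps power2_eq_square)
    finally show ?thesis by (simp add: cn_def mult.assoc)
  qed
  moreover have "cn \<ge> 0" using Nm L by (simp add: cn_def)
  ultimately show ?thesis using that by blast
qed

end

subsection \<open>The one-sided extensions\<close>

text \<open>Three radii around \<open>Vc\<close>: the layer is immersed within \<open>r\<close>,
  densities live within \<open>r / 2\<close>, and \<open>r / 4\<close> captures every
  \<open>Vh \<E>\<close>. Beyond the last one \<open>Dl\<close> has no zero in the period box, so
  the integrand is regular there. \<open>s0\<close> bounds the shifts as well as the signed
  distances.\<close>

locale crossing_setup = crossing_config +
  fixes A0 :: "config set" and \<rho> r m cn s0 :: real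
  assumes A0: "open A0" "A0 \<subseteq> U1" "cball \<E>c \<rho> \<subseteq> A0" and \<rho>: "\<rho> > 0"
    and r: "0 < r" "r \<le> pi" and m: "m > 0" and cn: "cn \<ge> 0" and s0: "s0 > 0"
    and indep: "\<And>\<E> V. \<E> \<in> A0 \<Longrightarrow> V \<in> ball Vc r \<Longrightarrow> cross3 (Dj 1 (\<E>, V)) (Dj 2 (\<E>, V)) \<noteq> 0"
    and lower: "\<And>\<E> V s. \<E> \<in> cball \<E>c \<rho> \<Longrightarrow> V \<in> cball Vc (r / 2) \<Longrightarrow>
      m * sqrt (s\<^sup>2 + (norm (V - Vh \<E>))\<^sup>2) \<le> norm (Dl (\<E>, V) + (s - dt \<E>) *\<^sub>R nh \<E>)"
    and normal: "\<And>\<E> V s. \<E> \<in> cball \<E>c \<rho> \<Longrightarrow> V \<in> cball Vc (r / 2) \<Longrightarrow>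
      \<bar>cross3 (Dj 1 (\<E>, V)) (Dj 2 (\<E>, V)) \<bullet> (Dl (\<E>, V) + (s - dt \<E>) *\<^sub>R nh \<E>)\<bar> \<le> cn * (\<bar>s\<bar> + (norm (V - Vh \<E>))\<^sup>2)"
    and away: "\<And>\<E> V. \<E> \<in> cball \<E>c \<rho> \<Longrightarrow> V \<in> cbox pb qb \<Longrightarrow> V \<notin> ball Vc (r / 4) \<Longrightarrow> Dl (\<E>, V) \<noteq> 0"
    and Vh_near: "\<And>\<E>. \<E> \<in> cball \<E>c \<rho> \<Longrightarrow> Vh \<E> \<in> ball Vc (r / 4)"
    and dt_bound: "\<And>\<E>. \<E> \<in> cball \<E>c \<rho> \<Longrightarrow> \<bar>dt \<E>\<bar> \<le> s0"

context crossing_config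
begin

lemma crossing_setup_exists: "\<exists>A0 \<rho> r m cn s0. crossing_setup k0 \<E>c U Vh A0 \<rho> r m cn s0"
proof -
  obtain A r m where A: "open A" "\<E>c \<in> A" "A \<subseteq> U1" and r: "0 < r" "r \<le> pi" and m: "m > 0"
    and indep: "\<And>\<E> V. \<E> \<in> A \<Longrightarrow> V \<in> ball Vc r \<Longrightarrow> cross3 (Dj 1 (\<E>, V)) (Dj 2 (\<E>, V)) \<noteq> 0"
    and lower: "\<And>\<E> V s. \<E> \<in> A \<Longrightarrow> V \<in> ball Vc r \<Longrightarrow> Vh \<E> \<in> ball Vc r \<Longrightarrow>
      m * sqrt (s\<^sup>2 + (norm (V - Vh \<E>))\<^sup>2) \<le> norm (Dl (\<E>, V) + (s - dt \<E>) *\<^sub>R nh \<E>)"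
    using local_lower_bound by blast
  let ?T = "cbox pb qb - ball Vc (r / 4)"
  let ?Q = "Z \<inter> Dl -` (- {0})"
  have "compact ?T" by (intro compact_diff compact_cbox open_ball)
  moreover have "open ?Q" by (rule continuous_open_preimage[OF Ck_continuous_on[OF Ck_Dl] open_Z]) auto
  moreover have "{\<E>c} \<times> ?T \<subseteq> ?Q"
  proof
    fix z assume "z \<in> {\<E>c} \<times> ?T"
    then obtain V where z: "z = (\<E>c, V)" "V \<in> cbox pb qb" "V \<notin> ball Vc (r / 4)" by blast
    have "V \<noteq> Vc" using z(3) r by auto
    then show "z \<in> ?Q" using Dl_Ec_nonzero[OF z(2)] inZ[OF EcU, of V] z(1) by blast
  qed
  \<comment> \<open>Compactness of the box without the small ball carries the absence of zeros from
    \<open>\<E>c\<close> to nearby configurations.\<close>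
  ultimately obtain X0 where X0: "\<E>c \<in> X0" "open X0" "X0 \<times> ?T \<subseteq> ?Q"
    using Elementary_Topology.tube_lemma[of ?T ?Q \<E>c] by blast
  let ?A' = "U1 \<inter> Vh -` ball Vc (r / 4)"
  have "open ?A'" by (rule continuous_open_preimage[OF Ck_continuous_on[OF Ck_Vh] openU1 open_ball])
  then have "open (A \<inter> X0 \<inter> ?A')" using A X0 by auto
  moreover have "\<E>c \<in> A \<inter> X0 \<inter> ?A'" using A X0 EcU1 r by auto
  ultimately obtain \<rho> where \<rho>: "\<rho> > 0" "cball \<E>c \<rho> \<subseteq> A \<inter> X0 \<inter> ?A'"
    by (meson open_contains_cball)
  have KU1: "cball \<E>c \<rho> \<subseteq> U1" using \<rho> by auto
  have Vn: "Vh \<E> \<in> ball Vc (r / 4)" if "\<E> \<in> cball \<E>c \<rho>" for \<E> using \<rho>(2) that by blast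
  have "Vh \<E> \<in> cball Vc (r / 2)" if "\<E> \<in> cball \<E>c \<rho>" for \<E> using Vn[OF that] r by auto
  from local_normal_bound[OF compact_cball convex_cball KU1 this]
  obtain cn where cn: "cn \<ge> 0" "\<And>\<E> V s. \<E> \<in> cball \<E>c \<rho> \<Longrightarrow> V \<in> cball Vc (r / 2) \<Longrightarrow>
    \<bar>cross3 (Dj 1 (\<E>, V)) (Dj 2 (\<E>, V)) \<bullet> (Dl (\<E>, V) + (s - dt \<E>) *\<^sub>R nh \<E>)\<bar> \<le> cn * (\<bar>s\<bar> + (norm (V - Vh \<E>))\<^sup>2)"
    by blast
  have "compact (dt ` cball \<E>c \<rho>)"
    by (intro compact_continuous_image compact_cball continuous_on_subset[OF Ck_continuous_on[OF Ck_dt] KU1])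
  then obtain s1 where s1: "\<forall>x\<in>dt ` cball \<E>c \<rho>. norm x \<le> s1" using compact_imp_bounded bounded_iff by blast
  have "crossing_setup k0 \<E>c U Vh A \<rho> r m cn (\<bar>s1\<bar> + 1)"
  proof (intro crossing_setup.intro crossing_config_axioms crossing_setup_axioms.intro)
    show "cball \<E>c \<rho> \<subseteq> A" using \<rho>(2) by auto
    fix \<E> assume E: "\<E> \<in> cball \<E>c \<rho>"
    then have EA: "\<E> \<in> A" "\<E> \<in> X0" using \<rho>(2) by auto
    show "Vh \<E> \<in> ball Vc (r / 4)" by (rule Vn[OF E])
    have "norm (dt \<E>) \<le> s1" using s1 E by blast
    then show "\<bar>dt \<E>\<bar> \<le> \<bar>s1\<bar> + 1" by simp
    fix V
    show "Dl (\<E>, V) \<noteq> 0" if "V \<in> cbox pb qb" "V \<notin> ball Vc (r / 4)"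
    proof -
      have "(\<E>, V) \<in> X0 \<times> ?T" using EA(2) that by simp
      then have "(\<E>, V) \<in> ?Q" using X0(3) by (rule subsetD[rotated])
      then show ?thesis by simp
    qed
    fix s assume V: "V \<in> cball Vc (r / 2)"
    show "m * sqrt (s\<^sup>2 + (norm (V - Vh \<E>))\<^sup>2) \<le> norm (Dl (\<E>, V) + (s - dt \<E>) *\<^sub>R nh \<E>)"
      by (rule lower[OF EA(1)]) (use V Vn[OF E] r in auto)
    show "\<bar>cross3 (Dj 1 (\<E>, V)) (Dj 2 (\<E>, V)) \<bullet> (Dl (\<E>, V) + (s - dt \<E>) *\<^sub>R nh \<E>)\<bar> \<le> cn * (\<bar>s\<bar> + (norm (V - Vh \<E>))\<^sup>2)"
      by (rule cn(2)[OF E V])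
  qed (use A \<rho> r m cn indep in auto)
  then show ?thesis by blast
qed

end

context crossing_setup
begin

text \<open>The configuration \<open>(\<E>, V)\<close> with the two orbits pulled apart along the normal \<open>nh \<E>\<close> until their
  signed distance is \<open>s\<close>. The critical point \<open>Vh \<E>\<close> stays where it is, and the actual configuration is
  recovered at \<open>s = dt \<E>\<close>.\<close>

definition De :: "(config \<times> real) \<times> (real ^ 2) \<Rightarrow> real ^ 3" where
  "De z = Dl (fst (fst z), snd z) + (snd (fst z) - dt (fst (fst z))) *\<^sub>R nh (fst (fst z))"

lemma De_Pair: "De ((\<E>, s), V) = Dl (\<E>, V) + (s - dt \<E>) *\<^sub>R nh \<E>"
  by (simp add: De_def)

lemma A0_U: "\<E> \<in> A0 \<Longrightarrow> \<E> \<in> U"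
  using A0(2) U1_D(1) by blast

abbreviation Y0 where "Y0 \<equiv> A0 \<times> (UNIV :: real set)"

lemma open_Y0V: "open (Y0 \<times> (UNIV :: (real ^ 2) set))"
  by (intro open_Times A0(1) open_UNIV)

lemma Ck_lift: 
  assumes "Ck k Z f"
  shows "Ck k (Y0 \<times> (UNIV :: (real ^ 2) set)) (\<lambda>z. f (fst (fst z), snd z))"
  by (rule Ck_compose[OF open_Y0V open_Z assms])
    (auto intro!: Ck_Pair Ck_fst' Ck_fst Ck_snd open_Y0V dest: A0_U[THEN inZ])

lemma Ck_lift_U1: 
  assumes "Ck k U1 f"
  shows "Ck k (Y0 \<times> (UNIV :: (real ^ 2) set)) (\<lambda>z. f (fst (fst z)))"
  by (rule Ck_compose[OF open_Y0V openU1 assms])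
    (use A0(2) in \<open>auto intro!: Ck_fst' Ck_fst open_Y0V\<close>)

lemma Ck_De: "Ck k (Y0 \<times> (UNIV :: (real ^ 2) set)) De"
  unfolding De_def[abs_def]
  by (intro Ck_add Ck_scaleR Ck_diff open_Y0V Ck_lift Ck_Dl Ck_lift_U1 Ck_nh Ck_dt Ck_snd' Ck_fst)

text \<open>The shift does not involve \<open>V\<close>, so the tangent vectors, and with them the
  normal of the layer, are those of the unshifted orbits.\<close>

lemma dir_deriv_De:
  assumes "\<E> \<in> A0"
  shows "dir_deriv (0, axis j 1) De ((\<E>, s), V) = Dj j (\<E>, V)"
proof -
  have "((\<lambda>V. De ((\<E>, s), V)) has_derivative (\<lambda>h. (h $ 1) *\<^sub>R Dj 1 (\<E>, V) + (h $ 2) *\<^sub>R Dj 2 (\<E>, V))) (at V)"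
    unfolding De_Pair by (intro has_derivative_add_const Dl_slice_derivative A0_U assms)
  then show ?thesis
    unfolding dir_deriv_slice using exhaust_2[of j] by (auto simp: dir_deriv_eq)
qed

sublocale lp0: layer_potential Y0 "ball Vc r" "cball Vc (r / 2)" pb qb De
proof unfold_locales
  show "open Y0" by (intro open_Times A0(1) open_UNIV)
  show "cball Vc (r / 2) \<subseteq> ball Vc r" using r by auto
  show "cball Vc (r / 2) \<subseteq> cbox pb qb" using r by (intro cball_box) simp
  show "Ck (Suc (Suc (Suc 0))) (Y0 \<times> ball Vc r) De" by (rule Ck_subset[OF Ck_De]) auto
  show "cross3 (dir_deriv (0, axis 1 1) De z) (dir_deriv (0, axis 2 1) De z) \<noteq> 0" if "z \<in> Y0 \<times> ball Vc r" for z
    using that indep by (auto simp: dir_deriv_De)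
qed auto

lemma no_De: "\<E> \<in> A0 \<Longrightarrow> lp0.no ((\<E>, s), V) = cross3 (Dj 1 (\<E>, V)) (Dj 2 (\<E>, V))"
  by (simp add: lp0.no_def lp0.ta_def lp0.tb_def dir_deriv_De)

sublocale lp: layer_potential_bounds Y0 "ball Vc r" "cball Vc (r / 2)" pb qb De
  "cball \<E>c \<rho> \<times> {- s0..s0}" snd "\<lambda>y. Vh (fst y)" m cn s0
proof unfold_locales
  show "compact (cball \<E>c \<rho> \<times> {- s0..s0})" by (intro compact_Times) auto
  show "cball \<E>c \<rho> \<times> {- s0..s0} \<subseteq> Y0" using A0 by auto
  show "Vh (fst y) \<in> cbox pb qb" if "y \<in> cball \<E>c \<rho> \<times> {- s0..s0}" for y
    using Vh_near[of "fst y"] that cball_box[of "r / 4"] r by auto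
  show "\<bar>snd y\<bar> \<le> s0" if "y \<in> cball \<E>c \<rho> \<times> {- s0..s0}" for y using that by auto
  show "m * sqrt ((snd y)\<^sup>2 + (norm (v - Vh (fst y)))\<^sup>2) \<le> norm (De (y, v))"
    if "y \<in> cball \<E>c \<rho> \<times> {- s0..s0}" "v \<in> cball Vc (r / 2)" for y v
    using that lower[of "fst y" v "snd y"] De_Pair[of "fst y" "snd y" v] by auto
  show "\<bar>lp0.no (y, v) \<bullet> De (y, v)\<bar> \<le> cn * (\<bar>snd y\<bar> + (norm (v - Vh (fst y)))\<^sup>2)"
    if "y \<in> cball \<E>c \<rho> \<times> {- s0..s0}" "v \<in> cball Vc (r / 2)" for y v
  proof -
    have "fst y \<in> cball \<E>c \<rho>" using that(1) by auto
    then show ?thesis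
      using normal[of "fst y" v "snd y"] that(2) A0(3) no_De[of "fst y" "snd y" v] De_Pair[of "fst y" "snd y" v] by auto
  qed
qed (use m cn in auto)

lemma K_props:
  assumes "\<E> \<in> cball \<E>c \<rho>"
  shows "\<E> \<in> A0" "\<E> \<in> U1" "\<E> \<in> U" "\<E> \<in> regular_pairs"
  using assms A0 A0_U U_reg by blast+

text \<open>Periodicity brings \<open>V\<close> into the box; outside the small ball
  \<open>away\<close> applies, inside it \<open>lower\<close> with \<open>s = dt \<E>\<close>, where
  the shift vanishes.\<close>

lemma Dl_nonzero:
  assumes E: "\<E> \<in> cball \<E>c \<rho>" and d: "dt \<E> \<noteq> 0"
  shows "Dl (\<E>, V) \<noteq> 0"
proof -
  obtain V' n where V': "\<forall>i. pb $ i \<le> V' $ i \<and> V' $ i < pb $ i + 2 * pi" "Delta k0 \<E> V' = Delta k0 \<E> V"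
    using reduce_Delta[OF K_props(4)[OF E], of pb k0 V] by blast
  have box: "V' \<in> cbox pb qb"
    using V'(1) unfolding qb_eq by (simp add: mem_box_cart less_imp_le)
  have "Dl (\<E>, V') \<noteq> 0"
  proof (cases "V' \<in> ball Vc (r / 4)")
    case False
    then show ?thesis by (rule away[OF E box])
  next
    case True
    have "m * sqrt ((dt \<E>)\<^sup>2 + (norm (V' - Vh \<E>))\<^sup>2) \<le> norm (Dl (\<E>, V') + (dt \<E> - dt \<E>) *\<^sub>R nh \<E>)"
      by (rule lower[OF E]) (use True r in auto)
    moreover have "0 < m * sqrt ((dt \<E>)\<^sup>2 + (norm (V' - Vh \<E>))\<^sup>2)"
      using m d by (simp add: add_pos_nonneg)
    ultimately show ?thesis by auto
  qed
  then show ?thesis using V'(2) by (simp add: Dl_def)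
qed

definition dirY :: "5 \<Rightarrow> config \<times> (real ^ 2)" where "dirY i = (asteroid_dir i, 0)"

lemma dR_formula:
  assumes E: "\<E> \<in> cball \<E>c \<rho>" and d: "dt \<E> \<noteq> 0"
  shows "dR k0 \<mu> i \<E> V = - (\<mu> * k0\<^sup>2) * (dir_deriv (dirY i) Dl (\<E>, V) \<bullet> newton (Dl (\<E>, V)) + dir_deriv (dirY i) (indirect k0) (\<E>, V))"
proof -
  have "Dl = (\<lambda>z. Delta k0 (fst z) (snd z))" by (simp add: Dl_def fun_eq_iff)
  then show ?thesis
    using dR_eq[OF K_props(4)[OF E] k0, of V \<mu> i] Dl_nonzero[OF E d, of V] by (simp add: dirY_def)
qed

lemma Ck_Vslice:
  assumes "Ck k Z f" "\<E> \<in> U"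
  shows "continuous_on S (\<lambda>V. f (\<E>, V))"
  by (rule continuous_on_compose2[OF Ck_continuous_on[OF assms(1)]])
    (use inZ[OF assms(2)] in \<open>auto intro!: continuous_intros\<close>)

lemma dR_continuous:
  assumes E: "\<E> \<in> cball \<E>c \<rho>" and d: "dt \<E> \<noteq> 0"
  shows "continuous_on UNIV (dR k0 \<mu> i \<E>)"
proof -
  have EU: "\<E> \<in> U" by (rule K_props(3)[OF E])
  have D: "continuous_on UNIV (\<lambda>V. Dl (\<E>, V))" by (rule Ck_Vslice[OF Ck_Dl[of 0] EU])
  have "continuous_on UNIV (\<lambda>V. newton (Dl (\<E>, V)))"
    unfolding newton_def using Dl_nonzero[OF E d] by (intro continuous_intros D) auto
  then show ?thesis
    unfolding dR_formula[OF E d, abs_def]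
    by (intro continuous_intros Ck_Vslice[OF Ck_dir_deriv[OF Ck_Dl[of "Suc 0"]] EU]
        Ck_Vslice[OF Ck_dir_deriv[OF Ck_indirect[OF k0, of "Suc 0"]] EU])
qed

lemma dt_line:
  assumes E: "\<E> \<in> U1"
  shows "((\<lambda>t. dt (\<E> + t *\<^sub>R a)) has_real_derivative nh \<E> \<bullet> dir_deriv (a, 0) Dl (\<E>, Vh \<E>)) (at 0)"
    and "dir_deriv a dt \<E> = nh \<E> \<bullet> dir_deriv (a, 0) Dl (\<E>, Vh \<E>)"
proof -
  show eq: "dir_deriv a dt \<E> = nh \<E> \<bullet> dir_deriv (a, 0) Dl (\<E>, Vh \<E>)"
    by (rule dir_deriv_eq[OF dt_has_derivative[OF E]])
  have "dt differentiable (at (\<E> + 0 *\<^sub>R a))" using Ck_imp_differentiable[OF Ck_dt E] by simp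
  from dir_deriv_line[OF this]
  show "((\<lambda>t. dt (\<E> + t *\<^sub>R a)) has_real_derivative nh \<E> \<bullet> dir_deriv (a, 0) Dl (\<E>, Vh \<E>)) (at 0)"
    by (simp add: has_real_derivative_iff_has_vector_derivative eq)
qed

abbreviation inv_sqrt_det where "inv_sqrt_det \<equiv> \<lambda>\<E>. 1 / sqrt (det (A_h k0 Vh \<E>))"

lemma Ck_inv_sqrt_det: "Ck k U1 inv_sqrt_det"
  unfolding det_A_h using U1_D(2)
  by (intro Ck_divide Ck_sqrt Ck_const openU1 Ck_graph Ck_hdet) (auto simp: less_imp_neq[symmetric])

lemma inv_sqrt_det_line:
  assumes "\<E> \<in> U1"
  shows "(\<lambda>t. inv_sqrt_det (\<E> + t *\<^sub>R a)) differentiable (at 0)"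
proof -
  have "inv_sqrt_det differentiable (at (\<E> + 0 *\<^sub>R a))"
    using Ck_imp_differentiable[OF Ck_inv_sqrt_det assms] by simp
  from dir_deriv_line[OF this] show ?thesis
    by (rule differentiableI_vector)
qed

definition jump_rhs where
  "jump_rhs \<mu> i \<E> = \<mu> * k0\<^sup>2 / pi * (dir_deriv (asteroid_dir i) inv_sqrt_det \<E> * dt \<E>
    + inv_sqrt_det \<E> * dir_deriv (asteroid_dir i) dt \<E>)"

lemma Ck_jump_rhs: "Ck k U1 (jump_rhs \<mu> i)"
  unfolding jump_rhs_def[abs_def]
  by (intro Ck_mult[OF openU1 Ck_const] Ck_add Ck_mult openU1 Ck_dir_deriv Ck_inv_sqrt_det Ck_dt)

text \<open>At signed distance 0 the determinant of \<open>A_h\<close> is the square of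
  \<open>norm (no0 \<E>)\<close>, and its derivative is multiplied by 0.\<close>

lemma jump_rhs_crossing:
  assumes E: "\<E> \<in> U1" and 0: "dt \<E> = 0"
  shows "jump_rhs \<mu> i \<E> = \<mu> * k0\<^sup>2 / pi * (nh \<E> \<bullet> dir_deriv (dirY i) Dl (\<E>, Vh \<E>)) / norm (no0 \<E>)"
proof -
  have "Dl (\<E>, Vh \<E>) = 0" using Dl_h[OF E] 0 by simp
  then have "hdet (\<E>, Vh \<E>) / 4 = (norm (no0 \<E>))\<^sup>2"
    using hdet_crossing[OF inZ[OF U1_D(1)[OF E]]] by (simp add: no0_def)
  then have "inv_sqrt_det \<E> = 1 / norm (no0 \<E>)" by (simp add: det_A_h)
  then show ?thesis by (simp add: jump_rhs_def 0 dt_line(2)[OF E] dirY_def)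
qed

lemma one_sided_extensions:
  "\<exists>Rplus Rminus :: config \<Rightarrow> real.
    (\<exists>C. C-lipschitz_on (ball \<E>c \<rho>) Rplus) \<and> (\<exists>C. C-lipschitz_on (ball \<E>c \<rho>) Rminus) \<and>
    (\<forall>\<E>\<in>ball \<E>c \<rho>. dt \<E> > 0 \<longrightarrow> Rplus \<E> = averaged_dR k0 \<mu> i \<E>) \<and>
    (\<forall>\<E>\<in>ball \<E>c \<rho>. dt \<E> < 0 \<longrightarrow> Rminus \<E> = averaged_dR k0 \<mu> i \<E>) \<and>
    (\<forall>\<E>\<in>ball \<E>c \<rho>. Rminus \<E> - Rplus \<E> = jump_rhs \<mu> i \<E>)"
proof -
  let ?W = "ball \<E>c \<rho>" and ?K = "cball \<E>c \<rho>"
  have WK: "\<E> \<in> ?W \<Longrightarrow> \<E> \<in> ?K" for \<E> by simp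
  have KU1: "?K \<subseteq> U1" using K_props(2) by blast
  have KZ: "?K \<times> cbox pb qb \<subseteq> Z" using K_props(4) by auto
  \<comment> \<open>The cutoff is 1 on the ball that contains every \<open>Vh \<E>\<close> and
    vanishes off the ball on which the layer bounds hold.\<close>
  obtain ph :: "real ^ 2 \<Rightarrow> real" where ph: "Ck (Suc (Suc 0)) UNIV ph" "\<forall>v\<in>cball Vc (r / 4). ph v = 1"
      "\<forall>v. v \<notin> cball Vc (r / 2) \<longrightarrow> ph v = 0"
    using cutoff_exists[of "r / 4" "r / 2" Vc] r by auto
  define w0 where "w0 = dir_deriv (dirY i) Dl"
  define ind where "ind = dir_deriv (dirY i) (indirect k0)"
  \<comment> \<open>The density of the singular part near the crossing point; it does not depend on
    the shift.\<close>
  define w where "w z = ph (snd z) *\<^sub>R w0 (fst (fst z), snd z)" for z :: "(config \<times> real) \<times> (real ^ 2)"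
  \<comment> \<open>The rest of the direct term: the factor \<open>1 - ph\<close> vanishes near the
    only place of the period box where \<open>Dl\<close> can be 0.\<close>
  define F2 where "F2 z = (1 - ph (snd z)) * (w0 z \<bullet> newton (Dl z))" for z
  \<comment> \<open>The factor in \<open>dR_formula\<close> divided by the area of the
    torus.\<close>
  define \<kappa> where "\<kappa> = - (\<mu> * k0\<^sup>2) / (2 * pi)\<^sup>2"
  define Sm where "Sm \<E> = \<kappa> * (integral (cbox pb qb) (\<lambda>V. F2 (\<E>, V)) + integral (cbox pb qb) (\<lambda>V. ind (\<E>, V)))" for \<E>
  have Ck_w0: "Ck k Z w0" for k unfolding w0_def by (intro Ck_dir_deriv Ck_Dl)
  have Ck_ind: "Ck k Z ind" for k unfolding ind_def by (intro Ck_dir_deriv Ck_indirect k0)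
  have w: "Ck (Suc (Suc 0)) (Y0 \<times> ball Vc r) w" "lp0.off_C w"
  proof -
    have "Ck (Suc (Suc 0)) (Y0 \<times> (UNIV :: (real ^ 2) set)) w"
      unfolding w_def[abs_def]
      by (intro Ck_scaleR open_Y0V Ck_lift Ck_w0 Ck_compose[OF open_Y0V open_UNIV ph(1)] Ck_snd) simp
    then show "Ck (Suc (Suc 0)) (Y0 \<times> ball Vc r) w" by (rule Ck_subset) auto
    show "lp0.off_C w" using ph(3) by (auto simp: lp0.off_C_def w_def)
  qed
  define Q2 where "Q2 = (Z \<inter> Dl -` (- {0})) \<union> regular_pairs \<times> ball Vc (r / 4)"
  have F2: "Ck (Suc 0) Q2 F2"
    unfolding Q2_def
  proof (rule Ck_Un)
    show o1: "open (Z \<inter> Dl -` (- {0}))"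
      by (rule continuous_open_preimage[OF Ck_continuous_on[OF Ck_Dl] open_Z]) auto
    show o2: "open (regular_pairs \<times> ball Vc (r / 4))" by (intro open_Times open_regular_pairs open_ball)
    show "Ck (Suc 0) (Z \<inter> Dl -` (- {0})) F2"
      unfolding F2_def[abs_def]
      by (intro Ck_mult Ck_diff Ck_const Ck_inner Ck_newton o1 Ck_compose[OF o1 open_UNIV Ck_SucD[OF ph(1)]] Ck_snd
          Ck_subset[OF Ck_w0] Ck_subset[OF Ck_Dl]) auto
    show "Ck (Suc 0) (regular_pairs \<times> ball Vc (r / 4)) F2"
      by (rule Ck_cong[OF o2 _ Ck_const[OF o2, of _ 0]]) (use ph(2) in \<open>auto simp: F2_def\<close>)
  qed
  have KQ2: "?K \<times> cbox pb qb \<subseteq> Q2"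
    unfolding Q2_def using away K_props(4) by fastforce
  have F2_cont: "(\<lambda>V. F2 (\<E>, V)) integrable_on cbox pb qb" if "\<E> \<in> ?K" for \<E>
    by (intro integrable_continuous continuous_on_compose2[OF Ck_continuous_on[OF F2]] continuous_intros)
      (use that KQ2 in auto)
  have ind_int: "(\<lambda>V. ind (\<E>, V)) integrable_on cbox pb qb" if "\<E> \<in> ?K" for \<E>
    by (intro integrable_continuous Ck_Vslice[OF Ck_ind[of 0] K_props(3)[OF that]])
  obtain L1 where L1: "L1 \<ge> 0" "\<And>x y. x \<in> ?K \<Longrightarrow> y \<in> ?K \<Longrightarrow> norm (dt x - dt y) \<le> L1 * norm (x - y)"
    using Ck_lipschitz[OF Ck_dt compact_cball convex_cball KU1] by blast
  obtain L2 where L2: "L2 \<ge> 0" "\<And>x y. x \<in> ?K \<Longrightarrow> y \<in> ?K \<Longrightarrow> norm (jump_rhs \<mu> i x - jump_rhs \<mu> i y) \<le> L2 * norm (x - y)"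
    using Ck_lipschitz[OF Ck_jump_rhs compact_cball convex_cball KU1] by blast
  obtain La where La: "La \<ge> 0" "\<forall>x\<in>?K. \<forall>y\<in>?K. \<bar>integral (cbox pb qb) (\<lambda>v. F2 (x, v)) - integral (cbox pb qb) (\<lambda>v. F2 (y, v))\<bar> \<le> La * norm (x - y)"
    using integral_lipschitz_param[OF F2 compact_cball convex_cball KQ2] by blast
  obtain Lb where Lb: "Lb \<ge> 0" "\<forall>x\<in>?K. \<forall>y\<in>?K. \<bar>integral (cbox pb qb) (\<lambda>v. ind (x, v)) - integral (cbox pb qb) (\<lambda>v. ind (y, v))\<bar> \<le> Lb * norm (x - y)"
    using integral_lipschitz_param[OF Ck_ind compact_cball convex_cball KZ] by blast
  obtain L where L: "L \<ge> 0" "\<forall>x y. (\<forall>z\<in>closed_segment x y. z \<in> ?K \<times> {- s0..s0} \<and> snd z \<noteq> 0) \<longrightarrow>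
    \<bar>lp0.potential w x - lp0.potential w y\<bar> \<le> L * norm (x - y)"
    using lp.potential_lipschitz[OF w] by blast
  define S where "S k = s0 * inverse (real (Suc k))" for k
  have S: "S \<longlonglongrightarrow> 0" "0 < S k" "S k \<le> s0" for k
  proof -
    show "S \<longlonglongrightarrow> 0" unfolding S_def using tendsto_mult_left[OF LIMSEQ_inverse_real_of_nat, of s0] by simp
    show "0 < S k" "S k \<le> s0" using s0 by (auto simp: S_def field_simps)
  qed
  show ?thesis
  proof (rule lipschitz_two_sided_extension[where N = "lp0.potential w" and \<kappa> = \<kappa> and Sm = Sm and S = S and L = L
        and ?L1.0 = L1 and ?L2.0 = L2 and ?L3.0 = "\<bar>\<kappa>\<bar> * (La + Lb)" and ?s0.0 = s0
        and j = "\<lambda>\<E>. 4 * pi * (w0 (\<E>, Vh \<E>) \<bullet> nh \<E>) / norm (no0 \<E>)"])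
    show "convex ?W" by simp
    show "continuous_on ?W dt"
      using KU1 by (intro continuous_on_subset[OF Ck_continuous_on[OF Ck_dt]]) auto
    show "\<bar>dt x - dt y\<bar> \<le> L1 * norm (x - y)" if "x \<in> ?W" "y \<in> ?W" for x y
      using L1(2)[OF WK[OF that(1)] WK[OF that(2)]] by simp
    show "\<bar>dt x\<bar> \<le> s0" if "x \<in> ?W" for x by (rule dt_bound[OF WK[OF that]])
    show "S \<longlonglongrightarrow> 0" "0 < S k" "S k \<le> s0" for k by (fact S)+
    show "L \<ge> 0" "L1 \<ge> 0" "L2 \<ge> 0" "0 \<le> \<bar>\<kappa>\<bar> * (La + Lb)" using L L1 L2 La Lb by auto
    show "\<bar>jump_rhs \<mu> i x - jump_rhs \<mu> i y\<bar> \<le> L2 * norm (x - y)" if "x \<in> ?W" "y \<in> ?W" for x y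
      using L2(2)[OF WK[OF that(1)] WK[OF that(2)]] by simp
    show "\<bar>Sm x - Sm y\<bar> \<le> \<bar>\<kappa>\<bar> * (La + Lb) * norm (x - y)" if "x \<in> ?W" "y \<in> ?W" for x y
    proof -
      let ?a = "\<lambda>x. integral (cbox pb qb) (\<lambda>V. F2 (x, V))" and ?b = "\<lambda>x. integral (cbox pb qb) (\<lambda>V. ind (x, V))"
      have "\<bar>(?a x + ?b x) - (?a y + ?b y)\<bar> \<le> La * norm (x - y) + Lb * norm (x - y)"
        using La(2)[rule_format, OF WK[OF that(1)] WK[OF that(2)]] Lb(2)[rule_format, OF WK[OF that(1)] WK[OF that(2)]] by linarith
      then have "\<bar>\<kappa>\<bar> * \<bar>(?a x + ?b x) - (?a y + ?b y)\<bar> \<le> \<bar>\<kappa>\<bar> * (La * norm (x - y) + Lb * norm (x - y))"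
        by (rule mult_left_mono) simp
      moreover have "\<bar>Sm x - Sm y\<bar> = \<bar>\<kappa>\<bar> * \<bar>(?a x + ?b x) - (?a y + ?b y)\<bar>"
        unfolding Sm_def right_diff_distrib[symmetric] abs_mult ..
      ultimately show ?thesis by (simp add: algebra_simps)
    qed
    show "\<bar>lp0.potential w (x, s) - lp0.potential w (y, t)\<bar> \<le> L * (norm (x - y) + \<bar>s - t\<bar>)"
      if xy: "x \<in> ?W" "y \<in> ?W" and st: "s * t > 0" "\<bar>s\<bar> \<le> s0" "\<bar>t\<bar> \<le> s0" for x y s t
    proof -
      \<comment> \<open>As \<open>s\<close> and \<open>t\<close> have the same sign, the segment
        stays on one side, which is convex in the shifted coordinates.\<close>
      have "z \<in> ?K \<times> {- s0..s0} \<and> snd z \<noteq> 0" if z: "z \<in> closed_segment (x, s) (y, t)" for z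
      proof
        have "closed_segment (x, s) (y, t) \<subseteq> ?K \<times> {- s0..s0}"
          using xy st by (intro closed_segment_subset convex_Times) auto
        then show "z \<in> ?K \<times> {- s0..s0}" using z by blast
        obtain u where u: "0 \<le> u" "u \<le> 1" "z = (1 - u) *\<^sub>R (x, s) + u *\<^sub>R (y, t)"
          using z by (auto simp: closed_segment_def)
        then have "snd z = (1 - u) * s + u * t" by simp
        also have "\<dots> \<in> closed_segment s t" using u by (auto simp: closed_segment_def)
        finally show "snd z \<noteq> 0"
          using st(1) by (auto simp: closed_segment_eq_real_ivl zero_less_mult_iff split: if_splits)
      qed
      then have "\<bar>lp0.potential w (x, s) - lp0.potential w (y, t)\<bar> \<le> L * norm ((x, s) - (y, t))" using L(2) by blast
      also have "\<dots> \<le> L * (norm (x - y) + \<bar>s - t\<bar>)"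
        using L(1) by (intro mult_left_mono) (auto simp: norm_Pair intro: order_trans[OF sqrt_sum_squares_le_sum_abs])
      finally show ?thesis .
    qed
    show "averaged_dR k0 \<mu> i x = \<kappa> * lp0.potential w (x, dt x) + Sm x" if x: "x \<in> ?W" "dt x \<noteq> 0" for x
    proof -
      have xK: "x \<in> ?K" and reg: "x \<in> regular_pairs" using WK[OF x(1)] K_props(4) by blast+
      have DeDl: "De ((x, dt x), V) = Dl (x, V)" for V by (simp add: De_Pair)
      have good: "lp0.good (x, dt x)"
        using K_props(1)[OF xK] Dl_nonzero[OF xK x(2)] by (simp add: lp0.good_def DeDl)
      have pot_int: "(\<lambda>V. w ((x, dt x), V) \<bullet> newton (De ((x, dt x), V))) integrable_on cbox pb qb"
        by (intro integrable_continuous lp0.continuous_slice[OF lp0.Ck_field[OF _ Ck_SucD[OF Ck_SucD[OF w(1)]]] lp0.off_C_field[OF w(2)] good]) simp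
      have split: "dR k0 \<mu> i x V = - (\<mu> * k0\<^sup>2) *
          (w ((x, dt x), V) \<bullet> newton (De ((x, dt x), V)) + F2 (x, V) + ind (x, V))" for V
        unfolding dR_formula[OF xK x(2)] by (simp add: w_def F2_def w0_def ind_def DeDl algebra_simps)
      \<comment> \<open>Off the crossing set the integrand is continuous and periodic, so the
        standard period box may be exchanged for the one centred at the crossing point.\<close>
      have "integral torus_box (dR k0 \<mu> i x) = integral (cbox pb qb) (dR k0 \<mu> i x)"
        unfolding torus_box_eq qb_eq
        by (rule integral_periodic_shift[symmetric, OF dR_continuous[OF xK x(2)]]) (use dR_periodic[OF reg] in auto)
      also have "\<dots> = - (\<mu> * k0\<^sup>2) * integral (cbox pb qb)
          (\<lambda>V. w ((x, dt x), V) \<bullet> newton (De ((x, dt x), V)) + F2 (x, V) + ind (x, V))"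
        unfolding split[abs_def] by (rule integral_mult_right)
      also have "integral (cbox pb qb) (\<lambda>V. w ((x, dt x), V) \<bullet> newton (De ((x, dt x), V)) + F2 (x, V) + ind (x, V)) =
          lp0.potential w (x, dt x) + integral (cbox pb qb) (\<lambda>V. F2 (x, V)) + integral (cbox pb qb) (\<lambda>V. ind (x, V))"
        unfolding lp0.potential_def
        by (intro integral_unique has_integral_add integrable_integral pot_int F2_cont[OF xK] ind_int[OF xK])
      finally have int: "integral torus_box (dR k0 \<mu> i x) = - (\<mu> * k0\<^sup>2) *
          (lp0.potential w (x, dt x) + integral (cbox pb qb) (\<lambda>V. F2 (x, V)) + integral (cbox pb qb) (\<lambda>V. ind (x, V)))" .
      have "1 / T * (M * (P + F + I)) = M / T * P + M / T * (F + I)" for T M P F I :: real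
        by (simp add: algebra_simps add_divide_distrib)
      then show ?thesis unfolding averaged_dR_def int Sm_def \<kappa>_def .
    qed
    fix x assume x: "x \<in> ?W" "dt x = 0"
    have xK: "x \<in> ?K" using WK[OF x(1)] .
    note xp = K_props[OF xK]
    have ph1: "ph (Vh x) = 1" using ph(2) Vh_near[OF xK] by auto
    \<comment> \<open>The constants agree because
      \<open>4 * pi / (2 * pi)\<^sup>2 = 1 / pi\<close>.\<close>
    show "jump_rhs \<mu> i x = - \<kappa> * (4 * pi * (w0 (x, Vh x) \<bullet> nh x) / norm (no0 x))"
      unfolding jump_rhs_crossing[OF xp(2) x(2)] \<kappa>_def w0_def
      by (simp add: inner_commute power2_eq_square)
    \<comment> \<open>At a crossing the shift starts from 0, so \<open>De\<close> is the layer plus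
      a multiple of a fixed unit normal, as \<open>potential_jump\<close> requires.\<close>
    have De0: "De ((x, s), V) = Dl (x, V) + s *\<^sub>R nh x" for s V by (simp add: De_Pair x(2))
    have "(\<lambda>k. integral (cbox pb qb) (\<lambda>v. (ph v *\<^sub>R w0 (x, v)) \<bullet> newton (Dl (x, v) + S k *\<^sub>R nh x)) -
        integral (cbox pb qb) (\<lambda>v. (ph v *\<^sub>R w0 (x, v)) \<bullet> newton (Dl (x, v) + (- S k) *\<^sub>R nh x)))
      \<longlonglongrightarrow> 4 * pi * ((ph (Vh x) *\<^sub>R w0 (x, Vh x)) \<bullet> nh x) / norm (cross3 (Dj 1 (x, Vh x)) (Dj 2 (x, Vh x)))"
    proof (rule potential_jump[where C = "cball Vc (r / 2)" and ?s0.0 = s0 and m = m])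
      show "continuous_on UNIV (\<lambda>v. ph v *\<^sub>R w0 (x, v))"
        by (intro continuous_on_scaleR Ck_continuous_on[OF ph(1)] Ck_Vslice[OF Ck_w0[of 0] xp(3)])
      show "ph v *\<^sub>R w0 (x, v) = 0" if "v \<notin> cball Vc (r / 2)" for v using ph(3) that by simp
      show "cball Vc (r / 2) \<subseteq> cbox pb qb" by (rule lp0.Cbox)
      show "((\<lambda>v. Dl (x, v)) has_derivative (\<lambda>u. (u $ 1) *\<^sub>R Dj 1 (x, Vh x) + (u $ 2) *\<^sub>R Dj 2 (x, Vh x))) (at (Vh x))"
        by (rule Dl_slice_derivative[OF xp(3)])
      show "Dl (x, Vh x) = 0" using Dl_h[OF xp(2)] x(2) by simp
      show "norm (nh x) = 1" by (rule norm_nh[OF xp(2)])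
      show "nh x \<bullet> Dj 1 (x, Vh x) = 0" "nh x \<bullet> Dj 2 (x, Vh x) = 0" by (rule nh_Dj[OF xp(2)])+
      show "cross3 (Dj 1 (x, Vh x)) (Dj 2 (x, Vh x)) \<noteq> 0" using U1_D(3)[OF xp(2)] by (simp add: no0_def)
      show "m * sqrt (s\<^sup>2 + (norm (v - Vh x))\<^sup>2) \<le> norm (Dl (x, v) + s *\<^sub>R nh x)" if "v \<in> cball Vc (r / 2)" for v s
        using lower[OF xK that, of s] x(2) by simp
      show "m > 0" by (rule m)
      show "S \<longlonglongrightarrow> 0" "0 < S k" "S k \<le> s0" for k by (fact S)+
      show "continuous_on UNIV (\<lambda>v. (ph v *\<^sub>R w0 (x, v)) \<bullet> newton (Dl (x, v) + s *\<^sub>R nh x))" if s: "s \<noteq> 0" "\<bar>s\<bar> \<le> s0" for s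
      proof -
        have good: "lp0.good (x, s)" by (rule lp.K_good) (use xK s in auto)
        have "Ck 0 UNIV (\<lambda>v. w ((x, s), v) \<bullet> newton (De ((x, s), v)))"
          by (rule lp0.Ck_extend_slice[OF lp0.Ck_field[OF _ Ck_SucD[OF Ck_SucD[OF w(1)]]] lp0.off_C_field[OF w(2)] good]) simp
        then show ?thesis by (simp add: w_def De0)
      qed
    qed
    then show "(\<lambda>k. lp0.potential w (x, S k) - lp0.potential w (x, - S k)) \<longlonglongrightarrow>
        4 * pi * (w0 (x, Vh x) \<bullet> nh x) / norm (no0 x)"
      by (simp add: lp0.potential_def w_def De0 ph1 no0_def)
  qed
qed

text \<open>One ball serves all four elements, because its radius is fixed before the index
  \<open>i\<close> is chosen.\<close>

lemma averaged_derivative_extensions: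
  "\<exists>W. open W \<and> \<E>c \<in> W \<and> W \<subseteq> U \<and>
    (\<forall>\<E>\<in>W. dt \<E> \<noteq> 0 \<longrightarrow> (\<forall>V. kepler_dist k0 \<E> V \<noteq> 0)) \<and>
    (\<forall>i\<in>Y_indices.
      (\<forall>\<E>\<in>W. dt \<E> \<noteq> 0 \<longrightarrow> dR k0 \<mu> i \<E> integrable_on torus_box) \<and>
      (\<forall>\<E>\<in>W. ((\<lambda>t. dt (\<E> + t *\<^sub>R asteroid_dir i)) has_real_derivative
          sgn (tau3 k0 Vh \<E>) \<bullet> dir_deriv (asteroid_dir i) (\<lambda>\<E>'. Delta k0 \<E>' (Vh \<E>)) \<E>) (at 0)) \<and>
      (\<forall>\<E>\<in>W. (\<lambda>t. 1 / sqrt (det (A_h k0 Vh (\<E> + t *\<^sub>R asteroid_dir i)))) differentiable (at 0)) \<and>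
      (\<exists>Rplus Rminus :: config \<Rightarrow> real.
        (\<exists>C. C-lipschitz_on W Rplus) \<and> (\<exists>C. C-lipschitz_on W Rminus) \<and>
        (\<forall>\<E>\<in>W. dt \<E> > 0 \<longrightarrow> Rplus \<E> = averaged_dR k0 \<mu> i \<E>) \<and>
        (\<forall>\<E>\<in>W. dt \<E> < 0 \<longrightarrow> Rminus \<E> = averaged_dR k0 \<mu> i \<E>) \<and>
        (\<forall>\<E>\<in>W. Rminus \<E> - Rplus \<E> =
          \<mu> * k0\<^sup>2 / pi *
            (dir_deriv (asteroid_dir i) (\<lambda>\<E>. 1 / sqrt (det (A_h k0 Vh \<E>))) \<E> * dt \<E>
             + 1 / sqrt (det (A_h k0 Vh \<E>)) * dir_deriv (asteroid_dir i) dt \<E>))))"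
proof (intro exI[of _ "ball \<E>c \<rho>"] conjI ballI impI allI)
  show "open (ball \<E>c \<rho>)" "\<E>c \<in> ball \<E>c \<rho>" using \<rho> by auto
  show "ball \<E>c \<rho> \<subseteq> U" using K_props(3) by auto
  fix \<E> assume "\<E> \<in> ball \<E>c \<rho>"
  then have E: "\<E> \<in> cball \<E>c \<rho>" by simp
  show "kepler_dist k0 \<E> V \<noteq> 0" if "dt \<E> \<noteq> 0" for V
    using Dl_nonzero[OF E that, of V] by (simp add: kepler_dist_def Dl_def)
  fix i :: 5
  show "dR k0 \<mu> i \<E> integrable_on torus_box" if "dt \<E> \<noteq> 0"
    unfolding torus_box_eq
    by (intro integrable_continuous continuous_on_subset[OF dR_continuous[OF E that]]) simp
  have "dir_deriv (asteroid_dir i, 0) Dl (\<E>, Vh \<E>) = dir_deriv (asteroid_dir i) (\<lambda>\<E>'. Delta k0 \<E>' (Vh \<E>)) \<E>"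
    by (simp add: dir_deriv_slice_fst Dl_def)
  then show "((\<lambda>t. dt (\<E> + t *\<^sub>R asteroid_dir i)) has_real_derivative
      sgn (tau3 k0 Vh \<E>) \<bullet> dir_deriv (asteroid_dir i) (\<lambda>\<E>'. Delta k0 \<E>' (Vh \<E>)) \<E>) (at 0)"
    using dt_line(1)[OF K_props(2)[OF E], of "asteroid_dir i"] by (simp add: nh_def)
  show "(\<lambda>t. 1 / sqrt (det (A_h k0 Vh (\<E> + t *\<^sub>R asteroid_dir i)))) differentiable (at 0)"
    by (rule inv_sqrt_det_line[OF K_props(2)[OF E]])
next
  fix i :: 5
  show "\<exists>Rplus Rminus :: config \<Rightarrow> real.
      (\<exists>C. C-lipschitz_on (ball \<E>c \<rho>) Rplus) \<and> (\<exists>C. C-lipschitz_on (ball \<E>c \<rho>) Rminus) \<and>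
      (\<forall>\<E>\<in>ball \<E>c \<rho>. dt \<E> > 0 \<longrightarrow> Rplus \<E> = averaged_dR k0 \<mu> i \<E>) \<and>
      (\<forall>\<E>\<in>ball \<E>c \<rho>. dt \<E> < 0 \<longrightarrow> Rminus \<E> = averaged_dR k0 \<mu> i \<E>) \<and>
      (\<forall>\<E>\<in>ball \<E>c \<rho>. Rminus \<E> - Rplus \<E> =
        \<mu> * k0\<^sup>2 / pi *
          (dir_deriv (asteroid_dir i) (\<lambda>\<E>. 1 / sqrt (det (A_h k0 Vh \<E>))) \<E> * dt \<E>
           + 1 / sqrt (det (A_h k0 Vh \<E>)) * dir_deriv (asteroid_dir i) dt \<E>))"
    using one_sided_extensions[of \<mu> i] unfolding jump_rhs_def .
qed

end

theorem theorem4p2: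
  fixes k0 \<mu> :: real and \<E>c :: config and U :: "config set" and Vh :: "config \<Rightarrow> real ^ 2"
  assumes "k0 > 0" and "\<mu> > 0"
    and "\<E>c \<in> regular_elements \<times> regular_elements"
    and "non_degenerate k0 \<E>c"
    and "crossing k0 \<E>c" and "one_crossing_point k0 \<E>c"
    and "local_min_continuation k0 \<E>c U Vh"
    and "kepler_dist k0 \<E>c (Vh \<E>c) = 0"
  shows "\<exists>W. open W \<and> \<E>c \<in> W \<and> W \<subseteq> U \<and>
    (\<forall>\<E>\<in>W. signed_dist k0 Vh \<E> \<noteq> 0 \<longrightarrow> (\<forall>V. kepler_dist k0 \<E> V \<noteq> 0)) \<and>
    (\<forall>i\<in>Y_indices.
      (\<forall>\<E>\<in>W. signed_dist k0 Vh \<E> \<noteq> 0 \<longrightarrow> dR k0 \<mu> i \<E> integrable_on torus_box) \<and>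
      (\<forall>\<E>\<in>W. ((\<lambda>t. signed_dist k0 Vh (\<E> + t *\<^sub>R asteroid_dir i)) has_real_derivative
          sgn (tau3 k0 Vh \<E>) \<bullet> dir_deriv (asteroid_dir i) (\<lambda>\<E>'. Delta k0 \<E>' (Vh \<E>)) \<E>) (at 0)) \<and>
      (\<forall>\<E>\<in>W. (\<lambda>t. 1 / sqrt (det (A_h k0 Vh (\<E> + t *\<^sub>R asteroid_dir i)))) differentiable (at 0)) \<and>
      (\<exists>Rplus Rminus :: config \<Rightarrow> real.
        (\<exists>C. C-lipschitz_on W Rplus) \<and> (\<exists>C. C-lipschitz_on W Rminus) \<and>
        (\<forall>\<E>\<in>W. signed_dist k0 Vh \<E> > 0 \<longrightarrow> Rplus \<E> = averaged_dR k0 \<mu> i \<E>) \<and>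
        (\<forall>\<E>\<in>W. signed_dist k0 Vh \<E> < 0 \<longrightarrow> Rminus \<E> = averaged_dR k0 \<mu> i \<E>) \<and>
        (\<forall>\<E>\<in>W. Rminus \<E> - Rplus \<E> =
          \<mu> * k0\<^sup>2 / pi *
            (dir_deriv (asteroid_dir i) (\<lambda>\<E>. 1 / sqrt (det (A_h k0 Vh \<E>))) \<E> * signed_dist k0 Vh \<E>
             + 1 / sqrt (det (A_h k0 Vh \<E>)) * dir_deriv (asteroid_dir i) (signed_dist k0 Vh) \<E>))))"
proof -
  interpret crossing_config k0 \<E>c U Vh
    using assms by unfold_locales
  obtain A0 \<rho> r m cn s0 where "crossing_setup k0 \<E>c U Vh A0 \<rho> r m cn s0"
    using crossing_setup_exists by blast
  then show ?thesis by (rule crossing_setup.averaged_derivative_extensions)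
qed

end
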